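(* Let $d\geq 3$. The homogeneous prime ideal $\mathcal{I}(\mathcal{M}^{\mathrm{IG}}_d)\subseteq\mathbb{C}[m_0,\ldots,m_d]$ of the $d$th inverse Gaussian moment variety $\mathcal{M}^{\mathrm{IG}}_d\subseteq\mathbb{P}^d$ is generated by $\binom{d-1}{3}$ cubics and $\binom{d-1}{2}$ quartics, given by the maximal minors of the $(3\times d)$-matrix $$H_d^{\mathrm{IG}}=\begin{pmatrix} m_0^2 & m_0 & m_1 & m_2 & m_3&\cdots& m_{d-2}\\ 0 & m_1 & 3m_2 & 5m_3 & 7m_4 &\cdots& (2d-3)m_{d-1}\\ m_1^2 & m_2 & m_3 &m_4 &m_5& \cdots& m_d \end{pmatrix}.$$ Furthermore, $\mathcal{M}^{\mathrm{IG}}_d$ is Cohen--Macaulay.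
   Context: The moments of the inverse Gaussian distribution with parameters $\mu,\lambda$ are given by $m_0=1$, $m_1=\mu$, and $m_i=\frac{2i-3}{\lambda}\mu^2 m_{i-1}+\mu^2 m_{i-2}$ for $i\geq 2$. The inverse Gaussian moment variety $\mathcal{M}^{\mathrm{IG}}_d\subseteq\mathbb{P}^d$ is the Zariski closure of the set of points $[m_0(\mu,\lambda):m_1(\mu,\lambda):\cdots:m_d(\mu,\lambda)]$ with $\mu\in\mathbb{C}$, $\lambda\in\mathbb{C}\setminus\{0\}$ (complex projective space with homogeneous coordinates $m_0,\dots,m_d$). $\mathcal{I}(V)$ denotes the homogeneous vanishing ideal of a projective variety $V$. A projective variety $V\subseteq\mathbb{P}^d$ is called Cohen--Macaulay if its homogeneous coordinate ring $\mathbb{C}[m_0,\ldots,m_d]/\mathcal{I}(V)$ is a Cohen--Macaulay ring. In $H_d^{\mathrm{IG}}$, the first column is $(m_0^2,0,m_1^2)^\top$ and for $2\le i\le d$ the $i$th column is $(m_{i-2},(2i-3)m_{i-1},m_i)^\top$. *)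

theory Defs
  imports
    Complex_Main
    "HOL-Library.Poly_Mapping"
    "HOL-Library.Extended_Nat"
    "HOL-Algebra.QuotRing"
    "HOL-Algebra.Ring_Divisibility"
    "Jordan_Normal_Form.Determinant"
    "Jordan_Normal_Form.DL_Submatrix"
begin

section \<open>Polynomials\<close>

text \<open>The type \<open>cpoly\<close> is the ring of complex polynomials in the countably many variables
  \<open>m\<^sub>0, m\<^sub>1, \<dots>\<close>, realised as the monoid algebra of the exponent monoid. For each \<open>d\<close>, the ring
  \<open>\<complex>[m\<^sub>0,\<dots>,m\<^sub>d]\<close> is the subring of the polynomials that involve only variables of index at
  most \<open>d\<close>.\<close>

type_synonym cpoly = "(nat \<Rightarrow>\<^sub>0 nat) \<Rightarrow>\<^sub>0 complex"

definition Var :: "nat \<Rightarrow> cpoly" where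
  "Var i = Poly_Mapping.single (Poly_Mapping.single i 1) 1"

definition poly_ring :: "nat \<Rightarrow> cpoly ring" where
  "poly_ring d = \<lparr>carrier = {f. \<forall>a \<in> Poly_Mapping.keys f. Poly_Mapping.keys a \<subseteq> {..d}},
     mult = (*), one = 1, zero = 0, add = (+)\<rparr>"

definition eval_poly :: "cpoly \<Rightarrow> (nat \<Rightarrow> complex) \<Rightarrow> complex" where
  "eval_poly f v = (\<Sum>a \<in> Poly_Mapping.keys f.
     Poly_Mapping.lookup f a *
       (\<Prod>i \<in> Poly_Mapping.keys a. v i ^ Poly_Mapping.lookup a i))"

definition mdegree :: "(nat \<Rightarrow>\<^sub>0 nat) \<Rightarrow> nat" where
  "mdegree a = (\<Sum>i \<in> Poly_Mapping.keys a. Poly_Mapping.lookup a i)"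

text \<open>The zero polynomial is homogeneous of every degree.\<close>

definition homogeneous_of_degree :: "nat \<Rightarrow> cpoly \<Rightarrow> bool" where
  "homogeneous_of_degree n f \<longleftrightarrow> (\<forall>a \<in> Poly_Mapping.keys f. mdegree a = n)"

definition homogeneous_polys :: "nat \<Rightarrow> cpoly set" where
  "homogeneous_polys d = {f \<in> carrier (poly_ring d). \<exists>n. homogeneous_of_degree n f}"

definition homogeneous_ideal :: "nat \<Rightarrow> cpoly set \<Rightarrow> bool" where
  "homogeneous_ideal d I \<longleftrightarrow> (\<exists>S \<subseteq> homogeneous_polys d. I = Idl\<^bsub>poly_ring d\<^esub> S)"

lemma cring_poly_ring: "cring (poly_ring d)"
proof -
  define C where "C = {f::cpoly. \<forall>a \<in> Poly_Mapping.keys f. Poly_Mapping.keys a \<subseteq> {..d}}"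
  have R: "poly_ring d = \<lparr>carrier = C, mult = (*), one = 1, zero = 0, add = (+)\<rparr>"
    by (simp only: poly_ring_def C_def)
  have zero: "0 \<in> C" and one: "1 \<in> C"
    by (simp_all add: C_def)
  have add: "f + g \<in> C" if "f \<in> C" "g \<in> C" for f g
    using that Poly_Mapping.keys_add[of f g] unfolding C_def by blast
  have neg: "- f \<in> C" if "f \<in> C" for f
    using that unfolding C_def by (simp add: in_keys_iff)
  have mult: "f * g \<in> C" if f: "f \<in> C" and g: "g \<in> C" for f g
    unfolding C_def
  proof (intro CollectI ballI)
    fix c assume "c \<in> Poly_Mapping.keys (f * g)"
    then obtain a b where "a \<in> Poly_Mapping.keys f" "b \<in> Poly_Mapping.keys g" "c = a + b"
      using Poly_Mapping.keys_mult[of f g] by blast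
    moreover have "Poly_Mapping.keys (a + b) \<subseteq> Poly_Mapping.keys a \<union> Poly_Mapping.keys b"
      by (rule Poly_Mapping.keys_add)
    ultimately show "Poly_Mapping.keys c \<subseteq> {..d}"
      using f g unfolding C_def by blast
  qed
  have "abelian_group (poly_ring d)"
  proof (rule abelian_groupI, unfold R ring_record_simps partial_object.simps)
    show "\<exists>g \<in> C. g + f = 0" if "f \<in> C" for f
      using neg[OF that] by (intro bexI[of _ "- f"]) simp_all
  qed (simp_all only: add zero add.assoc add.commute add_0_left add_0_right add.left_commute)
  moreover have "comm_monoid (poly_ring d)"
    by (rule comm_monoidI, unfold R monoid.simps partial_object.simps)
      (simp_all only: mult one mult.assoc mult.commute mult_1_left mult_1_right mult.left_commute)
  ultimately show ?thesis
    by (rule cringI) (simp add: R distrib_right)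
qed

section \<open>Projective varieties\<close>

text \<open>The vector space \<open>\<complex>\<^sup>d\<^sup>+\<^sup>1\<close> consists of the functions on \<open>nat\<close> supported on \<open>{..d}\<close>, and a
  point of projective space is the set of all its vectors of homogeneous coordinates.\<close>

definition proj_point :: "(nat \<Rightarrow> complex) \<Rightarrow> (nat \<Rightarrow> complex) set" where
  "proj_point v = {\<lambda>i. c * v i | c. c \<noteq> 0}"

definition proj_space :: "nat \<Rightarrow> (nat \<Rightarrow> complex) set set" where
  "proj_space d = proj_point ` {v. (\<forall>i > d. v i = 0) \<and> (\<exists>i \<le> d. v i \<noteq> 0)}"

definition vanishes_at :: "cpoly \<Rightarrow> (nat \<Rightarrow> complex) set \<Rightarrow> bool" where
  "vanishes_at f p \<longleftrightarrow> (\<forall>v \<in> p. eval_poly f v = 0)"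

definition zero_locus :: "nat \<Rightarrow> cpoly set \<Rightarrow> (nat \<Rightarrow> complex) set set" where
  "zero_locus d T = {p \<in> proj_space d. \<forall>f \<in> T. vanishes_at f p}"

definition zariski_closed :: "nat \<Rightarrow> (nat \<Rightarrow> complex) set set \<Rightarrow> bool" where
  "zariski_closed d Z \<longleftrightarrow> (\<exists>T \<subseteq> homogeneous_polys d. Z = zero_locus d T)"

definition zariski_closure ::
    "nat \<Rightarrow> (nat \<Rightarrow> complex) set set \<Rightarrow> (nat \<Rightarrow> complex) set set" where
  "zariski_closure d A = \<Inter>{Z. zariski_closed d Z \<and> A \<subseteq> Z}"

definition vanishing_ideal :: "nat \<Rightarrow> (nat \<Rightarrow> complex) set set \<Rightarrow> cpoly set" where
  "vanishing_ideal d V =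
     Idl\<^bsub>poly_ring d\<^esub> {f \<in> homogeneous_polys d. \<forall>p \<in> V. vanishes_at f p}"

definition coordinate_ring :: "nat \<Rightarrow> (nat \<Rightarrow> complex) set set \<Rightarrow> cpoly set ring" where
  "coordinate_ring d V = poly_ring d Quot vanishing_ideal d V"

section \<open>Cohen--Macaulay rings\<close>

text \<open>A regular sequence: each entry is a nonzerodivisor modulo the preceding ones, and together
  the entries generate a proper ideal.\<close>

definition regular_sequence :: "('a, 'b) ring_scheme \<Rightarrow> 'a list \<Rightarrow> bool" where
  "regular_sequence R xs \<longleftrightarrow>
     set xs \<subseteq> carrier R \<and>
     (\<forall>i < length xs. \<forall>a \<in> carrier R.
        xs ! i \<otimes>\<^bsub>R\<^esub> a \<in> Idl\<^bsub>R\<^esub> (set (take i xs)) \<longrightarrow> a \<in> Idl\<^bsub>R\<^esub> (set (take i xs))) \<and>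
     Idl\<^bsub>R\<^esub> (set xs) \<noteq> carrier R"

definition ideal_depth :: "('a, 'b) ring_scheme \<Rightarrow> 'a set \<Rightarrow> enat" where
  "ideal_depth R I = Sup {enat (length xs) | xs. regular_sequence R xs \<and> set xs \<subseteq> I}"

definition prime_codim :: "('a, 'b) ring_scheme \<Rightarrow> 'a set \<Rightarrow> enat" where
  "prime_codim R P = Sup {enat n | n. \<exists>Q :: nat \<Rightarrow> 'a set.
     (\<forall>i \<le> n. primeideal (Q i) R) \<and> (\<forall>i < n. Q i \<subset> Q (Suc i)) \<and> Q n = P}"

text \<open>This is the definition in Eisenbud, Commutative Algebra, Section 18.2 (and in Kaplansky,
  Commutative Rings, Section 3-1): depth equals codimension at every maximal ideal. It does not
  mention localisations; for Noetherian rings, depth and codimension of a maximal ideal are the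
  depth and the dimension of the local ring there.\<close>

definition cohen_macaulay_ring :: "('a, 'b) ring_scheme \<Rightarrow> bool" where
  "cohen_macaulay_ring R \<longleftrightarrow>
     cring R \<and> noetherian_ring R \<and>
     (\<forall>M. maximalideal M R \<longrightarrow> ideal_depth R M = prime_codim R M)"

definition cohen_macaulay_variety :: "nat \<Rightarrow> (nat \<Rightarrow> complex) set set \<Rightarrow> bool" where
  "cohen_macaulay_variety d V \<longleftrightarrow> cohen_macaulay_ring (coordinate_ring d V)"

section \<open>The inverse Gaussian moment variety\<close>

fun ig_moment :: "complex \<Rightarrow> complex \<Rightarrow> nat \<Rightarrow> complex" where
  "ig_moment \<mu> l 0 = 1"
| "ig_moment \<mu> l (Suc 0) = \<mu>"
| "ig_moment \<mu> l (Suc (Suc n)) =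
     (2 * of_nat (Suc (Suc n)) - 3) / l * \<mu>\<^sup>2 * ig_moment \<mu> l (Suc n) + \<mu>\<^sup>2 * ig_moment \<mu> l n"

definition ig_moment_point :: "nat \<Rightarrow> complex \<Rightarrow> complex \<Rightarrow> (nat \<Rightarrow> complex) set" where
  "ig_moment_point d \<mu> l = proj_point (\<lambda>i. if i \<le> d then ig_moment \<mu> l i else 0)"

definition ig_moment_variety :: "nat \<Rightarrow> (nat \<Rightarrow> complex) set set" where
  "ig_moment_variety d = zariski_closure d {ig_moment_point d \<mu> l | \<mu> l. l \<noteq> 0}"

text \<open>Matrices are indexed from \<open>0\<close>, so the entry at \<open>(r, c)\<close> lies in the column with
  number \<open>c + 1\<close>.\<close>

definition ig_matrix :: "nat \<Rightarrow> cpoly mat" where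
  "ig_matrix d = mat 3 d (\<lambda>(r, c).
     if c = 0 then [Var 0 ^ 2, 0, Var 1 ^ 2] ! r
     else (let i = c + 1 in [Var (i - 2), of_nat (2 * i - 3) * Var (i - 1), Var i] ! r))"

text \<open>The minors of maximal size of a matrix with at least as many columns as rows.\<close>

definition maximal_minors :: "'a :: comm_ring_1 mat \<Rightarrow> 'a set" where
  "maximal_minors A =
     {det (submatrix A UNIV J) | J. J \<subseteq> {..<dim_col A} \<and> card J = dim_row A}"

end

theory Submission
  imports
    Defs
    "HOL-Computational_Algebra.Field_as_Ring"
    "HOL-Computational_Algebra.Fundamental_Theorem_Algebra"
    "HOL-Analysis.Continuum_Not_Denumerable"
begin

text \<open>
  Put \<open>w = \<mu>\<^sup>2 / \<lambda>\<close> and \<open>x = \<mu> / w\<close>. The moments become \<open>m\<^sub>i = t w\<^sup>i p\<^sub>i(x)\<close>, where \<open>t\<close> is the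
  homogenising coordinate, \<open>p\<^sub>0 = 1\<close> and \<open>p\<^sub>i\<^sub>+\<^sub>1 = x q\<^sub>i\<close> with the reverse Bessel polynomials
  \<open>q\<^sub>i\<close>. The vanishing ideal \<open>I\<close> is therefore the kernel of a homomorphism into a polynomial ring in
  three variables, which makes it prime, and the recursion shows that it contains the ideal \<open>J\<close> of
  the maximal minors.

  For the order that prefers monomials with small \<open>\<Sum> i\<^sup>2\<close>, the antidiagonal terms of the minors
  lead. Hence modulo \<open>J\<close> every polynomial is a combination, with coefficients in
  \<open>A = \<complex>[m\<^sub>0, m\<^sub>d\<^sub>-\<^sub>1, m\<^sub>d]\<close>, of at most \<open>(d - 1)\<^sup>2\<close> standard monomials. On the other hand the
  elements \<open>z\<^sup>i y\<^sup>N\<^sup>-\<^sup>i\<close> with \<open>z = m\<^sub>1\<^sup>2\<close>, \<open>y = m\<^sub>0 m\<^sub>2 - m\<^sub>1\<^sup>2\<close> and \<open>i \<le> N = (d - 1)\<^sup>2 - 1\<close> are independent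
  over \<open>A\<close>, because their ratio \<open>z / y\<close> is \<open>x\<close>. So the standard monomials are an \<open>A\<close>-basis of the
  coordinate ring and \<open>I = J\<close>.

  Translates of \<open>m\<^sub>0, m\<^sub>d\<^sub>-\<^sub>1, m\<^sub>d\<close> by constants are then regular sequences, and by the
  Nullstellensatz every maximal ideal contains one. Depth never exceeds codimension in a Noetherian
  ring, and four polynomials in three variables are algebraically dependent, which excludes chains of
  five primes; so depth and codimension of each maximal ideal are both three.
\<close>

section \<open>Polynomials and substitution homomorphisms\<close>

text \<open>The leading terms bound the rank of the coordinate ring over \<open>A\<close> only from
  above, by the number 4 + 3(d - 3) + (d - 3)(d - 2) of standard monomials. The matching lower bound
  has an independent source: a power of degree (d - 1)^2 of a Bessel polynomial of degree d - 1.
  That the two numbers agree gives both I = J and freeness over \<open>A\<close>.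

  In the parametrization the comparison elements share one monomial factor, so their independence
  concerns polynomials in x of degree below (d - 1)^2. The obstacle there is that m_{d-1} and m_d
  contribute powers of two consecutive Bessel polynomials; hence the coprimality statements.

  Two further points shape the argument. The vanishing ideal is generated by homogeneous
  polynomials, whereas the kernel is defined by all polynomials; the two are identified through the
  minors, which are homogeneous and generate the kernel. And the Cohen-Macaulay condition ranges
  over all maximal ideals, hence over all points of the affine cone and not only its vertex; this is
  why translates of the three parameters occur.\<close>

abbreviation keys :: "('a \<Rightarrow>\<^sub>0 'b::zero) \<Rightarrow> 'a set"
  where "keys \<equiv> Poly_Mapping.keys"
abbreviation lookup :: "('a \<Rightarrow>\<^sub>0 'b::zero) \<Rightarrow> 'a \<Rightarrow> 'b"
  where "lookup \<equiv> Poly_Mapping.lookup"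

abbreviation monomial :: "(nat \<Rightarrow>\<^sub>0 nat) \<Rightarrow> cpoly"
  where "monomial a \<equiv> Poly_Mapping.single a 1"
abbreviation Const :: "complex \<Rightarrow> cpoly"
  where "Const c \<equiv> Poly_Mapping.single 0 c"
abbreviation exp_single :: "nat \<Rightarrow> nat \<Rightarrow> (nat \<Rightarrow>\<^sub>0 nat)"
  where "exp_single i k \<equiv> Poly_Mapping.single i k"

lemma cpoly_eq_sum_single: "f = (\<Sum>a\<in>keys f. Poly_Mapping.single a (lookup f a))"
  for f :: "'a \<Rightarrow>\<^sub>0 'b::comm_monoid_add"
proof (rule poly_mapping_eqI)
  fix k
  show "lookup f k = lookup (\<Sum>a\<in>keys f. Poly_Mapping.single a (lookup f a)) k"
    by (simp add: lookup_sum lookup_single when_def sum.delta' in_keys_iff)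
qed

lemma cpoly_induct [case_names zero add single]:
  assumes "P 0" "\<And>f g. P f \<Longrightarrow> P g \<Longrightarrow> P (f + g)" "\<And>a c. P (Poly_Mapping.single a c)"
  shows "P (f :: 'a \<Rightarrow>\<^sub>0 'b::comm_monoid_add)"
proof -
  have "P (\<Sum>a\<in>A. Poly_Mapping.single a (lookup f a))" if "finite A" for A
    using that by induction (auto intro: assms)
  then show ?thesis
    by (subst cpoly_eq_sum_single) auto
qed

lemma single_eq_Const_mult_mono: "Poly_Mapping.single a c = Const c * monomial a"
  by (simp add: mult_single)

lemma keys_plus_nat [simp]: "keys (a + b) = keys a \<union> keys b"
  for a b :: "'a \<Rightarrow>\<^sub>0 nat"
  by (auto simp: in_keys_iff lookup_add)

definition mono_val :: "(nat \<Rightarrow> 'a::comm_semiring_1) \<Rightarrow> (nat \<Rightarrow>\<^sub>0 nat) \<Rightarrow> 'a" where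
  "mono_val v a = (\<Prod>i\<in>keys a. v i ^ lookup a i)"

lemma mono_val_superset:
  assumes "finite S" "keys a \<subseteq> S"
  shows "mono_val v a = (\<Prod>i\<in>S. v i ^ lookup a i)"
  unfolding mono_val_def using assms
  by (intro prod.mono_neutral_left) (auto simp: in_keys_iff)

lemma mono_val_0 [simp]: "mono_val v 0 = 1"
  by (simp add: mono_val_def)

lemma mono_val_add [simp]: "mono_val v (a + b) = mono_val v a * mono_val v b"
  using mono_val_superset[of "keys a \<union> keys b" a v] mono_val_superset[of "keys a \<union> keys b" b v]
    mono_val_superset[of "keys a \<union> keys b" "a + b" v]
  by (simp add: lookup_add power_add prod.distrib)

lemma mono_val_single [simp]: "mono_val v (exp_single i k) = v i ^ k"
  by (cases "k = 0") (simp_all add: mono_val_def)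

text \<open>The coefficient map \<open>h\<close> is kept general because evaluation at points, the
  parametrization and the specialization of some coordinates are all instances.\<close>

definition subst_poly :: "(complex \<Rightarrow> 'a::comm_semiring_1) \<Rightarrow> (nat \<Rightarrow> 'a) \<Rightarrow> cpoly \<Rightarrow> 'a" where
  "subst_poly h v f = (\<Sum>a\<in>keys f. h (lookup f a) * mono_val v a)"

lemma eval_poly_conv_subst: "eval_poly f v = subst_poly id v f"
  by (simp add: eval_poly_def subst_poly_def mono_val_def)

locale subst_hom = comm_ring_hom h for h :: "complex \<Rightarrow> 'a::comm_ring_1"
begin

lemma subst_superset:
  assumes "finite S" "keys f \<subseteq> S"
  shows "subst_poly h v f = (\<Sum>a\<in>S. h (lookup f a) * mono_val v a)"
  unfolding subst_poly_def using assms
  by (intro sum.mono_neutral_left) (auto simp: in_keys_iff)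

lemma subst_add [simp]: "subst_poly h v (f + g) = subst_poly h v f + subst_poly h v g"
proof -
  let ?S = "keys f \<union> keys g"
  have "keys (f + g) \<subseteq> ?S" by (rule Poly_Mapping.keys_add)
  then show ?thesis
    by (simp add: subst_superset[of ?S] lookup_add hom_distribs sum.distrib distrib_right)
qed

lemma subst_0 [simp]: "subst_poly h v 0 = 0"
  by (simp add: subst_poly_def)

lemma subst_single [simp]: "subst_poly h v (Poly_Mapping.single a c) = h c * mono_val v a"
  by (cases "c = 0") (simp_all add: subst_poly_def)

lemma subst_1 [simp]: "subst_poly h v 1 = 1"
  using subst_single[of v 0 1] by (simp del: subst_single)

lemma subst_Var [simp]: "subst_poly h v (Var i) = v i"
  by (simp add: Var_def)

lemma subst_mult [simp]: "subst_poly h v (f * g) = subst_poly h v f * subst_poly h v g"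
proof (induction f rule: cpoly_induct)
  case (single a c)
  show ?case
    by (induction g rule: cpoly_induct) (simp_all add: mult_single hom_distribs algebra_simps)
qed (simp_all add: algebra_simps)

sublocale subst: comm_ring_hom "subst_poly h v" for v
  by unfold_locales simp_all

end

interpretation eval_id: subst_hom "id :: complex \<Rightarrow> complex"
  by unfold_locales simp_all

interpretation subst_Const: subst_hom Const
  by unfold_locales (simp_all add: single_add mult_single)

section \<open>The subring of polynomials in finitely many variables\<close>

text \<open>The carrier of \<open>poly_ring d\<close> as a plain set: with the simp rules below,
  ring-record statements turn into statements about the type class operations.\<close>

definition polys :: "nat \<Rightarrow> cpoly set" where
  "polys d = {f. \<forall>a \<in> keys f. keys a \<subseteq> {..d}}"

lemma poly_ring_simps [simp]:
  "f \<otimes>\<^bsub>poly_ring d\<^esub> g = f * g" "f \<oplus>\<^bsub>poly_ring d\<^esub> g = f + g"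
  "\<zero>\<^bsub>poly_ring d\<^esub> = 0" "\<one>\<^bsub>poly_ring d\<^esub> = 1" "carrier (poly_ring d) = polys d"
  by (simp_all add: poly_ring_def polys_def)

interpretation PR: cring "poly_ring d" for d
  by (rule cring_poly_ring)

lemma polys_0 [simp]: "0 \<in> polys d" and polys_1 [simp]: "1 \<in> polys d"
  by (simp_all add: polys_def)

lemma polys_add [simp]: "f \<in> polys d \<Longrightarrow> g \<in> polys d \<Longrightarrow> f + g \<in> polys d"
  using PR.add.m_closed[of f d g] by simp

lemma polys_mult [simp]: "f \<in> polys d \<Longrightarrow> g \<in> polys d \<Longrightarrow> f * g \<in> polys d"
  using PR.m_closed[of f d g] by simp

lemma polys_uminus [simp]: "- f \<in> polys d \<longleftrightarrow> f \<in> polys d"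
  by (simp add: polys_def in_keys_iff)

lemma polys_diff [simp]: "f \<in> polys d \<Longrightarrow> g \<in> polys d \<Longrightarrow> f - g \<in> polys d"
  using polys_add[of f d "- g"] by simp

lemma polys_power [simp]: "f \<in> polys d \<Longrightarrow> f ^ n \<in> polys d"
  by (induction n) auto

lemma polys_sum [simp]: "(\<And>i. i \<in> A \<Longrightarrow> f i \<in> polys d) \<Longrightarrow> sum f A \<in> polys d"
  by (induction A rule: infinite_finite_induct) auto

lemma polys_prod [simp]: "(\<And>i. i \<in> A \<Longrightarrow> f i \<in> polys d) \<Longrightarrow> prod f A \<in> polys d"
  by (induction A rule: infinite_finite_induct) auto

lemma polys_of_nat [simp]: "of_nat n \<in> polys d"
  by (induction n) auto

lemma polys_single: "keys a \<subseteq> {..d} \<Longrightarrow> Poly_Mapping.single a c \<in> polys d"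
  by (auto simp: polys_def)

lemma polys_Const [simp]: "Const c \<in> polys d"
  by (simp add: polys_single)

lemma polys_Var [simp]: "i \<le> d \<Longrightarrow> Var i \<in> polys d"
  unfolding Var_def by (rule polys_single) auto

lemma a_minus_poly_ring [simp]: "f \<in> polys d \<Longrightarrow> g \<in> polys d \<Longrightarrow> f \<ominus>\<^bsub>poly_ring d\<^esub> g = f - g"
proof -
  assume f: "f \<in> polys d" and g: "g \<in> polys d"
  have "\<ominus>\<^bsub>poly_ring d\<^esub> g = - g"
    using g by (intro PR.minus_equality) auto
  then show ?thesis by (simp add: a_minus_def)
qed

lemma ideal_polysD:
  assumes "ideal I (poly_ring d)"
  shows "0 \<in> I" "f \<in> I \<Longrightarrow> f \<in> polys d" "f \<in> I \<Longrightarrow> g \<in> I \<Longrightarrow> f + g \<in> I"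
    "f \<in> I \<Longrightarrow> g \<in> polys d \<Longrightarrow> g * f \<in> I" "f \<in> I \<Longrightarrow> g \<in> polys d \<Longrightarrow> f * g \<in> I"
    "f \<in> I \<Longrightarrow> - f \<in> I" "f \<in> I \<Longrightarrow> g \<in> I \<Longrightarrow> f - g \<in> I"
proof -
  interpret ideal I "poly_ring d" by fact
  show "0 \<in> I" using zero_closed by simp
  show pol: "f \<in> polys d" if "f \<in> I" for f
    using a_Hcarr[OF that] by simp
  show add: "f + g \<in> I" if "f \<in> I" "g \<in> I" for f g
    using a_closed[OF that] by simp
  show *: "g * f \<in> I" "f * g \<in> I" if "f \<in> I" "g \<in> polys d" for f g
    using I_l_closed[of f g] I_r_closed[of f g] that by auto
  show min: "- f \<in> I" if "f \<in> I" for f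
    using *(1)[OF that, of "- 1"] pol by simp
  show "f - g \<in> I" if "f \<in> I" "g \<in> I" for f g
    using add[OF that(1) min[OF that(2)]] by simp
qed

lemma ideal_polys_sum:
  assumes "ideal I (poly_ring d)" "\<And>i. i \<in> A \<Longrightarrow> f i \<in> I"
  shows "sum f A \<in> I"
  using assms(2) by (induction A rule: infinite_finite_induct)
    (auto intro: ideal_polysD[OF assms(1)])

lemma ideal_polysI:
  assumes "I \<subseteq> polys d" "0 \<in> I" "\<And>f g. f \<in> I \<Longrightarrow> g \<in> I \<Longrightarrow> f + g \<in> I"
    "\<And>f g. f \<in> I \<Longrightarrow> g \<in> polys d \<Longrightarrow> g * f \<in> I"
  shows "ideal I (poly_ring d)"
proof (rule idealI)
  show "subgroup I (add_monoid (poly_ring d))"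
  proof (rule PR.add.subgroupI)
    fix a assume a: "a \<in> I"
    have "\<ominus>\<^bsub>poly_ring d\<^esub> a = - a"
      using a assms(1) by (intro PR.minus_equality) auto
    then show "\<ominus>\<^bsub>poly_ring d\<^esub> a \<in> I"
      using assms(4)[OF a, of "- 1"] by simp
  qed (use assms in auto)
qed (use assms in \<open>auto simp: mult.commute PR.ring_axioms\<close>)

section \<open>Linear systems over an integral domain\<close>

text \<open>Elimination without division: the pivot \<open>M e v\<close> is cross-multiplied into
  the remaining equations, which removes one equation and one unknown. The predicate
  \<open>P\<close> describes a subring, so that the solution stays in the subring of the entries;
  later this is \<open>free_polys d\<close>.\<close>

lemma homogeneous_system_nontrivial_solution:
  fixes M :: "'e \<Rightarrow> 'u \<Rightarrow> 'a::idom"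
  assumes "finite E" "finite U" "card E < card U"
    and P: "P 0" "P 1" "\<And>x y. P x \<Longrightarrow> P y \<Longrightarrow> P (x + y)" "\<And>x y. P x \<Longrightarrow> P y \<Longrightarrow> P (x * y)"
      "\<And>x. P x \<Longrightarrow> P (- x)"
    and "\<And>e u. e \<in> E \<Longrightarrow> u \<in> U \<Longrightarrow> P (M e u)"
  shows "\<exists>s. (\<forall>u\<in>U. P (s u)) \<and> (\<exists>u\<in>U. s u \<noteq> 0) \<and> (\<forall>e\<in>E. (\<Sum>u\<in>U. M e u * s u) = 0)"
  using assms(1-3,9)
proof (induction E arbitrary: U M rule: finite_induct)
  case empty
  then obtain u where "u \<in> U" by fastforce
  then show ?case
    by (intro exI[of _ "\<lambda>_. 1"]) (auto intro: P)
next
  case (insert e E)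
  have Psum: "P (sum f A)" if "\<And>x. x \<in> A \<Longrightarrow> P (f x)" for f :: "'u \<Rightarrow> 'a" and A
    using that by (induction A rule: infinite_finite_induct) (auto intro: P)
  have Pdiff: "P (x - y)" if "P x" "P y" for x y
    using P(3)[OF that(1) P(5)[OF that(2)]] by simp
  show ?case
  proof (cases "\<forall>u\<in>U. M e u = 0")
    case True
    have "\<exists>s. (\<forall>u\<in>U. P (s u)) \<and> (\<exists>u\<in>U. s u \<noteq> 0) \<and> (\<forall>e\<in>E. (\<Sum>u\<in>U. M e u * s u) = 0)"
      using insert.prems insert.hyps by (intro insert.IH) auto
    then show ?thesis using True by auto
  next
    case False
    then obtain v where v: "v \<in> U" "M e v \<noteq> 0" by blast
    define U' where "U' = U - {v}"
    have U': "finite U'" "U = insert v U'" "v \<notin> U'" "card U = Suc (card U')"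
      using v insert.prems(1) using card_Suc_Diff1[of U v] by (auto simp: U'_def)
    define N where "N = (\<lambda>e' u. M e v * M e' u - M e' v * M e u)"
    have "\<exists>s. (\<forall>u\<in>U'. P (s u)) \<and> (\<exists>u\<in>U'. s u \<noteq> 0) \<and> (\<forall>e\<in>E. (\<Sum>u\<in>U'. N e u * s u) = 0)"
      using insert.prems insert.hyps U'
      by (intro insert.IH) (auto simp: N_def intro!: P Pdiff)
    then obtain s where s: "\<forall>u\<in>U'. P (s u)" "\<exists>u\<in>U'. s u \<noteq> 0"
      "\<And>e'. e' \<in> E \<Longrightarrow> (\<Sum>u\<in>U'. N e' u * s u) = 0" by blast
    \<comment> \<open>Scaling a solution of the smaller system by the pivot makes the value at
      \<open>v\<close> expressible without a quotient.\<close>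
    define r where "r = (\<lambda>u. if u = v then - (\<Sum>u\<in>U'. M e u * s u) else M e v * s u)"
    have sum_r: "(\<Sum>u\<in>U. M e' u * r u)
        = M e v * (\<Sum>u\<in>U'. M e' u * s u) - M e' v * (\<Sum>u\<in>U'. M e u * s u)" for e'
    proof -
      have "(\<Sum>u\<in>U'. M e' u * r u) = M e v * (\<Sum>u\<in>U'. M e' u * s u)"
        unfolding sum_distrib_left using U' by (intro sum.cong) (auto simp: r_def)
      then show ?thesis
        using U' by (simp add: r_def)
    qed
    have "(\<Sum>u\<in>U. M e' u * r u) = 0" if "e' \<in> E" for e'
    proof -
      have "(\<Sum>u\<in>U'. N e' u * s u)
          = M e v * (\<Sum>u\<in>U'. M e' u * s u) - M e' v * (\<Sum>u\<in>U'. M e u * s u)"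
        unfolding sum_distrib_left sum_subtractf[symmetric]
        by (intro sum.cong) (auto simp: N_def algebra_simps)
      then show ?thesis using s(3)[OF that] sum_r[of e'] by simp
    qed
    moreover have "(\<Sum>u\<in>U. M e u * r u) = 0"
      using sum_r[of e] by simp
    moreover have "\<forall>u\<in>U. P (r u)"
      using s(1) U' insert.prems(3) v by (auto simp: r_def intro!: P Psum)
    moreover have "\<exists>u\<in>U. r u \<noteq> 0"
      using s(2) v U' unfolding r_def by auto
    ultimately show ?thesis by auto
  qed
qed

lemma homogeneous_system_nontrivial_solution_UNIV:
  fixes M :: "'e \<Rightarrow> 'u \<Rightarrow> 'a::idom"
  assumes "finite E" "finite U" "card E < card U"
  shows "\<exists>s. (\<exists>u\<in>U. s u \<noteq> 0) \<and> (\<forall>e\<in>E. (\<Sum>u\<in>U. M e u * s u) = 0)"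
  using homogeneous_system_nontrivial_solution[OF assms, of "\<lambda>_. True" M] by simp

section \<open>Hilbert's basis theorem\<close>

text \<open>Induction on the number of free coordinates. Fix \<open>a\<close> in \<open>L\<close>. A
  member \<open>b\<close> that is not above \<open>a\<close> has \<open>b i < a i\<close> for some
  \<open>i\<close> in \<open>K\<close>, so it lies in one of finitely many slices
  \<open>b i = v\<close> with \<open>v < a i\<close>, and each slice has one free coordinate
  less.\<close>

lemma dickson:
  fixes L :: "('i \<Rightarrow> nat) set"
  assumes "finite K" "\<And>a b i. a \<in> L \<Longrightarrow> b \<in> L \<Longrightarrow> i \<notin> K \<Longrightarrow> a i = b i"
  shows "\<exists>F\<subseteq>L. finite F \<and> (\<forall>a\<in>L. \<exists>b\<in>F. \<forall>i. b i \<le> a i)"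
  using assms
proof (induction "card K" arbitrary: K L)
  case 0
  then have eq: "a = b" if "a \<in> L" "b \<in> L" for a b
    using that by (auto simp: fun_eq_iff)
  have "finite L"
  proof (cases "L = {}")
    case False
    then obtain a where "a \<in> L" by blast
    then have "L = {a}" using eq by blast
    then show ?thesis by simp
  qed simp
  then show ?case by (intro exI[of _ L]) auto
next
  case (Suc k)
  show ?case
  proof (cases "L = {}")
    case False
    then obtain a where a: "a \<in> L" by blast
    let ?Q = "\<lambda>p F. fst p \<in> K \<longrightarrow> F \<subseteq> L \<and> finite F \<and>
      (\<forall>b\<in>L. b (fst p) = snd p \<longrightarrow> (\<exists>c\<in>F. \<forall>j. c j \<le> b j))"
    have "\<exists>F. ?Q p F" for p
    proof (cases "fst p \<in> K")
      case True
      have "\<exists>F\<subseteq>{b\<in>L. b (fst p) = snd p}.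
          finite F \<and> (\<forall>b\<in>{b\<in>L. b (fst p) = snd p}. \<exists>c\<in>F. \<forall>j. c j \<le> b j)"
      proof (rule Suc.hyps(1)[of "K - {fst p}"])
        show "k = card (K - {fst p})"
          using True Suc.hyps(2) Suc.prems(1) by simp
      next
        fix b c i
        assume "b \<in> {b\<in>L. b (fst p) = snd p}" "c \<in> {b\<in>L. b (fst p) = snd p}" "i \<notin> K - {fst p}"
        then show "b i = c i"
          using Suc.prems(2)[of b c i] by (cases "i = fst p") auto
      qed (use Suc.prems in auto)
      then obtain F where "F \<subseteq> {b\<in>L. b (fst p) = snd p}" "finite F"
        "\<forall>b\<in>{b\<in>L. b (fst p) = snd p}. \<exists>c\<in>F. \<forall>j. c j \<le> b j" by blast
      then show ?thesis by (intro exI[of _ F]) blast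
    qed auto
    then obtain G where G: "\<And>p. ?Q p (G p)"
      using choice[of ?Q] by blast
    define F where "F = (\<lambda>i v. G (i, v))"
    have F: "F i v \<subseteq> L" "finite (F i v)" "b \<in> L \<Longrightarrow> b i = v \<Longrightarrow> \<exists>c\<in>F i v. \<forall>j. c j \<le> b j"
      if "i \<in> K" for i v b
      using G[of "(i, v)"] that by (auto simp: F_def)
    let ?G = "insert a (\<Union>i\<in>K. \<Union>v<a i. F i v)"
    have "?G \<subseteq> L" using F(1) a by blast
    moreover have "finite ?G" using F(2) Suc.prems(1) by auto
    moreover have "\<exists>c\<in>?G. \<forall>i. c i \<le> b i" if b: "b \<in> L" for b
    proof (cases "\<forall>i. a i \<le> b i")
      case False
      then obtain i where i: "b i < a i" by (auto simp: not_le)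
      with Suc.prems(2)[OF a b] have "i \<in> K" by force
      with F(3)[OF this b refl] i show ?thesis by blast
    qed auto
    ultimately show ?thesis by blast
  qed auto
qed

text \<open>The order on exponents is lexicographic from the lowest index. With infinitely many
  variables it has the descending chain m_0 > m_1 > m_2 > ..., so the indices are bounded and
  exponents are compared as lists of length d + 1.\<close>

lemma wf_exponents: "wf {(a, b :: nat \<Rightarrow>\<^sub>0 nat). a < b \<and> keys a \<subseteq> {..d} \<and> keys b \<subseteq> {..d}}"
proof -
  define l where "l = (\<lambda>a :: nat \<Rightarrow>\<^sub>0 nat. map (lookup a) [0..<Suc d])"
  have "(l a, l b) \<in> lexn less_than (Suc d)"
    if ab: "a < b" "keys a \<subseteq> {..d}" "keys b \<subseteq> {..d}" for a b
  proof -
    from ab(1) obtain k where k: "lookup a k < lookup b k" "\<And>i. i < k \<Longrightarrow> lookup a i = lookup b i"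
      by (auto simp: less_poly_mapping.rep_eq less_fun_def)
    have "k \<in> keys b" using k(1) by (simp add: in_keys_iff)
    then have "k \<le> d" using ab(3) by auto
    then have split: "[0..<Suc d] = [0..<k] @ k # [Suc k..<Suc d]"
      using upt_add_eq_append[of 0 k "Suc d - k"] by (simp add: upt_conv_Cons del: upt_Suc)
    have "map (lookup a) [0..<k] = map (lookup b) [0..<k]"
      using k(2) by simp
    then have "\<exists>xys x y xs' ys'. l a = xys @ x # xs' \<and> l b = xys @ y # ys' \<and> (x, y) \<in> less_than"
      unfolding l_def split using k(1)
      by (intro exI[of _ "map (lookup b) [0..<k]"] exI[of _ "lookup a k"] exI[of _ "lookup b k"]
          exI[of _ "map (lookup a) [Suc k..<Suc d]"] exI[of _ "map (lookup b) [Suc k..<Suc d]"])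
        (simp del: upt_Suc)
    then show ?thesis
      unfolding lexn_conv by (simp add: l_def)
  qed
  then have "{(a, b). a < b \<and> keys a \<subseteq> {..d} \<and> keys b \<subseteq> {..d}}
      \<subseteq> inv_image (lexn less_than (Suc d)) l"
    by (auto simp: inv_image_def)
  then show ?thesis
    using wf_subset wf_inv_image wf_lexn[OF wf_less_than] by blast
qed

lemma lookup_single_mult: "lookup (Poly_Mapping.single c k * f) (c + e) = k * lookup f e"
  for f :: cpoly
  by (induction f rule: cpoly_induct)
    (auto simp: lookup_add distrib_left mult_single lookup_single when_def)

text \<open>Dickson's lemma selects finitely many members of \<open>I\<close> whose leading
  exponents lie below those of all the others. Division by them lowers the leading exponent, hence
  every member of \<open>I\<close> lies in the ideal \<open>W\<close> that they generate.\<close>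

theorem hilbert_basis: "noetherian_ring (poly_ring d)"
proof (rule PR.noetherian_ringI)
  fix I assume I: "ideal I (poly_ring d)"
  let ?lead = "\<lambda>f :: cpoly. Max (keys f)"
  define L where "L = (\<lambda>f. lookup (?lead f)) ` (I - {0})"
  have lead_in: "?lead f \<in> keys f" if "f \<noteq> 0" for f :: cpoly
    using that by (intro Max_in) auto
  have lead_keys: "keys (?lead f) \<subseteq> {..d}" if "f \<in> I - {0}" for f
    using that lead_in[of f] ideal_polysD(2)[OF I, of f] by (auto simp: polys_def)
  have "\<exists>F\<subseteq>L. finite F \<and> (\<forall>a\<in>L. \<exists>b\<in>F. \<forall>i. b i \<le> a i)"
  proof (rule dickson[of "{..d}"])
    show "a i = b i" if "a \<in> L" "b \<in> L" "i \<notin> {..d}" for a b i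
    proof -
      have *: "c i = 0" if c: "c \<in> L" for c
      proof -
        obtain f where f: "f \<in> I - {0}" "c = lookup (?lead f)" using c by (auto simp: L_def)
        have "i \<notin> keys (?lead f)" using lead_keys[OF f(1)] \<open>i \<notin> {..d}\<close> by blast
        then show ?thesis unfolding f(2) by (simp add: in_keys_iff)
      qed
      then show ?thesis using *[OF that(1)] *[OF that(2)] by simp
    qed
  qed simp
  then obtain F where F': "F \<subseteq> L \<and> finite F \<and> (\<forall>a\<in>L. \<exists>b\<in>F. \<forall>i. b i \<le> a i)"
    by (elim exE)
  then have F: "F \<subseteq> L" "finite F" by blast+
  have F3: "\<exists>b\<in>F. \<forall>i. b i \<le> a i" if "a \<in> L" for a
    using F'[THEN conjunct2, THEN conjunct2] that by (rule bspec)
  obtain A where A: "A \<subseteq> I - {0}" "finite A" "F = (\<lambda>f. lookup (?lead f)) ` A"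
    using F(1,2) finite_subset_image unfolding L_def by metis
  have A_polys: "A \<subseteq> polys d"
    using A(1) ideal_polysD(2)[OF I] by auto
  define W where "W = Idl\<^bsub>poly_ring d\<^esub> A"
  have W: "ideal W (poly_ring d)" "A \<subseteq> W"
    unfolding W_def using PR.genideal_ideal[of A d] PR.genideal_self[of A d] A_polys by auto
  have "f \<in> W" if "f \<in> I - {0}" for f
    using that
  proof (induction "?lead f" arbitrary: f rule: wf_induct_rule[OF wf_exponents[of d]])
    case (1 f)
    define a where "a = ?lead f"
    have "lookup a \<in> L" using 1(2) unfolding L_def a_def by (rule imageI)
    then obtain b where b: "b \<in> F" "\<forall>i. b i \<le> lookup a i" using F3 by meson
    from b(1) obtain g where "g \<in> A" "b = lookup (?lead g)" unfolding A(3) by (rule imageE)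
    with b(2) have g: "g \<in> A" "\<And>i. lookup (?lead g) i \<le> lookup a i" by simp_all
    define e where "e = ?lead g"
    \<comment> \<open>Subtraction of exponents is truncated; here it is exact because
      \<open>e\<close> lies below \<open>a\<close> in every coordinate.\<close>
    define c where "c = a - e"
    have a: "a = c + e"
      using g(2) by (intro poly_mapping_eqI) (simp add: c_def e_def lookup_add minus_poly_mapping.rep_eq)
    have g0: "g \<in> I" "g \<noteq> 0" using g(1) A(1) by auto
    have e: "e \<in> keys g" unfolding e_def using g0 lead_in by auto
    have "a \<in> keys f" unfolding a_def using 1(2) lead_in by auto
    have "keys a \<subseteq> {..d}" unfolding a_def using 1(2) lead_keys by auto
    then have c: "keys c \<subseteq> {..d}" using a by simp
    define q where "q = Poly_Mapping.single c (lookup f a / lookup g e)"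
    have q: "q \<in> polys d" unfolding q_def by (rule polys_single[OF c])
    define h where "h = f - q * g"
    have "lookup h a = 0"
      using e unfolding h_def q_def a by (simp add: lookup_minus lookup_single_mult in_keys_iff)
    moreover have "b \<le> a" if "b \<in> keys h" for b
    proof -
      have "b \<in> keys f \<or> b \<in> keys (q * g)"
        using that by (auto simp: h_def in_keys_iff lookup_minus)
      then show ?thesis
      proof
        assume "b \<in> keys f" then show ?thesis unfolding a_def by (intro Max_ge) auto
      next
        assume "b \<in> keys (q * g)"
        then obtain b' where b': "b' \<in> keys g" "b = c + b'"
          using Poly_Mapping.keys_mult[of q g] by (auto simp: q_def split: if_splits)
        then have "b' \<le> e" unfolding e_def by (intro Max_ge) auto
        then show ?thesis unfolding b'(2) a by (rule add_left_mono)
      qed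
    qed
    ultimately have less: "b < a" if "b \<in> keys h" for b
      using that by (metis in_keys_iff order_le_less)
    have h: "h \<in> I"
      using 1(2) ideal_polysD(4)[OF I g0(1) q] unfolding h_def by (intro ideal_polysD(7)[OF I]) auto
    have "h \<in> W"
    proof (cases "h = 0")
      case False
      then show ?thesis
        using h less[OF lead_in[OF False]] lead_keys[of h] \<open>keys a \<subseteq> {..d}\<close>
        by (intro 1(1)) (auto simp: a_def)
    qed (use ideal_polysD(1)[OF W(1)] in simp)
    moreover have "q * g \<in> W"
      using g(1) W(2) q by (intro ideal_polysD(4)[OF W(1)]) auto
    ultimately have "h + q * g \<in> W" by (rule ideal_polysD(3)[OF W(1)])
    then show ?case by (simp add: h_def)
  qed
  then have "I \<subseteq> W" using ideal_polysD(1)[OF W(1)] by auto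
  moreover have "W \<subseteq> I"
    unfolding W_def using A(1) by (intro PR.genideal_minimal[OF I]) auto
  ultimately show "\<exists>A\<subseteq>carrier (poly_ring d). finite A \<and> I = Idl\<^bsub>poly_ring d\<^esub> A"
    using A(2) A_polys unfolding W_def by auto
qed

section \<open>Depth and codimension\<close>

lemma (in noetherian_ring) ideal_set_has_maximal:
  assumes "A \<noteq> {}" "\<And>I. I \<in> A \<Longrightarrow> ideal I R"
  shows "\<exists>M\<in>A. \<forall>I\<in>A. M \<subseteq> I \<longrightarrow> I = M"
proof (rule subset_Zorn)
  fix C assume C: "subset.chain A C"
  show "\<exists>U\<in>A. \<forall>X\<in>C. X \<subseteq> U"
  proof (cases "C = {}")
    case False
    have "subset.chain {I. ideal I R} C"
      using C assms(2) unfolding pred_on.chain_def by blast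
    then have "\<Union>C \<in> C" by (rule ideal_chain_is_trivial[OF False])
    moreover have "C \<subseteq> A" using C unfolding pred_on.chain_def by blast
    ultimately show ?thesis by (intro bexI[of _ "\<Union>C"]) auto
  qed (use assms(1) in auto)
qed

text \<open>An ideal \<open>M\<close> that is maximal among those containing \<open>I\<close> and
  avoiding \<open>T\<close> is prime: if a and b lie outside \<open>M\<close>, then M + (a) and M +
  (b) both meet \<open>T\<close>, and the product of two such elements lies in M + (ab).\<close>

lemma (in cring) prime_avoiding:
  assumes "noetherian_ring R" and I: "ideal I R" and T: "T \<subseteq> carrier R" "\<one> \<in> T"
    "\<And>s t. s \<in> T \<Longrightarrow> t \<in> T \<Longrightarrow> s \<otimes> t \<in> T" and "I \<inter> T = {}"
  shows "\<exists>Q. primeideal Q R \<and> I \<subseteq> Q \<and> Q \<inter> T = {}"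
proof -
  define A where "A = {J. ideal J R \<and> I \<subseteq> J \<and> J \<inter> T = {}}"
  have "\<exists>M\<in>A. \<forall>J\<in>A. M \<subseteq> J \<longrightarrow> J = M"
    using assms by (intro noetherian_ring.ideal_set_has_maximal) (auto simp: A_def)
  then obtain M where M: "M \<in> A" "\<And>J. J \<in> A \<Longrightarrow> M \<subseteq> J \<Longrightarrow> J = M" by blast
  then have iM: "ideal M R" and IM: "I \<subseteq> M" and MT: "M \<inter> T = {}" by (auto simp: A_def)
  interpret M: ideal M R by fact
  have ex: "\<exists>m\<in>M. \<exists>r\<in>carrier R. m \<oplus> r \<otimes> a \<in> T" if a: "a \<in> carrier R" "a \<notin> M" for a
  proof -
    have id: "ideal (M <+>\<^bsub>R\<^esub> PIdl a) R"
      using a(1) by (intro add_ideals iM cgenideal_ideal)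
    have mem: "h \<oplus> k \<in> M <+>\<^bsub>R\<^esub> PIdl a" if "h \<in> M" "k \<in> PIdl a" for h k
      unfolding set_add_def' using that by blast
    have sub: "M \<subseteq> M <+>\<^bsub>R\<^esub> PIdl a"
    proof
      fix m assume m: "m \<in> M"
      have "\<zero> \<in> PIdl a"
        using additive_subgroup.zero_closed[OF ideal.axioms(1)[OF cgenideal_ideal[OF a(1)]]] .
      then show "m \<in> M <+>\<^bsub>R\<^esub> PIdl a"
        using mem[OF m] r_zero[OF M.a_Hcarr[OF m]] by metis
    qed
    have "a \<in> M <+>\<^bsub>R\<^esub> PIdl a"
      using mem[OF M.zero_closed cgenideal_self[OF a(1)]] l_zero[OF a(1)] by simp
    then have "M <+>\<^bsub>R\<^esub> PIdl a \<notin> A" using M(2)[of "M <+>\<^bsub>R\<^esub> PIdl a"] sub a(2) by blast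
    then have "(M <+>\<^bsub>R\<^esub> PIdl a) \<inter> T \<noteq> {}" using id sub IM by (auto simp: A_def)
    then obtain m y where "m \<in> M" "y \<in> PIdl a" "m \<oplus> y \<in> T"
      unfolding set_add_def' by blast
    moreover then obtain r where "r \<in> carrier R" "y = r \<otimes> a"
      unfolding cgenideal_def by blast
    ultimately show ?thesis by blast
  qed
  have "primeideal M R"
  proof (rule primeidealI[OF iM is_cring])
    show "carrier R \<noteq> M" using T MT by blast
    fix a b assume ab: "a \<in> carrier R" "b \<in> carrier R" "a \<otimes> b \<in> M"
    show "a \<in> M \<or> b \<in> M"
    proof (rule ccontr)
      assume "\<not> (a \<in> M \<or> b \<in> M)"
      then obtain m r n s where *: "m \<in> M" "r \<in> carrier R" "m \<oplus> r \<otimes> a \<in> T"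
        "n \<in> M" "s \<in> carrier R" "n \<oplus> s \<otimes> b \<in> T" using ex ab by metis
      have c: "m \<in> carrier R" "n \<in> carrier R" using * by auto
      have "(m \<oplus> r \<otimes> a) \<otimes> (n \<oplus> s \<otimes> b) = m \<otimes> (n \<oplus> s \<otimes> b) \<oplus> ((r \<otimes> a) \<otimes> n \<oplus> (r \<otimes> s) \<otimes> (a \<otimes> b))"
        using c * ab by (simp add: l_distr r_distr m_ac a_ac)
      also have "\<dots> \<in> M"
        using c * ab by (intro M.a_closed M.I_r_closed[of m] M.I_l_closed[of n] M.I_l_closed[of "a \<otimes> b"]) auto
      finally show False using T(3)[OF *(3) *(6)] MT by blast
    qed
  qed
  then show ?thesis using IM MT by (intro exI[of _ M] conjI)
qed

text \<open>The prime \<open>P\<close> strictly contains a prime over the first \<open>k\<close> elements: one that avoids all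
  products of an element outside \<open>P\<close> and a power of the next, regular, element.\<close>

lemma (in cring) regular_sequence_prime_chain:
  assumes N: "noetherian_ring R" and reg: "regular_sequence R xs"
  shows "k \<le> length xs \<Longrightarrow> primeideal P R \<Longrightarrow> set (take k xs) \<subseteq> P \<Longrightarrow>
    \<exists>Q :: nat \<Rightarrow> 'a set. (\<forall>i\<le>k. primeideal (Q i) R) \<and> (\<forall>i<k. Q i \<subset> Q (Suc i)) \<and> Q k = P"
proof (induction k arbitrary: P)
  case 0
  then show ?case by (intro exI[of _ "\<lambda>_. P"]) auto
next
  case (Suc k)
  interpret P: primeideal P R by fact
  define x where "x = xs ! k"
  have xs: "set xs \<subseteq> carrier R" using reg by (simp add: regular_sequence_def)
  have x: "x \<in> carrier R" "x \<in> P" "set (take k xs) \<subseteq> P"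
    using Suc.prems xs by (auto simp: x_def take_Suc_conv_app_nth)
  define I where "I = Idl (set (take k xs))"
  have tk: "set (take k xs) \<subseteq> carrier R" using xs set_take_subset[of k xs] by blast
  have I: "ideal I R" unfolding I_def by (rule genideal_ideal[OF tk])
  have IP: "I \<subseteq> P" unfolding I_def by (rule genideal_minimal[OF P.is_ideal x(3)])
  have nzd: "a \<in> I" if "a \<in> carrier R" "x \<otimes> a \<in> I" for a
    using reg Suc.prems(1) that unfolding regular_sequence_def I_def x_def by auto
  have nzd_pow: "s \<in> I" if "s \<in> carrier R" "s \<otimes> x [^] j \<in> I" for s and j :: nat
    using that
  proof (induction j)
    case (Suc j)
    have "x \<otimes> (s \<otimes> x [^] j) \<in> I"
      using Suc.prems x(1) by (simp add: m_ac)
    then have "s \<otimes> x [^] j \<in> I"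
      using Suc.prems(1) x(1) nzd[of "s \<otimes> x [^] j"] by simp
    then show ?case by (rule Suc.IH[OF Suc.prems(1)])
  qed auto
  define T where "T = {s \<otimes> x [^] j | s (j :: nat). s \<in> carrier R - P}"
  have one: "\<one> \<in> carrier R - P"
    using P.I_notcarr P.one_imp_carrier one_closed by (simp add: Diff_iff) metis
  have T1: "s \<in> T" if "s \<in> carrier R - P" for s
    unfolding T_def using that by (intro CollectI exI[of _ s] exI[of _ "0::nat"]) simp
  have "x \<in> T"
    unfolding T_def using x one by (intro CollectI exI[of _ \<one>] exI[of _ "1::nat"]) simp
  have "\<exists>Q. primeideal Q R \<and> I \<subseteq> Q \<and> Q \<inter> T = {}"
  proof (rule prime_avoiding[OF N I])
    show "T \<subseteq> carrier R" using x(1) by (auto simp: T_def)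
    show "\<one> \<in> T" by (rule T1[OF one])
    show "I \<inter> T = {}" using nzd_pow IP by (auto simp: T_def)
    fix s t assume "s \<in> T" "t \<in> T"
    then obtain a b and i j :: nat where *: "s = a \<otimes> x [^] i" "t = b \<otimes> x [^] j"
      "a \<in> carrier R - P" "b \<in> carrier R - P" by (auto simp: T_def)
    have "s \<otimes> t = (a \<otimes> b) \<otimes> (x [^] i \<otimes> x [^] j)"
      using * x(1) by (simp add: m_ac)
    then have "s \<otimes> t = (a \<otimes> b) \<otimes> x [^] (i + j)"
      using x(1) by (simp only: nat_pow_mult)
    moreover have "a \<otimes> b \<in> carrier R - P"
      using * P.I_prime by auto
    ultimately show "s \<otimes> t \<in> T" unfolding T_def by blast
  qed
  then obtain P' where P': "primeideal P' R" "I \<subseteq> P'" "P' \<inter> T = {}" by blast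
  have "P' \<subseteq> P"
    using T1 P'(3) ideal.Icarr[OF primeideal.axioms(1)[OF P'(1)]] by blast
  then have lt: "P' \<subset> P" using \<open>x \<in> T\<close> x(2) P'(3) by blast
  have "set (take k xs) \<subseteq> P'" using P'(2) genideal_self[OF tk] by (auto simp: I_def)
  then obtain Q :: "nat \<Rightarrow> 'a set" where
    Q: "\<forall>i\<le>k. primeideal (Q i) R" "\<forall>i<k. Q i \<subset> Q (Suc i)" "Q k = P'"
    using Suc.IH[OF _ P'(1)] Suc.prems(1) by auto
  have "(Q(Suc k := P)) i \<subset> (Q(Suc k := P)) (Suc i)" if "i < Suc k" for i
    using that Q(2,3) lt by (cases "i = k") auto
  moreover have "primeideal ((Q(Suc k := P)) i) R" if "i \<le> Suc k" for i
    using that Q(1) Suc.prems(2) by (cases "i = Suc k") auto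
  ultimately show ?case
    by (intro exI[of _ "Q(Suc k := P)"] conjI) (simp_all del: fun_upd_apply, simp)
qed

section \<open>A criterion for Cohen-Macaulay rings of a known dimension\<close>

lemma (in cring) ideal_depth_le_prime_codim:
  assumes "noetherian_ring R" "primeideal P R"
  shows "ideal_depth R P \<le> prime_codim R P"
  unfolding ideal_depth_def
proof (rule Sup_least, clarify)
  fix xs assume xs: "regular_sequence R xs" "set xs \<subseteq> P"
  have "set (take (length xs) xs) \<subseteq> P" using xs(2) by simp
  from regular_sequence_prime_chain[OF assms(1) xs(1) order_refl assms(2) this]
  have "enat (length xs) \<in> {enat n | n. \<exists>Q :: nat \<Rightarrow> 'a set.
     (\<forall>i \<le> n. primeideal (Q i) R) \<and> (\<forall>i < n. Q i \<subset> Q (Suc i)) \<and> Q n = P}"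
    by (intro CollectI exI[of _ "length xs"] conjI refl)
  then show "enat (length xs) \<le> prime_codim R P"
    unfolding prime_codim_def by (rule Sup_upper)
qed

text \<open>The chain k <= depth <= codimension <= k collapses; the outer inequalities are the two
  assumptions \<open>depth\<close> and \<open>dim\<close>.\<close>

lemma (in cring) cohen_macaulay_ringI:
  assumes N: "noetherian_ring R"
    and depth: "\<And>M. maximalideal M R \<Longrightarrow> \<exists>xs. regular_sequence R xs \<and> set xs \<subseteq> M \<and> length xs = k"
    and dim: "\<And>Q. \<forall>i\<le>Suc k. primeideal (Q i) R \<Longrightarrow> \<forall>i\<le>k. Q i \<subset> Q (Suc i) \<Longrightarrow> False"
  shows "cohen_macaulay_ring R"
  unfolding cohen_macaulay_ring_def
proof (intro conjI allI impI antisym)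
  fix M assume M: "maximalideal M R"
  then have P: "primeideal M R" by (rule maximalideal_prime)
  show "ideal_depth R M \<le> prime_codim R M"
    by (rule ideal_depth_le_prime_codim[OF N P])
  have "prime_codim R M \<le> enat k"
    unfolding prime_codim_def
  proof (rule Sup_least, clarify)
    fix n and Q :: "nat \<Rightarrow> 'a set"
    assume Q: "\<forall>i\<le>n. primeideal (Q i) R" "\<forall>i<n. Q i \<subset> Q (Suc i)"
    show "enat n \<le> enat k"
    proof (rule ccontr)
      assume "\<not> enat n \<le> enat k"
      then have "k < n" by simp
      then show False using Q by (intro dim[of Q]) auto
    qed
  qed
  also have "enat k \<le> ideal_depth R M"
    unfolding ideal_depth_def using depth[OF M] by (intro Sup_upper CollectI) metis
  finally show "prime_codim R M \<le> ideal_depth R M" .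
qed (use N is_cring in auto)

section \<open>The parametrization\<close>

text \<open>With \<mu> = x w and \<lambda> = x^2 w, the factor \<mu>^2 / \<lambda> of the moment
  recursion is w and \<mu>^2 is x^2 w^2, so that w^i splits off from the i-th moment. The
  coefficient \<open>2 * n + 1\<close> is 2i - 3 for i = n + 2.\<close>

fun ig_poly :: "nat \<Rightarrow> complex poly" where
  "ig_poly 0 = 1"
| "ig_poly (Suc 0) = [:0, 1:]"
| "ig_poly (Suc (Suc n)) = smult (of_nat (2 * n + 1)) (ig_poly (Suc n)) + [:0, 0, 1:] * ig_poly n"

fun bessel_poly :: "nat \<Rightarrow> complex poly" where
  "bessel_poly 0 = 1"
| "bessel_poly (Suc 0) = [:1, 1:]"
| "bessel_poly (Suc (Suc n)) = smult (of_nat (2 * n + 3)) (bessel_poly (Suc n)) + [:0, 0, 1:] * bessel_poly n"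

lemma ig_poly_Suc: "ig_poly (Suc n) = [:0, 1:] * bessel_poly n"
proof (induction n rule: bessel_poly.induct)
  case (3 n)
  have "ig_poly (Suc (Suc (Suc n)))
      = smult (of_nat (2 * n + 3)) (ig_poly (Suc (Suc n))) + [:0, 0, 1:] * ig_poly (Suc n)"
    by (subst ig_poly.simps(3)) (simp add: algebra_simps)
  then show ?case
    unfolding 3 by (simp only: bessel_poly.simps mult_smult_right algebra_simps)
qed (simp_all add: one_pCons)

lemma odd_of_nat_nonzero: "2 * of_nat n + 3 \<noteq> (0 :: complex)"
proof
  assume "2 * of_nat n + 3 = (0 :: complex)"
  then have "of_nat (2 * n + 3) = (0 :: complex)" by simp
  then show False unfolding of_nat_eq_0_iff by simp
qed

lemma bessel_poly_degree_lead: "degree (bessel_poly n) = n \<and> lead_coeff (bessel_poly n) = 1"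
proof (induction n rule: bessel_poly.induct)
  case (3 n)
  have IH: "degree (bessel_poly n) = n" "lead_coeff (bessel_poly n) = 1"
    "degree (bessel_poly (Suc n)) = Suc n" "bessel_poly n \<noteq> 0" using 3 by auto
  define A where "A = smult (of_nat (2 * n + 3)) (bessel_poly (Suc n))"
  define B where "B = [:0, 0, 1:] * bessel_poly n"
  have A: "degree A = Suc n"
    using IH odd_of_nat_nonzero[of n] unfolding A_def by simp
  have "degree B = Suc (Suc n)"
    using IH unfolding B_def by (simp add: degree_mult_eq)
  moreover have "lead_coeff B = 1"
    unfolding B_def lead_coeff_mult IH(2) by simp
  ultimately have B: "degree B = Suc (Suc n)" "lead_coeff B = 1" by auto
  have "degree (A + B) = Suc (Suc n)"
    using A B by (subst degree_add_eq_right) auto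
  moreover have "lead_coeff (A + B) = 1"
    using A B by (subst lead_coeff_add_le) auto
  ultimately show ?case by (simp add: A_def B_def)
qed auto

lemma degree_bessel_poly [simp]: "degree (bessel_poly n) = n"
  using bessel_poly_degree_lead by blast

lemma bessel_poly_nonzero [simp]: "bessel_poly n \<noteq> 0"
  using bessel_poly_degree_lead[of n] by auto

lemma poly_bessel_poly_0_nonzero: "poly (bessel_poly n) 0 \<noteq> 0"
  by (induction n rule: bessel_poly.induct) (use odd_of_nat_nonzero in auto)

lemma coprime_bessel_poly_X: "coprime (bessel_poly n) [:0, 1:]"
proof (rule coprimeI)
  fix c assume c: "c dvd bessel_poly n" "c dvd [:0, 1:]"
  have prime: "prime_elem [:0, 1 :: complex:]"
    by (rule prime_elem_linear_field_poly) simp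
  show "is_unit c"
  proof (rule ccontr)
    assume "\<not> is_unit c"
    then have "[:0, 1:] dvd c" by (rule prime_elemD2[OF prime c(2)])
    then have "[:0, 1:] dvd bessel_poly n" using c(1) by (rule dvd_trans)
    then show False
      using poly_bessel_poly_0_nonzero[of n] poly_eq_0_iff_dvd[of "bessel_poly n" 0] by simp
  qed
qed

text \<open>By the recursion a common divisor of two neighbours divides x^2 times the preceding
  polynomial. It is coprime to x, since Bessel polynomials have nonzero constant term, so it divides
  the preceding polynomial and the induction applies.\<close>

lemma coprime_bessel_poly_Suc: "coprime (bessel_poly (Suc n)) (bessel_poly n)"
proof (induction n)
  case (Suc n)
  have X: "[:0, 0, 1:] = [:0, 1:] * [:0, 1 :: complex:]" by simp
  show ?case
  proof (rule coprimeI)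
    fix c assume c: "c dvd bessel_poly (Suc (Suc n))" "c dvd bessel_poly (Suc n)"
    have "c dvd [:0, 0, 1:] * bessel_poly n"
      using dvd_diff[OF c(1) dvd_smult[OF c(2), of "of_nat (2 * n + 3)"]]
      by (simp del: of_nat_add of_nat_mult mult_pCons_left)
    moreover have "coprime c [:0, 1:]"
      by (rule coprime_divisors[OF c(2) dvd_refl coprime_bessel_poly_X])
    ultimately have "c dvd bessel_poly n"
      unfolding X mult.assoc by (simp only: coprime_dvd_mult_right_iff)
    with c(2) Suc show "is_unit c" by (meson coprime_common_divisor)
  qed
qed auto

text \<open>In the target ring the outer variable is the homogenising coordinate \<open>t\<close>, the middle one is
  \<open>w = \<mu>\<^sup>2 / \<lambda>\<close> and the inner one is \<open>x = \<mu> / w\<close>; then \<open>m\<^sub>i = t w\<^sup>i p\<^sub>i(x)\<close> with \<open>p\<^sub>i\<close> the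
  polynomial \<open>ig_poly i\<close>.\<close>

type_synonym tpoly = "complex poly poly poly"

abbreviation tconst :: "complex \<Rightarrow> tpoly" where
  "tconst c \<equiv> [:[:[:c:]:]:]"

definition param_coord :: "nat \<Rightarrow> tpoly" where
  "param_coord i = monom (monom (ig_poly i) i) 1"

interpretation param: subst_hom tconst
  by unfold_locales (simp_all add: one_pCons)

definition param :: "cpoly \<Rightarrow> tpoly" where
  "param = subst_poly tconst param_coord"

lemma param_simps [simp]:
  "param 0 = 0" "param 1 = 1" "param (f + g) = param f + param g" "param (f * g) = param f * param g"
  "param (- f) = - param f" "param (f - g) = param f - param g" "param (f ^ k) = param f ^ k"
  "param (of_nat k) = of_nat k" "param (numeral m) = numeral m"
  "param (sum F A) = (\<Sum>i\<in>A. param (F i))"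
  "param (Var i) = param_coord i" "param (Poly_Mapping.single a c) = tconst c * mono_val param_coord a"
  by (simp_all add: param_def hom_distribs)

definition wdegree :: "(nat \<Rightarrow>\<^sub>0 nat) \<Rightarrow> nat" where
  "wdegree a = (\<Sum>i\<in>keys a. i * lookup a i)"

lemma mono_val_param_coord:
  "mono_val param_coord a = monom (monom (mono_val ig_poly a) (wdegree a)) (mdegree a)"
proof -
  have "(\<Prod>i\<in>S. param_coord i ^ e i)
      = monom (monom (\<Prod>i\<in>S. ig_poly i ^ e i) (\<Sum>i\<in>S. i * e i)) (\<Sum>i\<in>S. e i)"
    if "finite S" for S and e :: "nat \<Rightarrow> nat"
    using that by induction (simp_all add: param_coord_def monom_power mult_monom)
  from this[of "keys a" "lookup a"] show ?thesis
    by (simp add: mono_val_def wdegree_def mdegree_def)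
qed

section \<open>Evaluation of the parametrization and vanishing on the variety\<close>

definition tpoly_eval :: "complex \<Rightarrow> complex \<Rightarrow> complex \<Rightarrow> tpoly \<Rightarrow> complex" where
  "tpoly_eval t w x F = poly (poly (poly F [:[:t:]:]) [:w:]) x"

lemma tpoly_eval_param: "tpoly_eval t w x (param f) = eval_poly f (\<lambda>i. t * w ^ i * poly (ig_poly i) x)"
proof -
  let ?v = "\<lambda>i. t * w ^ i * poly (ig_poly i) x"
  have coord: "tpoly_eval t w x (param_coord i) = ?v i" for i
    by (simp add: tpoly_eval_def param_coord_def poly_monom)
  have "tpoly_eval t w x (mono_val param_coord a) = (\<Prod>i\<in>keys a. tpoly_eval t w x (param_coord i) ^ lookup a i)" for a
    by (simp add: tpoly_eval_def mono_val_def poly_prod)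
  then have val: "tpoly_eval t w x (mono_val param_coord a) = mono_val ?v a" for a
    by (simp add: coord mono_val_def)
  have hom: "tpoly_eval t w x (F + G) = tpoly_eval t w x F + tpoly_eval t w x G"
    "tpoly_eval t w x (F * G) = tpoly_eval t w x F * tpoly_eval t w x G"
    "tpoly_eval t w x 0 = 0" "tpoly_eval t w x (tconst c) = c" for F G c
    by (simp_all add: tpoly_eval_def)
  show ?thesis
    unfolding eval_poly_conv_subst
  proof (induction f rule: cpoly_induct)
    case (single a c)
    then show ?case by (simp only: param_simps hom val eval_id.subst_single) simp
  qed (simp_all only: param_simps hom eval_id.subst_add eval_id.subst_0)
qed

lemma poly_eq_0_cofinite:
  fixes p :: "'a::idom poly"
  assumes "infinite A" "\<And>x. x \<in> A \<Longrightarrow> poly p x = 0"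
  shows "p = 0"
proof (rule ccontr)
  assume "p \<noteq> 0"
  then have "finite {x. poly p x = 0}" by (rule poly_roots_finite)
  then show False using assms by (meson finite_subset mem_Collect_eq subsetI)
qed

text \<open>Only points with nonzero coordinates are tested, because x w and x^2 w must be
  admissible values of \<mu> and \<lambda>. These values still form infinite sets, so the variables
  can be removed one after the other.\<close>

lemma tpoly_eq_0I:
  assumes "\<And>t w x. t \<noteq> 0 \<Longrightarrow> w \<noteq> 0 \<Longrightarrow> x \<noteq> 0 \<Longrightarrow> tpoly_eval t w x F = 0"
  shows "F = 0"
proof -
  have inf: "infinite (- {0 :: complex})"
    using infinite_UNIV_char_0 by (simp add: Compl_eq_Diff_UNIV)
  then have inf2: "infinite ((\<lambda>c. [:c:]) ` (- {0 :: complex}))"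
    by (subst finite_image_iff) (auto intro!: inj_onI)
  then have inf3: "infinite ((\<lambda>c. [:c:]) ` (\<lambda>c. [:c:]) ` (- {0 :: complex}))"
    by (subst finite_image_iff) (auto intro!: inj_onI)
  have "poly (poly F [:[:t:]:]) [:w:] = 0" if "t \<noteq> 0" "w \<noteq> 0" for t w
    using assms[OF that] by (intro poly_eq_0_cofinite[OF inf]) (auto simp: tpoly_eval_def)
  then have "poly F [:[:t:]:] = 0" if "t \<noteq> 0" for t
    using that by (intro poly_eq_0_cofinite[OF inf2]) auto
  then show ?thesis
    by (intro poly_eq_0_cofinite[OF inf3]) auto
qed

lemma eval_poly_cong:
  assumes "f \<in> polys d" "\<And>i. i \<le> d \<Longrightarrow> v i = v' i"
  shows "eval_poly f v = eval_poly f v'"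
proof -
  have "(\<Prod>i\<in>keys a. v i ^ lookup a i) = (\<Prod>i\<in>keys a. v' i ^ lookup a i)" if "a \<in> keys f" for a
  proof (rule prod.cong[OF refl])
    fix i assume "i \<in> keys a"
    then have "i \<le> d" using assms(1) that by (auto simp: polys_def)
    then show "v i ^ lookup a i = v' i ^ lookup a i" using assms(2) by simp
  qed
  then show ?thesis unfolding eval_poly_def by simp
qed

lemma eval_poly_homogeneous:
  assumes "homogeneous_of_degree n f"
  shows "eval_poly f (\<lambda>i. c * v i) = c ^ n * eval_poly f v"
proof -
  have "(\<Prod>i\<in>keys a. (c * v i) ^ lookup a i) = c ^ n * (\<Prod>i\<in>keys a. v i ^ lookup a i)" if "a \<in> keys f" for a
    using assms that
    by (simp add: homogeneous_of_degree_def mdegree_def power_mult_distrib prod.distrib power_sum[symmetric])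
  then show ?thesis
    unfolding eval_poly_def sum_distrib_left by (intro sum.cong) auto
qed

text \<open>The arguments \<open>x * w\<close> and \<open>x\<^sup>2 * w\<close> invert the change of
  parameters w = \<mu>^2 / \<lambda>, x = \<lambda> / \<mu>.\<close>

lemma ig_moment_conv_ig_poly:
  assumes "w \<noteq> 0" "x \<noteq> 0"
  shows "ig_moment (x * w) (x\<^sup>2 * w) i = w ^ i * poly (ig_poly i) x"
proof (induction i rule: ig_poly.induct)
  case (3 n)
  have "(x * w)\<^sup>2 / (x\<^sup>2 * w) = w" using assms by (simp add: power2_eq_square)
  then have *: "c / (x\<^sup>2 * w) * (x * w)\<^sup>2 = c * w" for c by (metis times_divide_eq_left times_divide_eq_right)
  have "ig_moment (x * w) (x\<^sup>2 * w) (Suc (Suc n)) = ((2 * of_nat (Suc (Suc n)) - 3) * w) * (w ^ Suc n * poly (ig_poly (Suc n)) x)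
      + (x * w)\<^sup>2 * (w ^ n * poly (ig_poly n) x)"
    unfolding ig_moment.simps 3 * ..
  then show ?case by (simp add: algebra_simps power2_eq_square)
qed auto

lemma ig_moment_0: "ig_moment 0 l (Suc i) = 0"
  by (induction i rule: less_induct) (case_tac x, auto)

text \<open>Passing to the closure costs nothing, because the zero locus of the single homogeneous
  polynomial \<open>f\<close> is itself closed. Homogeneity also absorbs the scalar t by which the
  parametrized vectors differ from the moment vectors.\<close>

lemma homogeneous_vanishing_iff_param:
  assumes "f \<in> homogeneous_polys d"
  shows "(\<forall>p \<in> ig_moment_variety d. vanishes_at f p) \<longleftrightarrow> param f = 0"
proof
  have f: "f \<in> polys d" using assms by (simp add: homogeneous_polys_def)
  from assms obtain n where n: "homogeneous_of_degree n f" by (auto simp: homogeneous_polys_def)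
  have cut: "eval_poly f (\<lambda>i. if i \<le> d then v i else 0) = eval_poly f v" for v
    by (rule eval_poly_cong[OF f]) auto
  show "param f = 0" if van: "\<forall>p \<in> ig_moment_variety d. vanishes_at f p"
  proof (rule tpoly_eq_0I)
    fix t w x :: complex assume nz: "t \<noteq> 0" "w \<noteq> 0" "x \<noteq> 0"
    let ?v = "\<lambda>i. if i \<le> d then ig_moment (x * w) (x\<^sup>2 * w) i else 0"
    have "ig_moment_point d (x * w) (x\<^sup>2 * w) \<in> ig_moment_variety d"
      unfolding ig_moment_variety_def zariski_closure_def using nz by fastforce
    then have "vanishes_at f (proj_point ?v)" using van by (simp add: ig_moment_point_def)
    moreover have "?v \<in> proj_point ?v"
      unfolding proj_point_def by (rule CollectI, rule exI[of _ 1]) simp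
    ultimately have "eval_poly f ?v = 0" by (auto simp: vanishes_at_def)
    then show "tpoly_eval t w x (param f) = 0"
      using eval_poly_homogeneous[OF n, of t] nz
      by (simp add: cut tpoly_eval_param ig_moment_conv_ig_poly mult.assoc)
  qed
  assume 0: "param f = 0"
  have "eval_poly f (ig_moment \<mu> l) = 0" if l: "l \<noteq> 0" for \<mu> l
  proof (cases "\<mu> = 0")
    \<comment> \<open>The points with \<mu> = 0 are not of the form x w with x and w nonzero. Their
      moment vector (1, 0, ..., 0) is the value of the parametrization at t = 1, w = 0, x =
      0.\<close>
    case True
    have "eval_poly f (ig_moment \<mu> l) = eval_poly f (\<lambda>i. 1 * 0 ^ i * poly (ig_poly i) 0)"
    proof (rule eval_poly_cong[OF f])
      show "ig_moment \<mu> l i = 1 * 0 ^ i * poly (ig_poly i) 0" for i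
        using True ig_moment_0 by (cases i) auto
    qed
    then show ?thesis using 0 tpoly_eval_param[of 1 0 0 f] by (simp add: tpoly_eval_def)
  next
    case False
    define w x where "w = \<mu>\<^sup>2 / l" and "x = l / \<mu>"
    have "x * w = \<mu>" "x\<^sup>2 * w = l" "w \<noteq> 0" "x \<noteq> 0"
      using False l by (auto simp: w_def x_def power2_eq_square field_simps)
    then have "ig_moment \<mu> l i = 1 * w ^ i * poly (ig_poly i) x" for i
      using ig_moment_conv_ig_poly[of w x i] by simp
    then have "ig_moment \<mu> l = (\<lambda>i. 1 * w ^ i * poly (ig_poly i) x)" by blast
    then show ?thesis using 0 tpoly_eval_param[of 1 w x f] by (simp add: tpoly_eval_def)
  qed
  then have *: "vanishes_at f (ig_moment_point d \<mu> l)" if "l \<noteq> 0" for \<mu> l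
    using that eval_poly_homogeneous[OF n] cut
    by (auto simp: vanishes_at_def ig_moment_point_def proj_point_def)
  have "ig_moment_point d \<mu> l \<in> proj_space d" for \<mu> l
    unfolding ig_moment_point_def proj_space_def by (rule imageI) (auto intro!: exI[of _ 0])
  then have "{ig_moment_point d \<mu> l | \<mu> l. l \<noteq> 0} \<subseteq> zero_locus d {f}"
    using * by (auto simp: zero_locus_def)
  moreover have "zariski_closed d (zero_locus d {f})"
    unfolding zariski_closed_def using assms by auto
  ultimately have "ig_moment_variety d \<subseteq> zero_locus d {f}"
    unfolding ig_moment_variety_def zariski_closure_def by blast
  then show "\<forall>p \<in> ig_moment_variety d. vanishes_at f p"
    by (auto simp: zero_locus_def)
qed

lemma vanishing_ideal_conv_param:
  "vanishing_ideal d (ig_moment_variety d)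
    = Idl\<^bsub>poly_ring d\<^esub> {f \<in> homogeneous_polys d. param f = 0}"
  unfolding vanishing_ideal_def using homogeneous_vanishing_iff_param
  by (intro arg_cong[of _ _ "genideal (poly_ring d)"]) blast

section \<open>Weights of monomials\<close>

definition weight :: "(nat \<Rightarrow> nat) \<Rightarrow> (nat \<Rightarrow>\<^sub>0 nat) \<Rightarrow> nat" where
  "weight \<phi> a = (\<Sum>i\<in>keys a. \<phi> i * lookup a i)"

lemma weight_superset:
  assumes "finite S" "keys a \<subseteq> S"
  shows "weight \<phi> a = (\<Sum>i\<in>S. \<phi> i * lookup a i)"
  unfolding weight_def using assms
  by (intro sum.mono_neutral_left) (auto simp: in_keys_iff)

lemma weight_add [simp]: "weight \<phi> (a + b) = weight \<phi> a + weight \<phi> b"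
  using weight_superset[of "keys a \<union> keys b" a \<phi>] weight_superset[of "keys a \<union> keys b" b \<phi>]
    weight_superset[of "keys a \<union> keys b" "a + b" \<phi>]
  by (simp add: lookup_add sum.distrib distrib_left)

lemma weight_0 [simp]: "weight \<phi> 0 = 0"
  by (simp add: weight_def)

lemma weight_single [simp]: "weight \<phi> (exp_single i k) = \<phi> i * k"
  by (cases "k = 0") (simp_all add: weight_def)

lemma mdegree_eq_weight: "mdegree a = weight (\<lambda>_. 1) a"
  by (simp add: mdegree_def weight_def)

lemma wdegree_eq_weight: "wdegree a = weight (\<lambda>i. i) a"
  by (simp add: wdegree_def weight_def)

lemma mdegree_simps [simp]:
  "mdegree (a + b) = mdegree a + mdegree b" "mdegree (exp_single i k) = k" "mdegree 0 = 0"
  by (simp_all add: mdegree_eq_weight)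

abbreviation sq_weight :: "(nat \<Rightarrow>\<^sub>0 nat) \<Rightarrow> nat" where
  "sq_weight \<equiv> weight (\<lambda>i. i ^ 2)"

text \<open>Reduction raises the weight while keeping the degree; this bound makes it end.\<close>

lemma sq_weight_le:
  assumes "keys a \<subseteq> {..d}"
  shows "sq_weight a \<le> d ^ 2 * mdegree a"
  unfolding weight_def mdegree_def sum_distrib_left
proof (rule sum_mono)
  fix i assume "i \<in> keys a"
  then have "i \<le> d" using assms by auto
  then show "i ^ 2 * lookup a i \<le> d ^ 2 * lookup a i"
    by (intro mult_right_mono power_mono) auto
qed

text \<open>The admissible tails behind a leading monomial of degree \<open>n\<close> and weight
  \<open>s\<close>: in the order used here a larger weight means a smaller monomial.\<close>

definition higher :: "nat \<Rightarrow> nat \<Rightarrow> cpoly set" where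
  "higher n s = {h. \<forall>a\<in>keys h. mdegree a = n \<and> s < sq_weight a}"

lemma higher_add: "f \<in> higher n s \<Longrightarrow> g \<in> higher n s \<Longrightarrow> f + g \<in> higher n s"
  using Poly_Mapping.keys_add[of f g] unfolding higher_def by blast

lemma higher_diff: "f \<in> higher n s \<Longrightarrow> g \<in> higher n s \<Longrightarrow> f - g \<in> higher n s"
  using keys_diff[of f g] unfolding higher_def by blast

lemma higher_of_nat_mult: "f \<in> higher n s \<Longrightarrow> of_nat k * f \<in> higher n s"
proof (induction k)
  case (Suc k)
  then show ?case using higher_add[of f n s "of_nat k * f"] by (simp add: distrib_right)
qed (simp add: higher_def)

lemma higher_mono: "mdegree a = n \<Longrightarrow> s < sq_weight a \<Longrightarrow> monomial a \<in> higher n s"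
  by (simp add: higher_def)

lemma higher_mult_mono: "h \<in> higher n s \<Longrightarrow> h * monomial b \<in> higher (n + mdegree b) (s + sq_weight b)"
  using Poly_Mapping.keys_mult[of h "monomial b"] unfolding higher_def by fastforce

section \<open>The maximal minors and their leading monomials\<close>

lemma det_2:
  assumes "A \<in> carrier_mat 2 2"
  shows "det A = A $$ (0, 0) * A $$ (1, 1) - A $$ (0, 1) * A $$ (1, 0)"
proof -
  have dims: "dim_row A = 2" "dim_col A = 2" using assms by auto
  have md: "mat_delete A i j \<in> carrier_mat 1 1" for i j
    using assms by (auto simp: mat_delete_def)
  have "det A = (\<Sum>j<2. A $$ (0, j) * cofactor A 0 j)"
    using laplace_expansion_row[OF assms, of 0] by simp
  also have "\<dots> = A $$ (0, 0) * cofactor A 0 0 + A $$ (0, 1) * cofactor A 0 1"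
    by (simp add: numeral_2_eq_2)
  also have "cofactor A 0 0 = A $$ (1, 1)"
    unfolding cofactor_def det_single[OF md] by (simp add: mat_delete_def dims)
  also have "cofactor A 0 1 = - A $$ (1, 0)"
    unfolding cofactor_def det_single[OF md] by (simp add: mat_delete_def dims)
  finally show ?thesis by simp
qed

lemma det_3:
  assumes "A \<in> carrier_mat 3 3"
  shows "det A = A $$ (0, 0) * (A $$ (1, 1) * A $$ (2, 2) - A $$ (1, 2) * A $$ (2, 1))
    - A $$ (0, 1) * (A $$ (1, 0) * A $$ (2, 2) - A $$ (1, 2) * A $$ (2, 0))
    + A $$ (0, 2) * (A $$ (1, 0) * A $$ (2, 1) - A $$ (1, 1) * A $$ (2, 0))"
proof -
  have dims: "dim_row A = 3" "dim_col A = 3" using assms by auto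
  have md: "mat_delete A i j \<in> carrier_mat 2 2" for i j
    using assms by (auto simp: mat_delete_def)
  have "det A = (\<Sum>j<3. A $$ (0, j) * cofactor A 0 j)"
    using laplace_expansion_row[OF assms, of 0] by simp
  also have "\<dots> = A $$ (0, 0) * cofactor A 0 0 + A $$ (0, 1) * cofactor A 0 1 + A $$ (0, 2) * cofactor A 0 2"
    by (simp add: eval_nat_numeral)
  also have "cofactor A 0 0 = A $$ (1, 1) * A $$ (2, 2) - A $$ (1, 2) * A $$ (2, 1)"
    unfolding cofactor_def det_2[OF md] by (simp add: mat_delete_def dims numeral_2_eq_2)
  also have "cofactor A 0 1 = - (A $$ (1, 0) * A $$ (2, 2) - A $$ (1, 2) * A $$ (2, 0))"
    unfolding cofactor_def det_2[OF md] by (simp add: mat_delete_def dims numeral_2_eq_2)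
  also have "cofactor A 0 2 = A $$ (1, 0) * A $$ (2, 1) - A $$ (1, 1) * A $$ (2, 0)"
    unfolding cofactor_def det_2[OF md] by (simp add: mat_delete_def dims numeral_2_eq_2)
  finally show ?thesis by (simp add: right_diff_distrib)
qed

definition row0 :: "nat \<Rightarrow> cpoly" where
  "row0 c = (if c = 0 then Var 0 ^ 2 else Var (c - 1))"
definition row1 :: "nat \<Rightarrow> cpoly" where
  "row1 c = (if c = 0 then 0 else of_nat (2 * c - 1) * Var c)"
definition row2 :: "nat \<Rightarrow> cpoly" where
  "row2 c = (if c = 0 then Var 1 ^ 2 else Var (c + 1))"

definition ig_minor :: "nat \<Rightarrow> nat \<Rightarrow> nat \<Rightarrow> cpoly" where
  "ig_minor a b c = row0 a * (row1 b * row2 c - row1 c * row2 b)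
    - row0 b * (row1 a * row2 c - row1 c * row2 a) + row0 c * (row1 a * row2 b - row1 b * row2 a)"

lemma ig_matrix_entries:
  assumes "c < d"
  shows "ig_matrix d $$ (0, c) = row0 c" "ig_matrix d $$ (1, c) = row1 c" "ig_matrix d $$ (2, c) = row2 c"
proof -
  have "2 * (c + 1) - 3 = 2 * c - 1" by simp
  with assms show "ig_matrix d $$ (0, c) = row0 c" "ig_matrix d $$ (1, c) = row1 c"
    "ig_matrix d $$ (2, c) = row2 c"
    by (simp_all add: ig_matrix_def row0_def row1_def row2_def Let_def)
qed

lemma pick_3:
  assumes "a < b" "b < c"
  shows "pick {a, b, c} 0 = a" "pick {a, b, c} 1 = b" "pick {a, b, c} 2 = c"
proof -
  show 0: "pick {a, b, c} 0 = a"
    unfolding pick.simps using assms by (intro Least_equality) auto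
  then show 1: "pick {a, b, c} 1 = b"
    unfolding One_nat_def pick.simps(2) using assms by (intro Least_equality) auto
  then show "pick {a, b, c} 2 = c"
    unfolding numeral_2_eq_2 pick.simps(2)[of _ "Suc 0"] One_nat_def using assms
    by (intro Least_equality) auto
qed

lemma det_submatrix_ig_matrix:
  assumes "a < b" "b < c" "c < d"
  shows "det (submatrix (ig_matrix d) UNIV {a, b, c}) = ig_minor a b c"
proof -
  let ?S = "submatrix (ig_matrix d) UNIV {a, b, c}"
  have dims: "dim_row (ig_matrix d) = 3" "dim_col (ig_matrix d) = d"
    by (simp_all add: ig_matrix_def)
  have "{j. j < d \<and> j \<in> {a, b, c}} = {a, b, c}" using assms by auto
  then have card: "card {j. j < dim_col (ig_matrix d) \<and> j \<in> {a, b, c}} = 3"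
    "card {i. i < dim_row (ig_matrix d) \<and> i \<in> UNIV} = 3"
    using assms by (simp_all add: dims)
  then have S: "?S \<in> carrier_mat 3 3"
    by (auto simp: dim_submatrix)
  have idx: "?S $$ (i, j) = ig_matrix d $$ (i, pick {a, b, c} j)" if "i < 3" "j < 3" for i j
    using submatrix_index[of i "ig_matrix d" UNIV j "{a, b, c}"] that unfolding card pick_UNIV by simp
  have ac: "a < d" "b < d" using assms by auto
  show ?thesis
    unfolding det_3[OF S] ig_minor_def
    by (simp del: pick.simps add: idx pick_3[OF assms(1,2)] pick_3[OF assms(1,2), unfolded One_nat_def] ig_matrix_entries[OF ac(1)]
        ig_matrix_entries[OF ac(2)] ig_matrix_entries[OF assms(3)]
        ig_matrix_entries[OF ac(1), unfolded One_nat_def]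
        ig_matrix_entries[OF ac(2), unfolded One_nat_def] ig_matrix_entries[OF assms(3), unfolded One_nat_def])
qed

text \<open>The columns are numbered from \<open>0\<close>. Under the order by \<open>- \<Sum> i\<^sup>2\<close>, concavity makes the
  antidiagonal term of every minor the leading one.\<close>

definition lead_exp :: "nat \<Rightarrow> nat \<Rightarrow> nat \<Rightarrow> (nat \<Rightarrow>\<^sub>0 nat)" where
  "lead_exp a b c = (if a = 0 then exp_single 1 2 else exp_single (a + 1) 1)
     + exp_single b 1 + exp_single (c - 1) 1"

lemma Var_mult3: "Var p * Var q * Var r = monomial (exp_single p 1 + exp_single q 1 + exp_single r 1)"
  by (simp add: Var_def mult_single)

lemma Var_mult4: "Var s ^ 2 * (Var p * Var q) = monomial (exp_single s 2 + exp_single p 1 + exp_single q 1)"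
proof -
  have "Var s ^ 2 = monomial (exp_single s 2)"
    by (simp add: Var_def mult_single power2_eq_square single_add[symmetric] numeral_2_eq_2)
  then show ?thesis by (simp add: Var_def mult_single add.assoc)
qed

text \<open>All terms of a minor have the same degree and the same sum of indices. The antidiagonal
  indices a + 1, b, c - 1 are the most balanced, so their sum of squares is strictly the least, by
  rearrangement. For \<open>a = 0\<close> the zero entry of the first column removes two terms, and
  \<open>Var 1 ^ 2\<close> takes the place of the factor with index a + 1.\<close>

lemma ig_minor_lead:
  assumes "a < b" "b < c"
  shows "\<exists>h. ig_minor a b c = - of_nat (2 * b - 1) * monomial (lead_exp a b c) + h
    \<and> h \<in> higher (mdegree (lead_exp a b c)) (sq_weight (lead_exp a b c))"
proof -
  obtain b' c' where bc: "b = Suc b'" "c = Suc c'" "b' < c'"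
    using assms by (cases b; cases c) auto
  have V3: "Var p * Var q * Var r \<in> higher 3 s" if "s < p ^ 2 + q ^ 2 + r ^ 2" for p q r s
    unfolding Var_mult3 using that by (intro higher_mono) simp_all
  have V4: "Var t ^ 2 * (Var p * Var q) \<in> higher 4 s" if "s < 2 * t ^ 2 + p ^ 2 + q ^ 2" for t p q s
    unfolding Var_mult4 using that by (intro higher_mono) simp_all
  show ?thesis
  proof (cases a)
    case 0
    define h where "h = of_nat (2 * b - 1) * (Var 0 ^ 2 * (Var (Suc b') * Var (Suc (Suc c'))))
      - of_nat (2 * c - 1) * (Var 0 ^ 2 * (Var (Suc c') * Var (Suc (Suc b'))))
      + of_nat (2 * c - 1) * (Var 1 ^ 2 * (Var b' * Var (Suc c')))"
    have lead: "monomial (lead_exp a b c) = Var 1 ^ 2 * (Var (Suc b') * Var c')"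
      unfolding Var_mult4 lead_exp_def using 0 bc by simp
    have "ig_minor a b c = - of_nat (2 * b - 1) * monomial (lead_exp a b c) + h"
      unfolding lead h_def ig_minor_def row0_def row1_def row2_def using 0 bc
      by (simp add: algebra_simps del: of_nat_add of_nat_mult)
    moreover have "h \<in> higher (mdegree (lead_exp a b c)) (sq_weight (lead_exp a b c))"
    proof -
      have w: "mdegree (lead_exp a b c) = 4" "sq_weight (lead_exp a b c) = 2 + (Suc b') ^ 2 + c' ^ 2"
        using 0 bc by (simp_all add: lead_exp_def)
      show ?thesis
        unfolding h_def w
        by (intro higher_add higher_diff higher_of_nat_mult V4)
          (use bc(3) in \<open>simp_all add: power2_eq_square algebra_simps\<close>)
    qed
    ultimately show ?thesis by blast
  next
    case (Suc a')
    then have ab: "a' < b'" using assms bc by simp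
    define h where "h = of_nat (2 * b - 1) * (Var a' * Var (Suc b') * Var (Suc (Suc c')))
      - of_nat (2 * c - 1) * (Var a' * Var (Suc c') * Var (Suc (Suc b')))
      - of_nat (2 * a - 1) * (Var b' * Var (Suc a') * Var (Suc (Suc c')))
      + of_nat (2 * c - 1) * (Var b' * Var (Suc c') * Var (Suc (Suc a')))
      + of_nat (2 * a - 1) * (Var c' * Var (Suc a') * Var (Suc (Suc b')))"
    have lead: "monomial (lead_exp a b c) = Var (Suc (Suc a')) * Var (Suc b') * Var c'"
      unfolding Var_mult3 lead_exp_def using Suc bc by simp
    have "ig_minor a b c = - of_nat (2 * b - 1) * monomial (lead_exp a b c) + h"
      unfolding lead h_def ig_minor_def row0_def row1_def row2_def using Suc bc
      by (simp add: algebra_simps del: of_nat_add of_nat_mult)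
    moreover have "h \<in> higher (mdegree (lead_exp a b c)) (sq_weight (lead_exp a b c))"
    proof -
      have w: "mdegree (lead_exp a b c) = 3"
        "sq_weight (lead_exp a b c) = (Suc (Suc a')) ^ 2 + (Suc b') ^ 2 + c' ^ 2"
        using Suc bc by (simp_all add: lead_exp_def)
      show ?thesis
        unfolding h_def w
        by (intro higher_add higher_diff higher_of_nat_mult V3)
          (use bc(3) ab in \<open>simp_all add: power2_eq_square algebra_simps\<close>)
    qed
    ultimately show ?thesis by blast
  qed
qed

lemma ig_minor_lead':
  assumes "a < b" "b < c"
  obtains k h where "k \<noteq> 0" "ig_minor a b c = Poly_Mapping.single (lead_exp a b c) k + h"
    "h \<in> higher (mdegree (lead_exp a b c)) (sq_weight (lead_exp a b c))"
proof -
  define m where "m = 2 * b - 1"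
  have m: "- of_nat m \<noteq> (0 :: complex)" using assms by (simp add: m_def del: of_nat_diff)
  obtain h where h: "ig_minor a b c = - of_nat m * monomial (lead_exp a b c) + h"
    "h \<in> higher (mdegree (lead_exp a b c)) (sq_weight (lead_exp a b c))"
    using ig_minor_lead[OF assms] unfolding m_def by (elim exE conjE)
  have "of_nat m * monomial (lead_exp a b c) = Poly_Mapping.single (lead_exp a b c) (of_nat m)"
    unfolding single_of_nat[symmetric] mult_single by (simp del: single_of_nat)
  then show thesis
    using that[OF m _ h(2)] h(1) by (simp add: single_uminus)
qed

lemma ig_minor_keys:
  assumes "a < b" "b < c"
  shows "lead_exp a b c \<in> keys (ig_minor a b c)"
    "e \<in> keys (ig_minor a b c) \<Longrightarrow> e = lead_exp a b c \<or> sq_weight (lead_exp a b c) < sq_weight e"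
    "homogeneous_of_degree (if a = 0 then 4 else 3) (ig_minor a b c)" "ig_minor a b c \<noteq> 0"
proof -
  obtain k h where *: "k \<noteq> 0" "ig_minor a b c = Poly_Mapping.single (lead_exp a b c) k + h"
    "h \<in> higher (mdegree (lead_exp a b c)) (sq_weight (lead_exp a b c))"
    using ig_minor_lead'[OF assms] .
  have h: "mdegree e = mdegree (lead_exp a b c) \<and> sq_weight (lead_exp a b c) < sq_weight e"
    if "e \<in> keys h" for e
    using that *(3) by (simp add: higher_def)
  have "lead_exp a b c \<notin> keys h" using h[of "lead_exp a b c"] by auto
  then have "lookup (ig_minor a b c) (lead_exp a b c) = k"
    unfolding *(2) by (simp add: lookup_add in_keys_iff)
  then show lead: "lead_exp a b c \<in> keys (ig_minor a b c)"
    using *(1) by (simp add: in_keys_iff)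
  then show "ig_minor a b c \<noteq> 0" by auto
  have sub: "keys (ig_minor a b c) \<subseteq> {lead_exp a b c} \<union> keys h"
    unfolding *(2) using Poly_Mapping.keys_add[of "Poly_Mapping.single (lead_exp a b c) k" h]
    by (auto split: if_splits)
  then show "e = lead_exp a b c \<or> sq_weight (lead_exp a b c) < sq_weight e"
    if "e \<in> keys (ig_minor a b c)" using that h by blast
  have "mdegree (lead_exp a b c) = (if a = 0 then 4 else 3)"
    by (simp add: lead_exp_def)
  then show "homogeneous_of_degree (if a = 0 then 4 else 3) (ig_minor a b c)"
    unfolding homogeneous_of_degree_def using sub h by auto
qed

lemma sorted_exp_unique:
  assumes "p \<le> q" "q \<le> r" "p' \<le> q'" "q' \<le> r'"
    and eq: "exp_single p 1 + exp_single q 1 + exp_single r 1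
      = exp_single p' 1 + exp_single q' 1 + exp_single r' (1 :: nat)"
  shows "p = p' \<and> q = q' \<and> r = r'"
proof -
  have "{p, q, r} = {p', q', r'}"
    using arg_cong[OF eq, of keys] by (simp add: insert_commute)
  then have "Min {p, q, r} = Min {p', q', r'}" "Max {p, q, r} = Max {p', q', r'}" by simp_all
  then have pr: "p = p'" "r = r'" using assms(1-4) by (auto simp: min_def max_def split: if_splits)
  with eq have "exp_single q 1 = exp_single q' (1 :: nat)" by simp
  then have "keys (exp_single q (1 :: nat)) = keys (exp_single q' (1 :: nat))" by (rule arg_cong)
  then show ?thesis using pr by simp
qed

text \<open>The indices a + 1 <= b <= c - 1 are already sorted, so the monomial determines them.
  Degree four marks the case \<open>a = 0\<close>, in which one surplus factor m_1 is
  cancelled.\<close>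

lemma lead_exp_inj:
  assumes "a < b" "b < c" "a' < b'" "b' < c'" "lead_exp a b c = lead_exp a' b' c'"
  shows "a = a' \<and> b = b' \<and> c = c'"
proof -
  have "mdegree (lead_exp a b c) = mdegree (lead_exp a' b' c')" using assms(5) by simp
  then have a0: "a = 0 \<longleftrightarrow> a' = 0" by (simp add: lead_exp_def split: if_splits)
  have split2: "exp_single 1 2 = exp_single 1 1 + exp_single 1 (1 :: nat)"
    by (simp add: single_add[symmetric] numeral_2_eq_2)
  have "exp_single (a + 1) 1 + exp_single b 1 + exp_single (c - 1) 1
      = exp_single (a' + 1) 1 + exp_single b' 1 + exp_single (c' - 1) (1 :: nat)"
    using assms(5) a0 unfolding lead_exp_def split2 by (auto simp: add.assoc split: if_splits)
  then have "a + 1 = a' + 1 \<and> b = b' \<and> c - 1 = c' - 1"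
    using assms(1-4) by (intro sorted_exp_unique) auto
  then show ?thesis using assms(1-4) by auto
qed

text \<open>Each leading monomial occurs in both polynomials, so neither can have the larger weight.
  Injectivity makes the numbers of cubics and quartics exact.\<close>

lemma ig_minor_inj:
  assumes "a < b" "b < c" "a' < b'" "b' < c'" "ig_minor a b c = ig_minor a' b' c'"
  shows "a = a' \<and> b = b' \<and> c = c'"
proof (rule lead_exp_inj[OF assms(1-4)])
  have "lead_exp a b c = lead_exp a' b' c' \<or> sq_weight (lead_exp a' b' c') < sq_weight (lead_exp a b c)"
    using ig_minor_keys(2)[OF assms(3,4)] ig_minor_keys(1)[OF assms(1,2)] assms(5) by simp
  moreover have "lead_exp a' b' c' = lead_exp a b c \<or> sq_weight (lead_exp a b c) < sq_weight (lead_exp a' b' c')"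
    using ig_minor_keys(2)[OF assms(1,2)] ig_minor_keys(1)[OF assms(3,4)] assms(5) by simp
  ultimately show "lead_exp a b c = lead_exp a' b' c'" by auto
qed

lemma ig_minor_polys:
  assumes "a < b" "b < c" "c < d"
  shows "ig_minor a b c \<in> polys d"
proof -
  have "row0 x \<in> polys d" "row1 x \<in> polys d" "row2 x \<in> polys d" if "x < d" for x
    using that by (auto simp: row0_def row1_def row2_def simp del: of_nat_diff)
  then show ?thesis
    unfolding ig_minor_def using assms by (intro polys_add polys_diff polys_mult) auto
qed

text \<open>The row relation \<open>\<mu>\<^sup>2 row\<^sub>0 + w row\<^sub>1 = row\<^sub>2\<close> is the moment recursion.\<close>

lemma param_ig_minor: "param (ig_minor a b c) = 0"
proof -
  \<comment> \<open>\<open>\<alpha>\<close> is \<mu>^2 = x^2 w^2 and \<open>\<beta>\<close> is w,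
    both free of t. The first column obeys the same relation because its middle entry is zero and
    m_1 = \<mu> m_0.\<close>
  define \<alpha> \<beta> :: tpoly where "\<alpha> = [:monom (monom 1 2) 2:]" and "\<beta> = [:monom 1 1:]"
  have row2: "param (row2 c) = \<alpha> * param (row0 c) + \<beta> * param (row1 c)" for c
  proof (cases c)
    case 0
    then show ?thesis
      by (simp add: row0_def row1_def row2_def \<alpha>_def param_coord_def power2_eq_square mult_monom smult_monom)
        (simp add: monom_altdef power2_eq_square)
  next
    case (Suc c')
    define k where "k = 2 * c' + 1"
    have k: "2 * c - 1 = k" using Suc by (simp add: k_def)
    have "[:0, 0, 1:] = monom (1 :: complex) 2"
      by (simp add: monom_altdef power2_eq_square)
    then have rec: "ig_poly (Suc (Suc c')) = smult (of_nat k) (ig_poly (Suc c')) + monom 1 2 * ig_poly c'"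
      by (simp only: ig_poly.simps(3) k_def)
    have of_nat_monom: "of_nat k * monom (monom p m) 1 = (monom (monom (smult (of_nat k) p) m) 1 :: tpoly)" for p m
      by (simp add: of_nat_poly smult_monom)
    have "param (row1 c) = monom (monom (smult (of_nat k) (ig_poly (Suc c'))) (Suc c')) 1"
      unfolding row1_def k using Suc by (simp add: param_coord_def of_nat_monom[unfolded One_nat_def])
    moreover have "param (row0 c) = monom (monom (ig_poly c') c') 1"
      "param (row2 c) = monom (monom (ig_poly (Suc (Suc c'))) (Suc (Suc c'))) 1"
      using Suc by (simp_all add: row0_def row2_def param_coord_def del: ig_poly.simps)
    ultimately show ?thesis
      unfolding rec by (simp add: \<alpha>_def \<beta>_def smult_monom mult_monom add_monom)
  qed
  show ?thesis
    unfolding ig_minor_def param_simps row2 by (simp add: algebra_simps)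
qed

section \<open>Reduction to standard monomials\<close>

text \<open>These are the monomials divisible by no \<open>lead_exp a b c\<close> with a < b < c <
  d. The exponents of m_0, m_{d-1} and m_d are unrestricted, as these variables divide no leading
  monomial.\<close>

definition standard :: "nat \<Rightarrow> (nat \<Rightarrow>\<^sub>0 nat) \<Rightarrow> bool" where
  "standard d a \<longleftrightarrow> (\<Sum>i\<in>{2..d-2}. lookup a i) \<le> 2 \<and>
     (2 \<le> lookup a 1 \<longrightarrow> lookup a 1 + (\<Sum>i\<in>{2..d-2}. lookup a i) \<le> 3)"

lemma extract_variable:
  fixes a :: "nat \<Rightarrow>\<^sub>0 nat"
  assumes "finite S" "(\<Sum>i\<in>S. lookup a i) = Suc m"
  obtains p b where "p \<in> S" "a = exp_single p 1 + b" "(\<Sum>i\<in>S. lookup b i) = m"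
proof -
  have "\<exists>p\<in>S. lookup a p \<noteq> 0"
    using assms(2) by (metis Zero_not_Suc sum.neutral)
  then obtain p where p: "p \<in> S" "lookup a p \<noteq> 0" by (elim bexE)
  define b where "b = a - exp_single p 1"
  have a: "a = exp_single p 1 + b"
    by (rule poly_mapping_eqI)
      (use p(2) in \<open>auto simp: b_def lookup_add minus_poly_mapping.rep_eq lookup_single when_def\<close>)
  have "(\<Sum>i\<in>S. lookup a i) = (\<Sum>i\<in>S. lookup (exp_single p 1) i) + (\<Sum>i\<in>S. lookup b i)"
    by (simp only: a lookup_add sum.distrib)
  also have "(\<Sum>i\<in>S. lookup (exp_single p (1 :: nat)) i) = 1"
    using assms(1) p(1) by (simp add: lookup_single when_def sum.delta')
  finally show thesis using assms(2) a p(1) that by simp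
qed

lemma extract_two:
  fixes a :: "nat \<Rightarrow>\<^sub>0 nat"
  assumes "finite S" "(\<Sum>i\<in>S. lookup a i) \<ge> 2"
  obtains p q b where "p \<in> S" "q \<in> S" "p \<le> q" "a = exp_single p 1 + exp_single q 1 + b"
proof -
  obtain m where "(\<Sum>i\<in>S. lookup a i) = Suc (Suc m)"
    using assms(2) by (metis add_2_eq_Suc le_Suc_ex)
  then obtain p b where p: "p \<in> S" "a = exp_single p 1 + b" "(\<Sum>i\<in>S. lookup b i) = Suc m"
    by (rule extract_variable[OF assms(1)])
  obtain q e where q: "q \<in> S" "b = exp_single q 1 + e"
    by (rule extract_variable[OF assms(1) p(3)])
  show thesis
  proof (cases "p \<le> q")
    case True
    then show thesis using that[OF p(1) q(1) True] p(2) q(2) by (simp add: add.assoc)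
  next
    case False
    then have "q \<le> p" by simp
    then show thesis using that[OF q(1) p(1)] p(2) q(2) by (simp add: ac_simps)
  qed
qed

lemma extract_three:
  fixes a :: "nat \<Rightarrow>\<^sub>0 nat"
  assumes "finite S" "(\<Sum>i\<in>S. lookup a i) \<ge> 3"
  obtains p q r b where "p \<in> S" "q \<in> S" "r \<in> S" "p \<le> q" "q \<le> r"
    "a = exp_single p 1 + exp_single q 1 + exp_single r 1 + b"
proof -
  obtain m where "(\<Sum>i\<in>S. lookup a i) = Suc (Suc (Suc m))"
    using assms(2) by (metis add_Suc eval_nat_numeral(3) le_Suc_ex numeral_2_eq_2 plus_nat.simps(1,2) numeral_3_eq_3)
  then obtain r b where r: "r \<in> S" "a = exp_single r 1 + b" "(\<Sum>i\<in>S. lookup b i) = Suc (Suc m)"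
    by (rule extract_variable[OF assms(1)])
  have "(\<Sum>i\<in>S. lookup b i) \<ge> 2" using r(3) by simp
  then obtain p q e where pq: "p \<in> S" "q \<in> S" "p \<le> q" "b = exp_single p 1 + exp_single q 1 + e"
    by (rule extract_two[OF assms(1)])
  consider "r \<le> p" | "p \<le> r" "r \<le> q" | "q \<le> r" using pq(3) by linarith
  then show thesis
  proof cases
    case 1
    then show thesis using that[OF r(1) pq(1,2) 1 pq(3)] r(2) pq(4) by (simp add: ac_simps)
  next
    case 2
    then show thesis using that[OF pq(1) r(1) pq(2) 2] r(2) pq(4) by (simp add: ac_simps)
  next
    case 3
    then show thesis using that[OF pq(1,2) r(1) pq(3) 3] r(2) pq(4) by (simp add: ac_simps)
  qed
qed

text \<open>Three factors p <= q <= r among m_2, ..., m_{d-2} form the leading monomial of the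
  columns p - 1, q, r + 1. Otherwise m_1^2 occurs together with two more factors p <= q among m_1,
  ..., m_{d-2}, and the columns 0, p, q + 1 serve.\<close>

lemma nonstandard_imp_lead_exp:
  assumes "d \<ge> 3" "\<not> standard d e"
  obtains a b c f where "a < b" "b < c" "c < d" "e = lead_exp a b c + f"
proof (cases "(\<Sum>i\<in>{2..d-2}. lookup e i) \<ge> 3")
  case True
  obtain p q r f where *: "p \<in> {2..d-2}" "q \<in> {2..d-2}" "r \<in> {2..d-2}" "p \<le> q" "q \<le> r"
    "e = exp_single p 1 + exp_single q 1 + exp_single r 1 + f"
    using extract_three[OF _ True] by blast
  have "e = lead_exp (p - 1) q (r + 1) + f"
    using * by (simp add: lead_exp_def)
  then show thesis using * by (intro that[of "p - 1" q "r + 1" f]) auto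
next
  case False
  with assms(2) have e: "2 \<le> lookup e 1" "lookup e 1 + (\<Sum>i\<in>{2..d-2}. lookup e i) \<ge> 4"
    by (auto simp: standard_def)
  define g where "g = e - exp_single 1 2"
  have eg: "e = exp_single 1 2 + g"
    by (rule poly_mapping_eqI)
      (use e(1) in \<open>auto simp: g_def lookup_add minus_poly_mapping.rep_eq lookup_single when_def\<close>)
  have "{1..d-2} = insert 1 {2..d-2}" using assms(1) by auto
  then have "(\<Sum>i\<in>{1..d-2}. lookup e i) \<ge> 4" using e(2) by simp
  moreover have "(\<Sum>i\<in>{1..d-2}. lookup e i)
      = (\<Sum>i\<in>{1..d-2}. lookup (exp_single 1 2) i) + (\<Sum>i\<in>{1..d-2}. lookup g i)"
    by (simp only: eg lookup_add sum.distrib)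
  moreover have "(\<Sum>i\<in>{1..d-2}. lookup (exp_single 1 (2 :: nat)) i) = 2"
    using assms(1) by (simp add: lookup_single when_def sum.delta')
  ultimately have "(\<Sum>i\<in>{1..d-2}. lookup g i) \<ge> 2" by linarith
  then obtain p q f where *: "p \<in> {1..d-2}" "q \<in> {1..d-2}" "p \<le> q" "g = exp_single p 1 + exp_single q 1 + f"
    using extract_two[of "{1..d-2}" g] by blast
  have "e = lead_exp 0 p (q + 1) + f"
    unfolding eg *(4) by (simp add: lead_exp_def ac_simps)
  then show thesis using * assms(1) by (intro that[of 0 p "q + 1" f]) auto
qed

definition reduced :: "nat \<Rightarrow> cpoly \<Rightarrow> bool" where
  "reduced d f \<longleftrightarrow> f \<in> polys d \<and> (\<forall>a\<in>keys f. standard d a)"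

lemma reduced_0: "reduced d 0"
  by (simp add: reduced_def)

lemma reduced_add: "reduced d f \<Longrightarrow> reduced d g \<Longrightarrow> reduced d (f + g)"
  using Poly_Mapping.keys_add[of f g] unfolding reduced_def by auto

lemma reduced_diff: "reduced d f \<Longrightarrow> reduced d g \<Longrightarrow> reduced d (f - g)"
  using keys_diff[of f g] unfolding reduced_def by auto

lemma keys_Const_mult: "keys (Const c * f) \<subseteq> keys f"
  using Poly_Mapping.keys_mult[of "Const c" f] by (auto split: if_splits)

lemma reduced_Const_mult: "reduced d f \<Longrightarrow> reduced d (Const c * f)"
  using keys_Const_mult[of c f] unfolding reduced_def by auto

context
  fixes d :: nat and I :: "cpoly set"
  assumes d: "d \<ge> 3" and I: "ideal I (poly_ring d)"
    and minors: "\<And>a b c. a < b \<Longrightarrow> b < c \<Longrightarrow> c < d \<Longrightarrow> ig_minor a b c \<in> I"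
begin

lemma reduce_sum:
  assumes "\<And>a. a \<in> keys f \<Longrightarrow> \<exists>r. reduced d r \<and> monomial a - r \<in> I"
  shows "\<exists>r. reduced d r \<and> f - r \<in> I"
proof -
  have "\<exists>r. reduced d r \<and> (\<Sum>a\<in>A. Poly_Mapping.single a (lookup f a)) - r \<in> I"
    if "finite A" "A \<subseteq> keys f" for A
    using that
  proof induction
    case empty
    then show ?case using reduced_0 ideal_polysD(1)[OF I] by (intro exI[of _ 0]) simp
  next
    case (insert a A)
    then obtain r where r: "reduced d r" "(\<Sum>a\<in>A. Poly_Mapping.single a (lookup f a)) - r \<in> I" by auto
    obtain s where s: "reduced d s" "monomial a - s \<in> I" using assms insert.prems by auto
    let ?c = "Const (lookup f a)"
    have "?c * (monomial a - s) \<in> I"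
      by (rule ideal_polysD(4)[OF I s(2) polys_Const])
    from ideal_polysD(3)[OF I this r(2)]
    have "(\<Sum>a\<in>insert a A. Poly_Mapping.single a (lookup f a)) - (?c * s + r) \<in> I"
      using insert.hyps by (simp add: single_eq_Const_mult_mono[of a "lookup f a"] algebra_simps)
    then show ?case
      using reduced_add[OF reduced_Const_mult[OF s(1)] r(1)] by (intro exI conjI)
  qed
  from this[of "keys f"] show ?thesis
    by (simp add: cpoly_eq_sum_single[symmetric])
qed

text \<open>A nonstandard monomial is exchanged for the tail of a multiple of a minor. The tail has
  the same degree and strictly larger weights, so the distance to the bound d^2 times the degree
  decreases.\<close>

lemma reduce_mono:
  "keys e \<subseteq> {..d} \<Longrightarrow> \<exists>r. reduced d r \<and> monomial e - r \<in> I"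
proof (induction "d ^ 2 * mdegree e - sq_weight e" arbitrary: e rule: less_induct)
  case less
  show ?case
  proof (cases "standard d e")
    case True
    then have "reduced d (monomial e)" using less.prems by (simp add: reduced_def polys_single)
    then show ?thesis using ideal_polysD(1)[OF I] by (intro exI[of _ "monomial e"]) simp
  next
    case False
    obtain a b c f where *: "a < b" "b < c" "c < d" "e = lead_exp a b c + f"
      using nonstandard_imp_lead_exp[OF d False] .
    define l where "l = lead_exp a b c"
    obtain k h where kh: "k \<noteq> 0" "ig_minor a b c = Poly_Mapping.single l k + h"
      "h \<in> higher (mdegree l) (sq_weight l)"
      unfolding l_def using ig_minor_lead'[OF *(1,2)] .
    have keys: "keys l \<subseteq> {..d}" "keys f \<subseteq> {..d}" using less.prems *(4) by (auto simp: l_def)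
    have "h = ig_minor a b c - Poly_Mapping.single l k" using kh(2) by simp
    then have h: "h \<in> polys d"
      using ig_minor_polys[OF *(1-3)] polys_single[OF keys(1)] by simp
    define q where "q = Const (1 / k) * monomial f"
    have q: "q \<in> polys d" unfolding q_def using keys(2) by (simp add: polys_single)
    have "q * ig_minor a b c \<in> I"
      by (rule ideal_polysD(4)[OF I minors[OF *(1-3)] q])
    moreover have "q * Poly_Mapping.single l k = monomial e"
      using kh(1) *(4) by (simp add: q_def l_def mult_single ac_simps)
    ultimately have eI: "monomial e + q * h \<in> I" by (simp add: kh(2) distrib_left)
    have "\<exists>r. reduced d r \<and> q * h - r \<in> I"
    proof (rule reduce_sum)
      fix e' assume e': "e' \<in> keys (q * h)"
      have "q * h = Const (1 / k) * (h * monomial f)" by (simp add: q_def ac_simps)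
      then have "keys (q * h) \<subseteq> keys (h * monomial f)" by (simp only: keys_Const_mult)
      then have "e' \<in> keys (h * monomial f)" using e' by (rule subsetD)
      then have "mdegree e' = mdegree e" "sq_weight e < sq_weight e'"
        using higher_mult_mono[OF kh(3), of f] *(4) by (auto simp: higher_def l_def)
      moreover have k': "keys e' \<subseteq> {..d}" using e' polys_mult[OF q h] by (auto simp: polys_def)
      ultimately show "\<exists>r. reduced d r \<and> monomial e' - r \<in> I"
        using sq_weight_le[OF k'] by (intro less.hyps) auto
    qed
    then obtain r where r: "reduced d r" "q * h - r \<in> I" by (elim exE conjE)
    have "monomial e - - r = (monomial e + q * h) - (q * h - r)" by simp
    then have "monomial e - - r \<in> I" using ideal_polysD(7)[OF I eI r(2)] by simp
    moreover have "reduced d (- r)" using reduced_diff[OF reduced_0 r(1)] by simp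
    ultimately show ?thesis by (intro exI conjI)
  qed
qed

lemma reduce_poly: "f \<in> polys d \<Longrightarrow> \<exists>r. reduced d r \<and> f - r \<in> I"
  by (rule reduce_sum, rule reduce_mono) (simp add: polys_def)

end

section \<open>Independence of the standard monomials\<close>

text \<open>The coefficient ring \<open>A\<close>, over which the coordinate ring turns out to be
  free.\<close>

definition free_polys :: "nat \<Rightarrow> cpoly set" where
  "free_polys d = {f. \<forall>a\<in>keys f. keys a \<subseteq> {0, d - 1, d}}"

lemma free_polys_add: "f \<in> free_polys d \<Longrightarrow> g \<in> free_polys d \<Longrightarrow> f + g \<in> free_polys d"
  using Poly_Mapping.keys_add[of f g] unfolding free_polys_def by blast

lemma free_polys_uminus: "f \<in> free_polys d \<Longrightarrow> - f \<in> free_polys d"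
  unfolding free_polys_def by (simp add: in_keys_iff)

lemma free_polys_diff: "f \<in> free_polys d \<Longrightarrow> g \<in> free_polys d \<Longrightarrow> f - g \<in> free_polys d"
  using free_polys_add[OF _ free_polys_uminus] by fastforce

lemma free_polys_mult:
  assumes "f \<in> free_polys d" "g \<in> free_polys d"
  shows "f * g \<in> free_polys d"
  unfolding free_polys_def
proof (intro CollectI ballI)
  fix c assume "c \<in> keys (f * g)"
  then obtain a b where ab: "a \<in> keys f" "b \<in> keys g" "c = a + b"
    using Poly_Mapping.keys_mult[of f g] by auto
  have "keys a \<subseteq> {0, d - 1, d}" "keys b \<subseteq> {0, d - 1, d}"
    using ab assms unfolding free_polys_def by blast+
  then show "keys c \<subseteq> {0, d - 1, d}" unfolding ab(3) by simp
qed

lemma free_polys_0 [simp]: "0 \<in> free_polys d" and free_polys_1 [simp]: "1 \<in> free_polys d"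
  by (simp_all add: free_polys_def)

lemma free_polys_sum: "(\<And>i. i \<in> A \<Longrightarrow> f i \<in> free_polys d) \<Longrightarrow> sum f A \<in> free_polys d"
  by (induction A rule: infinite_finite_induct) (auto intro: free_polys_add)

lemma mono_val_ig_poly_free:
  assumes "d \<ge> 3" "keys a \<subseteq> {0, d - 1, d}"
  shows "mono_val ig_poly a = [:0, 1:] ^ (lookup a (d - 1) + lookup a d)
      * bessel_poly (d - 2) ^ lookup a (d - 1) * bessel_poly (d - 1) ^ lookup a d"
    and "wdegree a = (d - 1) * lookup a (d - 1) + d * lookup a d"
    and "mdegree a = lookup a 0 + lookup a (d - 1) + lookup a d"
proof -
  have ne: "0 \<noteq> d - 1" "0 \<noteq> d" "d - 1 \<noteq> d" using assms(1) by auto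
  have e1: "ig_poly (d - 1) = [:0, 1:] * bessel_poly (d - 2)"
    using ig_poly_Suc[of "d - 2"] assms(1) by (simp add: numeral_2_eq_2 Suc_diff_Suc)
  have e2: "ig_poly d = [:0, 1:] * bessel_poly (d - 1)"
    using ig_poly_Suc[of "d - 1"] assms(1) by simp
  have "mono_val ig_poly a = ig_poly (d - 1) ^ lookup a (d - 1) * ig_poly d ^ lookup a d"
    using mono_val_superset[OF _ assms(2), of ig_poly] ne by simp
  then show "mono_val ig_poly a = [:0, 1:] ^ (lookup a (d - 1) + lookup a d)
      * bessel_poly (d - 2) ^ lookup a (d - 1) * bessel_poly (d - 1) ^ lookup a d"
    unfolding e1 e2 power_mult_distrib power_add by (simp only: ac_simps)
  show "wdegree a = (d - 1) * lookup a (d - 1) + d * lookup a d"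
    unfolding wdegree_eq_weight using weight_superset[OF _ assms(2), of "\<lambda>i. i"] ne by simp
  show "mdegree a = lookup a 0 + lookup a (d - 1) + lookup a d"
    unfolding mdegree_eq_weight using weight_superset[OF _ assms(2), of "\<lambda>_. 1"] ne by simp
qed

text \<open>The coefficient of t^D w^W: a relation in three variables is thereby cut into relations
  between polynomials in x alone.\<close>

lemma coeff_param_mult:
  assumes "finite S" "keys f \<subseteq> S"
  shows "coeff (coeff (param f * [:[:q:]:]) D) W
    = (\<Sum>a\<in>S. if mdegree a = D \<and> wdegree a = W then mono_val ig_poly a * smult (lookup f a) q else 0)"
proof -
  have "param f * [:[:q:]:] = (\<Sum>a\<in>S. monom (monom (mono_val ig_poly a * smult (lookup f a) q) (wdegree a)) (mdegree a))"
    unfolding param_def param.subst_superset[OF assms] mono_val_param_coord sum_distrib_right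
    by (intro sum.cong refl) (simp add: smult_monom ac_simps)
  then show ?thesis
    unfolding coeff_sum by (simp only: coeff_sum) (rule sum.cong[OF refl], auto)
qed

text \<open>In a fixed bidegree the exponents \<open>(b, c)\<close> of \<open>m\<^sub>d\<^sub>-\<^sub>1\<close> and \<open>m\<^sub>d\<close> differ by multiples of
  \<open>(- d, d - 1)\<close>, so all but the term with the least \<open>c\<close> acquire an extra factor \<open>N\<^sup>d\<^sup>-\<^sup>1\<close>, where
  \<open>N\<close> is the Bessel polynomial of degree \<open>d - 1\<close>. As \<open>N\<close> is coprime to \<open>x\<close> and to its predecessor,
  \<open>N\<^sup>d\<^sup>-\<^sup>1\<close> divides the polynomial of degree less than \<open>(d - 1)\<^sup>2\<close> formed by the coefficients of that
  term.\<close>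

lemma powers_independent_over_free_polys:
  fixes s :: "nat \<Rightarrow> cpoly"
  assumes d: "d \<ge> 3" and s: "\<And>i. i < (d - 1)\<^sup>2 \<Longrightarrow> s i \<in> free_polys d"
    and sum0: "(\<Sum>i<(d - 1)\<^sup>2. param (s i) * [:[:monom 1 i:]:]) = 0"
  shows "\<forall>i<(d - 1)\<^sup>2. s i = 0"
proof (rule ccontr)
  assume "\<not> (\<forall>i<(d - 1)\<^sup>2. s i = 0)"
  then obtain i0 where i0: "i0 < (d - 1)\<^sup>2" "s i0 \<noteq> 0" by blast
  define n where "n = d - 1"
  have n: "n \<ge> 1" "d = n + 1" using d by (auto simp: n_def)
  define A where "A = (\<Union>i<n\<^sup>2. keys (s i))"
  have finA: "finite A" by (simp add: A_def)
  have keysA: "keys a \<subseteq> {0, d - 1, d}" if "a \<in> A" for a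
    using that s unfolding A_def n_def free_polys_def by blast
  \<comment> \<open>\<open>P a\<close> collects the coefficients of the monomial \<open>a\<close> in
    all the \<open>s i\<close> into one polynomial in x; since \<open>i < n\<^sup>2\<close>, its
    degree is below \<open>n\<^sup>2\<close>.\<close>
  define P where "P = (\<lambda>a. \<Sum>i<n\<^sup>2. monom (lookup (s i) a) i)"
  have "keys (s i0) \<noteq> {}" using i0(2) by simp
  then obtain a0 where a0: "a0 \<in> keys (s i0)" by blast
  then have "a0 \<in> A" using i0(1) by (auto simp: A_def n_def)
  define S where "S = {a\<in>A. mdegree a = mdegree a0 \<and> wdegree a = wdegree a0}"
  have finS: "finite S" using finA by (simp add: S_def)
  have "a0 \<in> S" using \<open>a0 \<in> A\<close> by (simp add: S_def)
  have "coeff (coeff (\<Sum>i<n\<^sup>2. param (s i) * [:[:monom 1 i:]:]) (mdegree a0)) (wdegree a0)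
      = (\<Sum>i<n\<^sup>2. \<Sum>a\<in>A. if mdegree a = mdegree a0 \<and> wdegree a = wdegree a0
            then mono_val ig_poly a * monom (lookup (s i) a) i else 0)"
    unfolding coeff_sum
    by (intro sum.cong refl, subst coeff_param_mult[OF finA]) (auto simp: A_def smult_monom intro!: sum.cong)
  also have "\<dots> = (\<Sum>a\<in>A. \<Sum>i<n\<^sup>2. if mdegree a = mdegree a0 \<and> wdegree a = wdegree a0
            then mono_val ig_poly a * monom (lookup (s i) a) i else 0)"
    by (rule sum.swap)
  also have "\<dots> = (\<Sum>a\<in>A. if mdegree a = mdegree a0 \<and> wdegree a = wdegree a0 then mono_val ig_poly a * P a else 0)"
  proof (rule sum.cong[OF refl])
    fix a
    show "(\<Sum>i<n\<^sup>2. if mdegree a = mdegree a0 \<and> wdegree a = wdegree a0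
            then mono_val ig_poly a * monom (lookup (s i) a) i else 0)
        = (if mdegree a = mdegree a0 \<and> wdegree a = wdegree a0 then mono_val ig_poly a * P a else 0)"
      by (cases "mdegree a = mdegree a0 \<and> wdegree a = wdegree a0")
        (simp_all only: if_True if_False P_def sum_distrib_left sum.neutral_const simp_thms)
  qed
  also have "\<dots> = (\<Sum>a\<in>S. mono_val ig_poly a * P a)"
    unfolding S_def using finA by (simp add: sum.inter_filter)
  finally have rel: "(\<Sum>a\<in>S. mono_val ig_poly a * P a) = 0"
    using sum0 by (simp add: n_def)
  have "Min ((\<lambda>a. lookup a d) ` S) \<in> (\<lambda>a. lookup a d) ` S"
    using finS \<open>a0 \<in> S\<close> by (intro Min_in) auto
  then obtain a1 where a1: "a1 \<in> S" "Min ((\<lambda>a. lookup a d) ` S) = lookup a1 d" by auto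
  have min: "lookup a1 d \<le> lookup a d" if "a \<in> S" for a
    using finS that unfolding a1(2)[symmetric] by (intro Min_le) auto
  have SA: "a \<in> A" "mdegree a = mdegree a0" "wdegree a = wdegree a0" if "a \<in> S" for a
    using that by (auto simp: S_def)
  define N where "N = bessel_poly n"
  define M where "M = bessel_poly (d - 2)"
  define b1 c1 where "b1 = lookup a1 (d - 1)" and "c1 = lookup a1 d"
  have val: "mono_val ig_poly a = [:0, 1:] ^ (lookup a (d - 1) + lookup a d) * M ^ lookup a (d - 1) * N ^ lookup a d"
    if "a \<in> S" for a
    unfolding M_def N_def n_def by (rule mono_val_ig_poly_free(1)[OF d keysA[OF SA(1)[OF that]]])
  \<comment> \<open>If k is the excess of the exponent of m_d over that of \<open>a1\<close>,
    equality of the weighted degrees shows that n divides (n + 1) k, hence k. The value k = 0 would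
    make all three exponents agree, by equality of the degrees.\<close>
  have big: "c1 + n \<le> lookup a d" if a: "a \<in> S" "a \<noteq> a1" for a
  proof -
    note ka = keysA[OF SA(1)[OF a(1)]] and k1 = keysA[OF SA(1)[OF a1(1)]]
    have w: "n * lookup a n + (n + 1) * lookup a d = n * lookup a1 n + (n + 1) * lookup a1 d"
      using mono_val_ig_poly_free(2)[OF d ka] mono_val_ig_poly_free(2)[OF d k1] SA(3)[OF a(1)] SA(3)[OF a1(1)]
      by (simp add: n(2))
    have m: "lookup a 0 + lookup a n + lookup a d = lookup a1 0 + lookup a1 n + lookup a1 d"
      using mono_val_ig_poly_free(3)[OF d ka] mono_val_ig_poly_free(3)[OF d k1] SA(2)[OF a(1)] SA(2)[OF a1(1)]
      by (simp add: n(2))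
    obtain k where k: "lookup a d = lookup a1 d + k" using min[OF a(1)] le_Suc_ex by blast
    have eq: "n * lookup a n + (n + 1) * k = n * lookup a1 n"
      using w unfolding k by (simp add: distrib_left)
    then have "n dvd (n + 1) * k" by (metis dvd_add_right_iff dvd_triv_left)
    then have "n dvd k" by (metis coprime_Suc_right_nat coprime_dvd_mult_right_iff Suc_eq_plus1)
    moreover have "k \<noteq> 0"
    proof
      assume "k = 0"
      then have "lookup a d = lookup a1 d" "lookup a n = lookup a1 n" using k eq n(1) by auto
      then have "lookup a i = lookup a1 i" if "i \<in> {0, d - 1, d}" for i
        using that m n(2) by auto
      moreover have "lookup a i = lookup a1 i" if "i \<notin> {0, d - 1, d}" for i
      proof -
        have "i \<notin> keys a" "i \<notin> keys a1" using that ka k1 by blast+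
        then show ?thesis by (simp add: in_keys_iff)
      qed
      ultimately have "a = a1" by (intro poly_mapping_eqI) blast
      then show False using a(2) by simp
    qed
    ultimately have "n \<le> k" by (simp add: dvd_imp_le)
    then show ?thesis by (simp add: k c1_def)
  qed
  have "(\<Sum>a\<in>S. mono_val ig_poly a * P a)
      = mono_val ig_poly a1 * P a1 + (\<Sum>a\<in>S - {a1}. mono_val ig_poly a * P a)"
    using finS a1(1) by (simp add: sum.remove)
  then have "mono_val ig_poly a1 * P a1 = - (\<Sum>a\<in>S - {a1}. mono_val ig_poly a * P a)"
    using rel by (simp add: add_eq_0_iff)
  moreover have "N ^ (c1 + n) dvd (\<Sum>a\<in>S - {a1}. mono_val ig_poly a * P a)"
  proof (rule dvd_sum)
    fix a assume a: "a \<in> S - {a1}"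
    then have "N ^ (c1 + n) dvd N ^ lookup a d" using big[of a] by (intro le_imp_power_dvd) auto
    then show "N ^ (c1 + n) dvd mono_val ig_poly a * P a"
      using a val[of a] by (auto intro: dvd_mult dvd_mult2)
  qed
  ultimately have "N ^ (c1 + n) dvd mono_val ig_poly a1 * P a1" by simp
  also have "mono_val ig_poly a1 * P a1 = N ^ c1 * ([:0, 1:] ^ (b1 + c1) * (M ^ b1 * P a1))"
    unfolding val[OF a1(1)] b1_def c1_def by (simp only: ac_simps)
  finally have "N ^ c1 * N ^ n dvd N ^ c1 * ([:0, 1:] ^ (b1 + c1) * (M ^ b1 * P a1))"
    by (simp only: power_add)
  moreover have N0: "N ^ c1 \<noteq> 0" by (simp add: N_def)
  ultimately have "N ^ n dvd [:0, 1:] ^ (b1 + c1) * (M ^ b1 * P a1)"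
    by (simp only: dvd_mult_cancel_left) simp
  moreover have "coprime (N ^ n) ([:0, 1:] ^ (b1 + c1))"
    unfolding N_def using coprime_bessel_poly_X by (simp only: coprime_power_left_iff coprime_power_right_iff) simp
  moreover have "coprime (N ^ n) (M ^ b1)"
  proof -
    have "n = Suc (d - 2)" using d by (simp add: n_def)
    then have "coprime N M" unfolding N_def M_def using coprime_bessel_poly_Suc[of "d - 2"] by simp
    then show ?thesis by (simp only: coprime_power_left_iff coprime_power_right_iff) simp
  qed
  ultimately have dvd: "N ^ n dvd P a1" by (simp only: coprime_dvd_mult_right_iff)
  have "n\<^sup>2 \<ge> 1" using n(1) by simp
  have "degree (P a1) < n\<^sup>2"
  proof -
    have "degree (P a1) \<le> n\<^sup>2 - 1"
      unfolding P_def by (intro degree_sum_le) (auto intro: order_trans[OF degree_monom_le])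
    then show ?thesis using \<open>n\<^sup>2 \<ge> 1\<close> by linarith
  qed
  moreover have "degree (N ^ n) = n\<^sup>2" by (simp add: N_def degree_power_eq power2_eq_square)
  ultimately have P0: "P a1 = 0"
    using dvd dvd_imp_degree_le[of "N ^ n" "P a1"] by (cases "P a1 = 0") auto
  have "lookup (s i) a1 = 0" if "i < n\<^sup>2" for i
  proof -
    have "coeff (P a1) i = lookup (s i) a1"
      using that by (simp add: P_def coeff_sum)
    then show ?thesis by (simp add: P0)
  qed
  moreover have "a1 \<in> A" by (rule SA(1)[OF a1(1)])
  ultimately show False by (auto simp: A_def in_keys_iff)
qed

section \<open>The comparison elements\<close>

definition comparison_poly :: "nat \<Rightarrow> nat \<Rightarrow> cpoly" where
  "comparison_poly m i = (Var 1 ^ 2) ^ i * (Var 0 * Var 2 - Var 1 ^ 2) ^ (m - i)"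

text \<open>Since p_1^2 = x^2 and p_0 p_2 - p_1^2 = (x + x^2) - x^2 = x, the two building blocks go
  to t^2 w^2 x^2 and t^2 w^2 x. All images share the factor
  \<open>monom (monom (monom 1 m) (2 * m)) (2 * m)\<close> and differ by a power of x only.\<close>

lemma param_comparison_poly:
  assumes "i \<le> m"
  shows "param (comparison_poly m i) = monom (monom (monom 1 m) (2 * m)) (2 * m) * [:[:monom 1 i:]:]"
proof -
  have X: "[:0, 1:] = monom (1 :: complex) 1" by (simp add: monom_altdef)
  have p1: "param_coord 1 ^ 2 = monom (monom (monom 1 2) 2) 2"
    by (simp add: param_coord_def X monom_power mult_monom numeral_2_eq_2)
  have X2: "[:0, 0, 1:] = monom (1 :: complex) 2" by (simp add: monom_altdef power2_eq_square)
  have "ig_poly 2 = monom 1 1 + monom 1 2"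
    unfolding X2[symmetric] X[symmetric] by (simp add: numeral_2_eq_2)
  then have "param_coord 0 * param_coord 2 = monom (monom (monom 1 1 + monom 1 2) 2) 2"
    by (simp add: param_coord_def mult_monom one_pCons[symmetric] numeral_2_eq_2)
  then have p2: "param_coord 0 * param_coord 2 - param_coord 1 ^ 2 = monom (monom (monom 1 1) 2) 2"
    unfolding p1 by (simp add: diff_monom[symmetric] add_monom[symmetric])
  have "2 * i + (m - i) = m + i" "2 * i + 2 * (m - i) = 2 * m" using assms by auto
  then show ?thesis
    unfolding comparison_poly_def param_simps p1 p2[unfolded p1] monom_power mult_monom
    by (simp add: mult_monom smult_monom mult.commute)
qed

section \<open>Counting standard monomials\<close>

definition standard_base :: "nat \<Rightarrow> (nat \<Rightarrow>\<^sub>0 nat) set" where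
  "standard_base d = {a. keys a \<subseteq> {1..d-2} \<and> standard d a}"

lemma exp_eq_single_1:
  fixes a :: "nat \<Rightarrow>\<^sub>0 nat"
  assumes "keys a \<subseteq> {1..d-2}" "(\<Sum>i\<in>{2..d-2}. lookup a i) = 0"
  shows "a = exp_single 1 (lookup a 1)"
proof (rule poly_mapping_eqI)
  fix k
  show "lookup a k = lookup (exp_single 1 (lookup a 1)) k"
  proof (cases "k = 1")
    case False
    have "lookup a k = 0"
    proof (cases "k \<in> {2..d-2}")
      case True
      then show ?thesis using assms(2) by (simp add: sum_eq_0_iff)
    next
      case False
      then have "k \<notin> keys a" using assms(1) \<open>k \<noteq> 1\<close> by auto
      then show ?thesis by (simp add: in_keys_iff)
    qed
    then show ?thesis using False by (simp add: lookup_single_not_eq)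
  qed simp
qed

text \<open>The three sets hold the monomials with zero, one and two factors from m_2, ..., m_{d-2}.
  In the last, a single rectangle encodes an unordered pair together with an exponent of m_1: a pair
  with p < q stands for m_p m_{q-1} without m_1, and one with q <= p for m_q m_p m_1.\<close>

lemma standard_base_subset:
  "standard_base d \<subseteq> (\<lambda>k. exp_single 1 k) ` {..3}
    \<union> (\<lambda>(k, p). exp_single p 1 + exp_single 1 k) ` ({..2} \<times> {2..d-2})
    \<union> (\<lambda>(p, q). if p < q then exp_single p 1 + (exp_single (q - 1) 1 + exp_single 1 0)
          else exp_single q 1 + (exp_single p 1 + exp_single 1 1)) ` ({2..d-2} \<times> {2..d-1})"
    (is "_ \<subseteq> ?A \<union> ?B \<union> ?C")
proof
  fix a assume "a \<in> standard_base d"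
  then have ka: "keys a \<subseteq> {1..d-2}" and st: "standard d a" by (auto simp: standard_base_def)
  have f1: "lookup (exp_single p 1) 1 = (0 :: nat)" if "p \<in> {2..d-2}" for p
    using that by (auto simp: lookup_single when_def)
  consider "(\<Sum>i\<in>{2..d-2}. lookup a i) = 0" | "(\<Sum>i\<in>{2..d-2}. lookup a i) = Suc 0"
    | "(\<Sum>i\<in>{2..d-2}. lookup a i) = 2"
    using st unfolding standard_def by linarith
  then show "a \<in> ?A \<union> ?B \<union> ?C"
  proof cases
    case 1
    then have "lookup a 1 \<le> 3" using st unfolding standard_def by linarith
    then have "a \<in> ?A" using exp_eq_single_1[OF ka 1] by blast
    then show ?thesis by blast
  next
    case 2
    obtain p b where p: "p \<in> {2..d-2}" "a = exp_single p 1 + b" "(\<Sum>i\<in>{2..d-2}. lookup b i) = 0"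
      by (rule extract_variable[OF _ 2]) auto
    have kb: "keys b \<subseteq> {1..d-2}" using ka p(2) by simp
    have "lookup a 1 = lookup b 1" unfolding p(2) lookup_add f1[OF p(1)] by simp
    moreover have "lookup a 1 \<le> 2" using st 2 unfolding standard_def by linarith
    ultimately have "(lookup b 1, p) \<in> {..2} \<times> {2..d-2}" using p(1) by simp
    moreover have "a = (\<lambda>(k, p). exp_single p 1 + exp_single 1 k) (lookup b 1, p)"
      using p(2) exp_eq_single_1[OF kb p(3)] by simp
    ultimately have "a \<in> ?B" by blast
    then show ?thesis by blast
  next
    case 3
    then have "(\<Sum>i\<in>{2..d-2}. lookup a i) \<ge> 2" by simp
    then obtain p q b where p: "p \<in> {2..d-2}" "q \<in> {2..d-2}" "p \<le> q" "a = exp_single p 1 + exp_single q 1 + b"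
      by (rule extract_two[of "{2..d-2}" a, OF finite_atLeastAtMost])
    have kb: "keys b \<subseteq> {1..d-2}" using ka p(4) by simp
    have one: "(\<Sum>i\<in>{2..d-2}. lookup (exp_single p 1) i) = (1 :: nat)" if "p \<in> {2..d-2}" for p
      using that by (simp add: lookup_single when_def sum.delta')
    have "(\<Sum>i\<in>{2..d-2}. lookup b i) = 0"
      using 3 unfolding p(4) lookup_add sum.distrib one[OF p(1)] one[OF p(2)] by simp
    then have b: "b = exp_single 1 (lookup b 1)" by (rule exp_eq_single_1[OF kb])
    have "lookup a 1 = lookup b 1" unfolding p(4) lookup_add f1[OF p(1)] f1[OF p(2)] by simp
    moreover have "lookup a 1 \<le> 1" using st 3 unfolding standard_def by linarith
    ultimately consider "lookup b 1 = 0" | "lookup b 1 = 1" by linarith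
    then have "a \<in> ?C"
    proof cases
      case 1
      show ?thesis
        by (rule image_eqI[of _ _ "(p, q + 1)"]) (use p b 1 in \<open>auto simp: add.assoc\<close>)
    next
      case 2
      show ?thesis
        by (rule image_eqI[of _ _ "(q, p)"]) (use p b 2 in \<open>auto simp: add.assoc\<close>)
    qed
    then show ?thesis by blast
  qed
qed

lemma finite_standard_base: "finite (standard_base d)"
  by (rule finite_subset[OF standard_base_subset]) auto

text \<open>The three sets contribute at most 4, 3(d - 3) and (d - 3)(d - 2) monomials, and these
  numbers add up to (d - 1)^2.\<close>

lemma card_standard_base_le:
  assumes "d \<ge> 3"
  shows "card (standard_base d) \<le> (d - 1)\<^sup>2"
proof -
  let ?f = "\<lambda>k. exp_single 1 k"
  let ?g = "\<lambda>(k, p). exp_single p 1 + exp_single 1 k"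
  let ?h = "\<lambda>(p, q). if p < q then exp_single p 1 + (exp_single (q - 1) 1 + exp_single 1 0)
          else exp_single q 1 + (exp_single p 1 + exp_single 1 1)"
  let ?A = "?f ` {..3}" and ?B = "?g ` ({..2} \<times> {2..d-2})" and ?C = "?h ` ({2..d-2} \<times> {2..d-1})"
  have "card (standard_base d) \<le> card (?A \<union> ?B \<union> ?C)"
    by (rule card_mono[OF _ standard_base_subset]) auto
  also have "\<dots> \<le> card ?A + card ?B + card ?C"
    using card_Un_le[of "?A \<union> ?B" ?C] card_Un_le[of ?A ?B] by linarith
  also have "\<dots> \<le> card {..3::nat} + card ({..2::nat} \<times> {2..d-2}) + card ({2..d-2} \<times> {2..d-1})"
    by (intro add_mono card_image_le) auto
  also have "\<dots> = (d - 1)\<^sup>2"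
  proof -
    obtain k where "d = k + 3" using assms le_Suc_ex add.commute by metis
    then show ?thesis by (simp add: power2_eq_square algebra_simps)
  qed
  finally show ?thesis .
qed

section \<open>The kernel of the parametrization\<close>

definition base_part :: "nat \<Rightarrow> (nat \<Rightarrow>\<^sub>0 nat) \<Rightarrow> (nat \<Rightarrow>\<^sub>0 nat)" where
  "base_part d a = (\<Sum>i\<in>{1..d-2}. exp_single i (lookup a i))"

definition free_part :: "nat \<Rightarrow> (nat \<Rightarrow>\<^sub>0 nat) \<Rightarrow> (nat \<Rightarrow>\<^sub>0 nat)" where
  "free_part d a = (\<Sum>i\<in>{0, d-1, d}. exp_single i (lookup a i))"

lemma lookup_sum_exp_single:
  fixes f :: "nat \<Rightarrow> nat"
  assumes "finite S"
  shows "lookup (\<Sum>i\<in>S. exp_single i (f i)) k = (if k \<in> S then f k else 0)"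
  using assms by (simp add: lookup_sum lookup_single when_def sum.delta')

lemma keys_sum_exp_single: "finite S \<Longrightarrow> keys (\<Sum>i\<in>S. exp_single i (f i :: nat)) \<subseteq> S"
  by (auto simp: in_keys_iff lookup_sum_exp_single split: if_splits)

lemma free_part_plus_base_part:
  assumes "d \<ge> 3" "keys a \<subseteq> {..d}"
  shows "a = free_part d a + base_part d a"
proof (rule poly_mapping_eqI)
  fix k
  have "lookup a k = 0" if "k > d" using that assms(2) by (auto simp: in_keys_iff subset_iff)
  then show "lookup a k = lookup (free_part d a + base_part d a) k"
    unfolding lookup_add free_part_def base_part_def
    using assms(1) by (subst (1 2) lookup_sum_exp_single) auto
qed

lemma base_part_in_standard_base:
  assumes "standard d a" "d \<ge> 3"
  shows "base_part d a \<in> standard_base d"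
proof -
  have "lookup (base_part d a) i = lookup a i" if "i \<in> {1..d-2}" for i
    unfolding base_part_def using that by (subst lookup_sum_exp_single) auto
  then have "(\<Sum>i\<in>{2..d-2}. lookup (base_part d a) i) = (\<Sum>i\<in>{2..d-2}. lookup a i)"
    "lookup (base_part d a) 1 = lookup a 1"
    using assms(2) by (auto intro!: sum.cong)
  then show ?thesis
    using assms(1) keys_sum_exp_single[of "{1..d-2}"] unfolding standard_base_def standard_def base_part_def
    by simp
qed

text \<open>The coordinate of \<open>r\<close> in \<open>A\<close> at the standard monomial
  \<open>\<beta>\<close>.\<close>

definition coeff_part :: "nat \<Rightarrow> cpoly \<Rightarrow> (nat \<Rightarrow>\<^sub>0 nat) \<Rightarrow> cpoly" where
  "coeff_part d r \<beta> = (\<Sum>a\<in>{a\<in>keys r. base_part d a = \<beta>}. Poly_Mapping.single (free_part d a) (lookup r a))"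

lemma coeff_part_free: "coeff_part d r \<beta> \<in> free_polys d"
  unfolding coeff_part_def
proof (rule free_polys_sum)
  fix a
  show "Poly_Mapping.single (free_part d a) (lookup r a) \<in> free_polys d"
    unfolding free_polys_def using keys_sum_exp_single[of "{0, d-1, d}"] by (simp add: free_part_def)
qed

lemma reduced_eq_sum_coeff_part:
  assumes "d \<ge> 3" "reduced d r"
  shows "r = (\<Sum>\<beta>\<in>standard_base d. coeff_part d r \<beta> * monomial \<beta>)"
proof -
  have "(\<Sum>\<beta>\<in>standard_base d. coeff_part d r \<beta> * monomial \<beta>)
      = (\<Sum>\<beta>\<in>standard_base d. \<Sum>a\<in>{a\<in>keys r. base_part d a = \<beta>}. Poly_Mapping.single a (lookup r a))"
  proof (rule sum.cong[OF refl])
    fix \<beta>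
    show "coeff_part d r \<beta> * monomial \<beta>
        = (\<Sum>a\<in>{a\<in>keys r. base_part d a = \<beta>}. Poly_Mapping.single a (lookup r a))"
      unfolding coeff_part_def sum_distrib_right
    proof (rule sum.cong[OF refl])
      fix a assume a: "a \<in> {a\<in>keys r. base_part d a = \<beta>}"
      then have "keys a \<subseteq> {..d}" using assms(2) by (simp add: reduced_def polys_def)
      then have "a = free_part d a + \<beta>" using free_part_plus_base_part[OF assms(1), of a] a by simp
      then show "Poly_Mapping.single (free_part d a) (lookup r a) * monomial \<beta> = Poly_Mapping.single a (lookup r a)"
        by (simp add: mult_single)
    qed
  qed
  also have "\<dots> = (\<Sum>a\<in>keys r. Poly_Mapping.single a (lookup r a))"
    using assms base_part_in_standard_base
    by (intro sum.group finite_standard_base) (auto simp: reduced_def)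
  also have "\<dots> = r" by (rule cpoly_eq_sum_single[symmetric])
  finally show ?thesis ..
qed

text \<open>A relation would express \<open>(d - 1)\<^sup>2\<close> independent elements through fewer than \<open>(d - 1)\<^sup>2\<close>
  standard monomials.\<close>

lemma reduced_param_eq_0:
  assumes d: "d \<ge> 3" and r: "reduced d r" "param r = 0"
    and nf: "\<And>f. f \<in> polys d \<Longrightarrow> \<exists>r. reduced d r \<and> param f = param r"
  shows "r = 0"
proof (rule ccontr)
  assume "r \<noteq> 0"
  define n where "n = (d - 1)\<^sup>2"
  have "n \<ge> 1" using d by (simp add: n_def)
  let ?B = "standard_base d" and ?c = "coeff_part d"
  have "\<exists>\<beta>\<in>?B. ?c r \<beta> \<noteq> 0"
  proof (rule ccontr)
    assume "\<not> (\<exists>\<beta>\<in>?B. ?c r \<beta> \<noteq> 0)"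
    then have "r = 0" by (subst reduced_eq_sum_coeff_part[OF d r(1)]) simp
    then show False using \<open>r \<noteq> 0\<close> by simp
  qed
  then obtain \<beta>0 where \<beta>0: "\<beta>0 \<in> ?B" "?c r \<beta>0 \<noteq> 0" by blast
  define e where "e = comparison_poly (n - 1)"
  have "e i \<in> polys d" for i
    unfolding e_def comparison_poly_def using d by (intro polys_mult polys_power polys_diff polys_Var) auto
  then have "\<exists>r. reduced d r \<and> param (e i) = param r" for i by (rule nf)
  then obtain R where R: "\<And>i. reduced d (R i)" "\<And>i. param (e i) = param (R i)" by metis
  \<comment> \<open>Subtracting a multiple of the relation \<open>r\<close> removes the coordinate
    at \<open>\<beta>0\<close> from each \<open>R i\<close>, by cross-multiplication since
    \<open>A\<close> is not a field. At most n - 1 coordinates remain for n elements, which forces a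
    dependence over \<open>A\<close>.\<close>
  define M where "M = (\<lambda>\<beta> i. ?c r \<beta>0 * ?c (R i) \<beta> - ?c (R i) \<beta>0 * ?c r \<beta>)"
  have "card (?B - {\<beta>0}) < card {..<n}"
    using card_standard_base_le[OF d] \<beta>0(1) finite_standard_base[of d] \<open>n \<ge> 1\<close> unfolding n_def
    by simp
  then have "\<exists>s. (\<forall>i\<in>{..<n}. s i \<in> free_polys d) \<and> (\<exists>i\<in>{..<n}. s i \<noteq> 0)
      \<and> (\<forall>\<beta>\<in>?B - {\<beta>0}. (\<Sum>i\<in>{..<n}. M \<beta> i * s i) = 0)"
    using finite_standard_base[of d]
    by (intro homogeneous_system_nontrivial_solution)
      (auto simp: M_def intro!: free_polys_add free_polys_mult free_polys_uminus free_polys_diff coeff_part_free)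
  then obtain s where s: "\<forall>i\<in>{..<n}. s i \<in> free_polys d" "\<exists>i\<in>{..<n}. s i \<noteq> 0"
    "\<forall>\<beta>\<in>?B - {\<beta>0}. (\<Sum>i\<in>{..<n}. M \<beta> i * s i) = 0" by (elim exE conjE)
  have M0: "(\<Sum>i<n. M \<beta> i * s i) = 0" if "\<beta> \<in> ?B" for \<beta>
    using s(3) that by (cases "\<beta> = \<beta>0") (auto simp: M_def mult.commute)
  have "(\<Sum>i<n. s i * (?c r \<beta>0 * R i - ?c (R i) \<beta>0 * r)) = (\<Sum>i<n. \<Sum>\<beta>\<in>?B. M \<beta> i * s i * monomial \<beta>)"
  proof (rule sum.cong[OF refl])
    fix i
    have "?c r \<beta>0 * R i - ?c (R i) \<beta>0 * r = (\<Sum>\<beta>\<in>?B. M \<beta> i * monomial \<beta>)"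
      by (subst reduced_eq_sum_coeff_part[OF d R(1)[of i]], subst (2) reduced_eq_sum_coeff_part[OF d r(1)])
        (simp add: M_def sum_distrib_left sum_subtractf[symmetric] algebra_simps)
    then show "s i * (?c r \<beta>0 * R i - ?c (R i) \<beta>0 * r) = (\<Sum>\<beta>\<in>?B. M \<beta> i * s i * monomial \<beta>)"
      by (simp add: sum_distrib_left ac_simps)
  qed
  also have "\<dots> = (\<Sum>\<beta>\<in>?B. \<Sum>i<n. M \<beta> i * s i * monomial \<beta>)" by (rule sum.swap)
  also have "\<dots> = 0"
    by (rule sum.neutral) (simp add: sum_distrib_right[symmetric] M0)
  finally have "param (\<Sum>i<n. s i * (?c r \<beta>0 * R i - ?c (R i) \<beta>0 * r)) = 0" by simp
  then have rel: "(\<Sum>i<n. param (s i * ?c r \<beta>0) * param (e i)) = 0"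
    using r(2) R(2) by (simp add: ac_simps)
  \<comment> \<open>The common monomial factor of the images of the comparison elements; it is
    nonzero and cancels in the domain.\<close>
  define K :: tpoly where "K = monom (monom (monom 1 (n - 1)) (2 * (n - 1))) (2 * (n - 1))"
  have pe: "param (e i) = K * [:[:monom 1 i:]:]" if "i < n" for i
    unfolding e_def K_def using that by (intro param_comparison_poly) simp
  have "K * (\<Sum>i<n. param (s i * ?c r \<beta>0) * [:[:monom 1 i:]:])
      = (\<Sum>i<n. param (s i * ?c r \<beta>0) * param (e i))"
    unfolding sum_distrib_left
  proof (rule sum.cong[OF refl])
    fix i assume "i \<in> {..<n}"
    then have "i < n" by simp
    show "K * (param (s i * ?c r \<beta>0) * [:[:monom 1 i:]:]) = param (s i * ?c r \<beta>0) * param (e i)"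
      unfolding pe[OF \<open>i < n\<close>] by (simp only: ac_simps)
  qed
  then have "K * (\<Sum>i<n. param (s i * ?c r \<beta>0) * [:[:monom 1 i:]:]) = 0" using rel by simp
  moreover have "K \<noteq> 0" by (simp add: K_def)
  ultimately have sum0: "(\<Sum>i<n. param (s i * ?c r \<beta>0) * [:[:monom 1 i:]:]) = 0"
    by (simp only: mult_eq_0_iff) simp
  have "\<forall>i<(d - 1)\<^sup>2. s i * ?c r \<beta>0 = 0"
  proof (rule powers_independent_over_free_polys[OF d])
    show "s i * ?c r \<beta>0 \<in> free_polys d" if "i < (d - 1)\<^sup>2" for i
      using that s(1) by (intro free_polys_mult coeff_part_free) (simp add: n_def)
    show "(\<Sum>i<(d - 1)\<^sup>2. param (s i * ?c r \<beta>0) * [:[:monom 1 i:]:]) = 0"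
      using sum0 by (simp only: n_def)
  qed
  then show False using s(2) \<beta>0(2) by (auto simp: n_def)
qed

section \<open>Algebraic dependence of four elements\<close>

definition degrees_le :: "nat \<Rightarrow> tpoly \<Rightarrow> bool" where
  "degrees_le K F \<longleftrightarrow> (\<forall>i j k. coeff (coeff (coeff F i) j) k \<noteq> 0 \<longrightarrow> i \<le> K \<and> j \<le> K \<and> k \<le> K)"

lemma degrees_le_mult:
  assumes "degrees_le K F" "degrees_le L G"
  shows "degrees_le (K + L) (F * G)"
  unfolding degrees_le_def
proof (intro allI impI)
  fix i j k
  assume "coeff (coeff (coeff (F * G) i) j) k \<noteq> 0"
  then have "(\<Sum>i'\<le>i. \<Sum>j'\<le>j. \<Sum>k'\<le>k. coeff (coeff (coeff F i') j') k'
      * coeff (coeff (coeff G (i - i')) (j - j')) (k - k')) \<noteq> 0"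
    by (simp only: coeff_mult coeff_sum) simp
  then obtain i' where i': "i' \<le> i" "(\<Sum>j'\<le>j. \<Sum>k'\<le>k. coeff (coeff (coeff F i') j') k'
      * coeff (coeff (coeff G (i - i')) (j - j')) (k - k')) \<noteq> 0"
    by (rule sum.not_neutral_contains_not_neutral) (simp only: atMost_iff)
  from i'(2) obtain j' where j': "j' \<le> j" "(\<Sum>k'\<le>k. coeff (coeff (coeff F i') j') k'
      * coeff (coeff (coeff G (i - i')) (j - j')) (k - k')) \<noteq> 0"
    by (rule sum.not_neutral_contains_not_neutral) (simp only: atMost_iff)
  from j'(2) obtain k' where k': "k' \<le> k" "coeff (coeff (coeff F i') j') k'
      * coeff (coeff (coeff G (i - i')) (j - j')) (k - k') \<noteq> 0"
    by (rule sum.not_neutral_contains_not_neutral) (simp only: atMost_iff)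
  from k'(2) have "coeff (coeff (coeff F i') j') k' \<noteq> 0" "coeff (coeff (coeff G (i - i')) (j - j')) (k - k') \<noteq> 0"
    by auto
  then have "i' \<le> K \<and> j' \<le> K \<and> k' \<le> K" "i - i' \<le> L \<and> j - j' \<le> L \<and> k - k' \<le> L"
    using assms unfolding degrees_le_def by blast+
  then show "i \<le> K + L \<and> j \<le> K + L \<and> k \<le> K + L" by linarith
qed

lemma degrees_le_1: "degrees_le 0 1"
  unfolding degrees_le_def by (auto simp: coeff_1 split: if_splits)

lemma degrees_le_power: "degrees_le K F \<Longrightarrow> degrees_le (m * K) (F ^ m)"
proof (induction m)
  case (Suc m)
  then show ?case using degrees_le_mult[of K F "m * K" "F ^ m"] by simp
qed (simp add: degrees_le_1)

lemma degrees_le_mono: "degrees_le K F \<Longrightarrow> K \<le> L \<Longrightarrow> degrees_le L F"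
  unfolding degrees_le_def by (meson order_trans)

lemma degrees_le_prod:
  assumes "finite A" "\<And>i. i \<in> A \<Longrightarrow> degrees_le K (F i)"
  shows "degrees_le (card A * K) (\<Prod>i\<in>A. F i)"
  using assms
proof (induction A)
  case (insert i A)
  have "degrees_le (K + card A * K) (F i * (\<Prod>i\<in>A. F i))"
    using insert by (intro degrees_le_mult) auto
  then show ?case using insert.hyps by simp
qed (simp add: degrees_le_1)

lemma ex_degrees_le: "\<exists>K. degrees_le K F"
proof -
  define d2 where "d2 = (\<lambda>i. \<Sum>j\<le>degree (coeff F i). degree (coeff (coeff F i) j))"
  define K where "K = degree F + (\<Sum>i\<le>degree F. degree (coeff F i) + d2 i)"
  have "degrees_le K F"
    unfolding degrees_le_def
  proof (intro allI impI)
    fix i j k assume k: "coeff (coeff (coeff F i) j) k \<noteq> 0"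
    then have "coeff (coeff F i) j \<noteq> 0" "coeff F i \<noteq> 0" by auto
    then have i: "i \<le> degree F" and j: "j \<le> degree (coeff F i)" by (auto intro: le_degree)
    have kk: "k \<le> degree (coeff (coeff F i) j)" using k by (rule le_degree)
    have "degree (coeff (coeff F i) j) \<le> d2 i"
      unfolding d2_def using j by (intro member_le_sum) auto
    moreover have "degree (coeff F i) + d2 i \<le> (\<Sum>i\<le>degree F. degree (coeff F i) + d2 i)"
      using i by (intro member_le_sum) auto
    ultimately show "i \<le> K \<and> j \<le> K \<and> k \<le> K" using i j kk by (simp add: K_def)
  qed
  then show ?thesis ..
qed

text \<open>There are \<open>(N + 1)\<^sup>4\<close> monomials of degree at most \<open>N\<close> in each of the four elements, but only
  \<open>O(N\<^sup>3)\<close> coefficients in a polynomial in three variables.\<close>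

lemma four_tpolys_dependent:
  fixes g :: "nat \<Rightarrow> tpoly"
  shows "\<exists>E c. finite E \<and> E \<noteq> {} \<and> (\<forall>e\<in>E. c e \<noteq> 0) \<and>
    (\<forall>e\<in>E. \<forall>e'\<in>E. (\<forall>i<4. e i = e' i) \<longrightarrow> e = e') \<and>
    (\<Sum>e\<in>E. tconst (c e) * (\<Prod>i<4. g i ^ e i)) = 0"
proof -
  have "\<forall>i. \<exists>K. degrees_le K (g i)" using ex_degrees_le by blast
  then obtain K0 where K0: "\<And>i. degrees_le (K0 i) (g i)" by metis
  define K where "K = (\<Sum>i<4::nat. K0 i)"
  have K: "degrees_le K (g i)" if "i < 4" for i
    by (rule degrees_le_mono[OF K0]) (use that in \<open>auto simp: K_def intro: member_le_sum\<close>)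
  \<comment> \<open>The constant is chosen for the count: L + 1 <= (4K + 1)(N + 1), so the cube of L
    + 1 is at most N (N + 1)^3, which is less than (N + 1)^4.\<close>
  define N where "N = (4 * K + 1) ^ 3"
  define L where "L = 4 * (N * K)"
  define U where "U = {..<4::nat} \<rightarrow>\<^sub>E {..N}"
  define S where "S = {..L} \<times> {..L} \<times> {..L}"
  define G where "G = (\<lambda>e :: nat \<Rightarrow> nat. \<Prod>i<4. g i ^ e i)"
  have finU: "finite U" by (simp add: U_def finite_PiE)
  have G: "degrees_le L (G e)" if "e \<in> U" for e
  proof -
    have "degrees_le (card {..<4::nat} * (N * K)) (G e)"
      unfolding G_def
    proof (rule degrees_le_prod)
      fix i :: nat assume "i \<in> {..<4}"
      then have "e i \<le> N" using that by (auto simp: U_def PiE_def)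
      then show "degrees_le (N * K) (g i ^ e i)"
        using degrees_le_power[OF K, of i "e i"] \<open>i \<in> {..<4}\<close>
        by (auto elim!: degrees_le_mono)
    qed simp
    then show ?thesis by (simp add: L_def)
  qed
  have "card S < card U"
  proof -
    have "L + 1 \<le> (4 * K + 1) * (N + 1)" by (simp add: L_def algebra_simps)
    then have "(L + 1) ^ 3 \<le> ((4 * K + 1) * (N + 1)) ^ 3" by (rule power_mono) simp
    also have "\<dots> = N * (N + 1) ^ 3" by (simp only: power_mult_distrib N_def)
    also have "\<dots> < (N + 1) * (N + 1) ^ 3" by simp
    finally have "(L + 1) ^ 3 < (N + 1) ^ 4" by (simp only: power_Suc[symmetric]) simp
    moreover have "card U = (N + 1) ^ 4" by (simp add: U_def card_PiE)
    moreover have "card S = (L + 1) ^ 3" by (simp add: S_def power3_eq_cube)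
    ultimately show ?thesis by simp
  qed
  moreover have "finite S" by (simp add: S_def)
  ultimately obtain s where s: "\<exists>e\<in>U. s e \<noteq> 0"
    "\<forall>x\<in>S. (\<Sum>e\<in>U. coeff (coeff (coeff (G e) (fst x)) (fst (snd x))) (snd (snd x)) * s e) = 0"
    using homogeneous_system_nontrivial_solution_UNIV[of S U
        "\<lambda>x e. coeff (coeff (coeff (G e) (fst x)) (fst (snd x))) (snd (snd x))"] finU by auto
  have "(\<Sum>e\<in>U. tconst (s e) * G e) = 0"
  proof (intro poly_eqI)
    fix i j k
    have co: "coeff (coeff (coeff (\<Sum>e\<in>U. tconst (s e) * G e) i) j) k
        = (\<Sum>e\<in>U. coeff (coeff (coeff (G e) i) j) k * s e)"
      by (simp add: coeff_sum mult.commute)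
    have "(\<Sum>e\<in>U. coeff (coeff (coeff (G e) i) j) k * s e) = 0"
    proof (cases "i \<le> L \<and> j \<le> L \<and> k \<le> L")
      case True
      then show ?thesis using bspec[OF s(2), of "(i, j, k)"] by (simp add: S_def)
    next
      case False
      then have "coeff (coeff (coeff (G e) i) j) k = 0" if "e \<in> U" for e
        using G[OF that] unfolding degrees_le_def by blast
      then show ?thesis by simp
    qed
    then show "coeff (coeff (coeff (\<Sum>e\<in>U. tconst (s e) * G e) i) j) k = coeff (coeff (coeff 0 i) j) k"
      unfolding co by simp
  qed
  moreover have "(\<Sum>e\<in>U. tconst (s e) * G e) = (\<Sum>e\<in>{e\<in>U. s e \<noteq> 0}. tconst (s e) * G e)"
    using finU by (intro sum.mono_neutral_right) auto
  ultimately have "(\<Sum>e\<in>{e\<in>U. s e \<noteq> 0}. tconst (s e) * G e) = 0" by simp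
  moreover have "e = e'" if "e \<in> U" "e' \<in> U" "\<forall>i<4. e i = e' i" for e e'
    using that unfolding U_def by (intro PiE_ext[of e _ _ e']) auto
  ultimately show ?thesis
    using s(1) finU by (intro exI[of _ "{e\<in>U. s e \<noteq> 0}"] exI[of _ s]) (auto simp: G_def)
qed

section \<open>Chains of primes\<close>

lemma primeideal_polysD:
  assumes "primeideal P (poly_ring d)"
  shows "ideal P (poly_ring d)" "1 \<notin> P"
    "f \<in> polys d \<Longrightarrow> g \<in> polys d \<Longrightarrow> f * g \<in> P \<Longrightarrow> f \<in> P \<or> g \<in> P"
    "f \<in> polys d \<Longrightarrow> f ^ k \<in> P \<Longrightarrow> f \<in> P"
proof -
  interpret primeideal P "poly_ring d" by fact
  show "ideal P (poly_ring d)" by (rule is_ideal)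
  show one: "1 \<notin> P" using I_notcarr one_imp_carrier by auto
  show pr: "f \<in> P \<or> g \<in> P" if "f \<in> polys d" "g \<in> polys d" "f * g \<in> P" for f g
    using I_prime[of f g] that by simp
  show "f \<in> P" if "f \<in> polys d" "f ^ k \<in> P" for f k
    using that(2)
  proof (induction k)
    case (Suc k)
    then show ?case using pr[OF that(1) polys_power[OF that(1), of k]] by auto
  qed (use one in simp)
qed

text \<open>The criterion of Coquand and Lombardi: along a chain of \<open>n + 1\<close> primes, elements separating
  the consecutive primes satisfy no polynomial relation modulo the first prime, as one sees by
  looking at the lexicographically least monomial of a relation.\<close>

lemma chain_elements_independent:
  assumes "\<And>i. i \<le> n \<Longrightarrow> primeideal (P i) (poly_ring d)" "\<And>i. i < n \<Longrightarrow> P i \<subseteq> P (Suc i)"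
    "\<And>i. i < n \<Longrightarrow> f i \<in> P (Suc i) - P i"
    "finite E" "E \<noteq> {}" "\<And>e. e \<in> E \<Longrightarrow> c e \<noteq> 0"
    "\<And>e e'. e \<in> E \<Longrightarrow> e' \<in> E \<Longrightarrow> (\<forall>i<n. x e i = x e' i) \<Longrightarrow> e = e'"
  shows "(\<Sum>e\<in>E. Const (c e) * (\<Prod>i<n. f i ^ x e i)) \<notin> P 0"
  using assms
proof (induction n arbitrary: P f E x)
  case 0
  then obtain e where "E = {e}" by blast
  show ?case
  proof
    assume "(\<Sum>e\<in>E. Const (c e) * (\<Prod>i<0. f i ^ x e i)) \<in> P 0"
    then have "Const (c e) \<in> P 0" by (simp add: \<open>E = {e}\<close>)
    have "primeideal (P 0) (poly_ring d)" using 0(1) by simp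
    note P = primeideal_polysD[OF this]
    have "Const (1 / c e) * Const (c e) \<in> P 0"
      by (rule ideal_polysD(4)[OF P(1) \<open>Const (c e) \<in> P 0\<close> polys_Const])
    moreover have "c e \<noteq> 0" using 0(6) \<open>E = {e}\<close> by simp
    ultimately show False using P(2) by (simp add: mult_single)
  qed
next
  case (Suc n)
  have pr0: "primeideal (P 0) (poly_ring d)" and pr1: "primeideal (P 1) (poly_ring d)"
    using Suc.prems(1) by auto
  note P0 = primeideal_polysD[OF pr0] and P1 = primeideal_polysD[OF pr1]
  have fp: "f i \<in> polys d" if "i < Suc n" for i
    using Suc.prems(3)[OF that] ideal_polysD(2)[OF primeideal_polysD(1)[OF Suc.prems(1)[of "Suc i"]]] that by auto
  \<comment> \<open>The least exponent of \<open>f 0\<close>. The power \<open>f 0 ^ m\<close> can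
    be split off because \<open>f 0\<close> lies outside the prime \<open>P 0\<close>; modulo
    \<open>P 1\<close>, which contains \<open>f 0\<close>, only the terms with exponent exactly
    \<open>m\<close> survive in the cofactor \<open>q\<close>.\<close>
  define m where "m = Min ((\<lambda>e. x e 0) ` E)"
  have m: "m \<le> x e 0" if "e \<in> E" for e
    using Suc.prems(4) that by (simp add: m_def)
  have "m \<in> (\<lambda>e. x e 0) ` E" unfolding m_def using Suc.prems(4,5) by (intro Min_in) auto
  define E0 where "E0 = {e\<in>E. x e 0 = m}"
  have E0: "E0 \<noteq> {}" "finite E0" using \<open>m \<in> (\<lambda>e. x e 0) ` E\<close> Suc.prems(4) by (auto simp: E0_def)
  define t where "t = (\<lambda>e. Const (c e) * (\<Prod>i<n. f (Suc i) ^ x e (Suc i)))"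
  have t: "t e \<in> polys d" for e unfolding t_def using fp by (intro polys_mult polys_prod polys_power) auto
  define q where "q = (\<Sum>e\<in>E. f 0 ^ (x e 0 - m) * t e)"
  have q: "q \<in> polys d" unfolding q_def using t fp[of 0] by (intro polys_sum polys_mult polys_power) auto
  have f0: "f 0 \<in> polys d" "f 0 \<notin> P 0" "f 0 \<in> P 1" using fp[of 0] Suc.prems(3)[of 0] by auto
  have "(\<Sum>e\<in>E. Const (c e) * (\<Prod>i<Suc n. f i ^ x e i)) = f 0 ^ m * q"
    unfolding q_def sum_distrib_left
  proof (rule sum.cong[OF refl])
    fix e assume "e \<in> E"
    then have "f 0 ^ x e 0 = f 0 ^ m * f 0 ^ (x e 0 - m)"
      using m by (simp add: power_add[symmetric])
    then show "Const (c e) * (\<Prod>i<Suc n. f i ^ x e i) = f 0 ^ m * (f 0 ^ (x e 0 - m) * t e)"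
      unfolding t_def prod.lessThan_Suc_shift by (simp add: ac_simps)
  qed
  moreover have "q \<notin> P 0"
  proof
    assume "q \<in> P 0"
    then have "q \<in> P 1" using Suc.prems(2)[of 0] by auto
    have split: "q = (\<Sum>e\<in>E0. t e) + (\<Sum>e\<in>E - E0. f 0 ^ (x e 0 - m) * t e)"
      unfolding q_def using Suc.prems(4)
      by (subst sum.subset_diff[of E0 E]) (auto simp: E0_def add.commute)
    have "(\<Sum>e\<in>E - E0. f 0 ^ (x e 0 - m) * t e) \<in> P 1"
    proof (rule ideal_polys_sum[OF P1(1)])
      fix e assume e: "e \<in> E - E0"
      then obtain j where "x e 0 - m = Suc j" using m[of e] by (auto simp: E0_def le_less dest: less_imp_Suc_add)
      then have eq: "f 0 ^ (x e 0 - m) * t e = f 0 * (f 0 ^ j * t e)" by (simp add: ac_simps)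
      have "f 0 ^ j * t e \<in> polys d" by (intro polys_mult polys_power f0(1) t)
      then show "f 0 ^ (x e 0 - m) * t e \<in> P 1" unfolding eq by (rule ideal_polysD(5)[OF P1(1) f0(3)])
    qed
    from ideal_polysD(7)[OF P1(1) \<open>q \<in> P 1\<close> this] have "(\<Sum>e\<in>E0. t e) \<in> P 1"
      by (simp add: split)
    moreover have "(\<Sum>e\<in>E0. Const (c e) * (\<Prod>i<n. f (Suc i) ^ x e (Suc i))) \<notin> P (Suc 0)"
    proof (rule Suc.IH[of "\<lambda>i. P (Suc i)" "\<lambda>i. f (Suc i)" E0 "\<lambda>e i. x e (Suc i)"])
      fix e e' assume e: "e \<in> E0" "e' \<in> E0" "\<forall>i<n. x e (Suc i) = x e' (Suc i)"
      then have "\<forall>i<Suc n. x e i = x e' i" by (auto simp: E0_def less_Suc_eq_0_disj)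
      then show "e = e'" using Suc.prems(7) e by (simp add: E0_def)
    qed (use Suc.prems E0 in \<open>auto simp: E0_def\<close>)
    ultimately show False by (simp add: t_def)
  qed
  ultimately show ?case
    using P0(3)[OF polys_power[OF f0(1)] q, of m] P0(4)[OF f0(1), of m] f0(2) by auto
qed

text \<open>A relation between the images under \<open>param\<close> is a relation between the
  elements themselves modulo the kernel, hence modulo \<open>P 0\<close>, which contradicts their
  independence along the chain.\<close>

lemma no_long_prime_chain:
  assumes "\<And>i. i \<le> 4 \<Longrightarrow> primeideal (P i) (poly_ring d)" "\<And>i. i < 4 \<Longrightarrow> P i \<subset> P (Suc i)"
    and ker: "{f \<in> polys d. param f = 0} \<subseteq> P 0"
  shows False
proof -
  have "\<exists>f. f \<in> P (Suc i) - P i" if "i < 4" for i using assms(2)[OF that] by blast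
  then obtain f where f: "\<And>i. i < 4 \<Longrightarrow> f i \<in> P (Suc i) - P i" by metis
  have fp: "f i \<in> polys d" if "i < 4" for i
    using f[OF that] ideal_polysD(2)[OF primeideal_polysD(1)[OF assms(1)[of "Suc i"]]] that by auto
  obtain E and c :: "(nat \<Rightarrow> nat) \<Rightarrow> complex" where E: "finite E" "E \<noteq> {}" "\<forall>e\<in>E. c e \<noteq> 0"
    "\<forall>e\<in>E. \<forall>e'\<in>E. (\<forall>i<4. e i = e' i) \<longrightarrow> e = e'"
    "(\<Sum>e\<in>E. tconst (c e) * (\<Prod>i<4. param (f i) ^ e i)) = 0"
    using four_tpolys_dependent[of "\<lambda>i. param (f i)"] by (elim exE conjE)
  define F where "F = (\<Sum>e\<in>E. Const (c e) * (\<Prod>i<4. f i ^ e i))"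
  have "param (\<Prod>i\<in>A. f i ^ e i) = (\<Prod>i\<in>A. param (f i) ^ e i)" for A and e :: "nat \<Rightarrow> nat"
    by (induction A rule: infinite_finite_induct) simp_all
  then have "param F = (\<Sum>e\<in>E. tconst (c e) * (\<Prod>i<4. param (f i) ^ e i))"
    by (simp add: F_def)
  moreover have "F \<in> polys d"
    unfolding F_def using fp by (intro polys_sum polys_mult polys_prod polys_power polys_Const) auto
  ultimately have "F \<in> P 0" using E(5) ker by auto
  moreover have "F \<notin> P 0"
    unfolding F_def
  proof (rule chain_elements_independent[where n = 4 and x = "\<lambda>e. e"])
    show "P i \<subseteq> P (Suc i)" if "i < 4" for i using assms(2)[OF that] by blast
    show "e = e'" if "e \<in> E" "e' \<in> E" "\<forall>i<4. e i = e' i" for e e'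
      using bspec[OF bspec[OF E(4) that(1)] that(2)] that(3) by simp
  qed (use assms(1) f E(1-3) in auto)
  ultimately show False by simp
qed

section \<open>Hilbert's Nullstellensatz\<close>

definition const_poly_eval :: "complex poly \<Rightarrow> cpoly \<Rightarrow> cpoly" where
  "const_poly_eval q y = poly (map_poly Const q) y"

lemma const_poly_eval_pCons [simp]: "const_poly_eval (pCons a q) y = Const a + y * const_poly_eval q y"
  by (simp add: const_poly_eval_def map_poly_pCons)

lemma const_poly_eval_0 [simp]: "const_poly_eval 0 y = 0"
  by (simp add: const_poly_eval_def)

lemma const_poly_eval_add: "const_poly_eval (p + q) y = const_poly_eval p y + const_poly_eval q y"
  by (induction p q rule: poly_induct2) (simp_all add: single_add algebra_simps)

lemma const_poly_eval_smult: "const_poly_eval (smult c p) y = Const c * const_poly_eval p y"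
  by (induction p) (simp_all add: mult_single algebra_simps)

lemma const_poly_eval_mult: "const_poly_eval (p * q) y = const_poly_eval p y * const_poly_eval q y"
  by (induction p) (simp_all add: const_poly_eval_add const_poly_eval_smult algebra_simps)

lemma const_poly_eval_sum: "const_poly_eval (\<Sum>i\<in>A. f i) y = (\<Sum>i\<in>A. const_poly_eval (f i) y)"
  by (induction A rule: infinite_finite_induct) (simp_all add: const_poly_eval_add)

lemma const_poly_eval_prod:
  "const_poly_eval (\<Prod>i\<in>A. [:- a i, 1:]) y = (\<Prod>i\<in>A. y - Const (a i))"
proof -
  have "const_poly_eval 1 y = 1" by (simp add: one_pCons)
  moreover have "const_poly_eval [:- b, 1:] y = y - Const b" for b by (simp add: single_uminus)
  ultimately show ?thesis
    by (induction A rule: infinite_finite_induct)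
      (simp_all del: mult_pCons_left const_poly_eval_pCons add: const_poly_eval_mult)
qed

lemma const_poly_eval_polys: "y \<in> polys d \<Longrightarrow> const_poly_eval q y \<in> polys d"
  by (induction q) simp_all

text \<open>Over the complex numbers \<open>q\<close> splits into linear factors. The values
  \<open>y - Const z\<close> of these factors lie outside the prime, and so does their
  product.\<close>

lemma const_poly_eval_not_in_prime:
  assumes P: "primeideal P (poly_ring d)" and y: "y \<in> polys d" "\<And>a. y - Const a \<notin> P"
  shows "q \<noteq> 0 \<Longrightarrow> const_poly_eval q y \<notin> P"
proof (induction "degree q" arbitrary: q)
  case 0
  then obtain c where c: "q = [:c:]" by (metis degree_eq_zeroE)
  then have "c \<noteq> 0" using 0 by auto
  show ?case
  proof
    assume "const_poly_eval q y \<in> P"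
    then have "Const c \<in> P" by (simp add: c)
    from ideal_polysD(4)[OF primeideal_polysD(1)[OF P] this polys_Const, of "1 / c"]
    show False using primeideal_polysD(2)[OF P] \<open>c \<noteq> 0\<close> by (simp add: mult_single)
  qed
next
  case (Suc n)
  then have "\<not> constant (poly q)" by (simp add: constant_degree)
  then obtain z where "poly q z = 0" using fundamental_theorem_of_algebra by blast
  then obtain r where r: "q = [:- z, 1:] * r" by (auto simp: poly_eq_0_iff_dvd elim: dvdE)
  have "r \<noteq> 0" using Suc.prems r by auto
  then have "degree r = n" using Suc.hyps(2) unfolding r by (subst (asm) degree_mult_eq) auto
  then have "const_poly_eval r y \<notin> P" using Suc.hyps(1) \<open>r \<noteq> 0\<close> by blast
  moreover have "const_poly_eval q y = (y - Const z) * const_poly_eval r y"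
    unfolding r const_poly_eval_mult by (simp add: single_uminus)
  ultimately show ?case
    using primeideal_polysD(3)[OF P, of "y - Const z" "const_poly_eval r y"] y const_poly_eval_polys[OF y(1)]
    by auto
qed

lemma finite_bounded_exponents: "finite {a :: nat \<Rightarrow>\<^sub>0 nat. keys a \<subseteq> {..d} \<and> mdegree a \<le> N}"
proof (rule finite_subset)
  show "{a :: nat \<Rightarrow>\<^sub>0 nat. keys a \<subseteq> {..d} \<and> mdegree a \<le> N}
      \<subseteq> (\<lambda>f. \<Sum>i\<le>d. exp_single i (f i)) ` ({..d} \<rightarrow>\<^sub>E {..N})"
  proof
    fix a :: "nat \<Rightarrow>\<^sub>0 nat" assume a: "a \<in> {a. keys a \<subseteq> {..d} \<and> mdegree a \<le> N}"
    define f where "f = restrict (lookup a) {..d}"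
    have "lookup a i \<le> N" for i
    proof (cases "i \<in> keys a")
      case True
      then have "lookup a i \<le> mdegree a" unfolding mdegree_def by (intro member_le_sum) auto
      then show ?thesis using a by simp
    qed (simp add: in_keys_iff)
    then have "f \<in> {..d} \<rightarrow>\<^sub>E {..N}" by (auto simp: f_def)
    moreover have "a = (\<Sum>i\<le>d. exp_single i (f i))"
    proof (rule poly_mapping_eqI)
      fix k
      have "lookup (\<Sum>i\<le>d. exp_single i (f i)) k = (if k \<le> d then lookup a k else 0)"
        by (simp add: lookup_sum lookup_single when_def sum.delta' f_def)
      moreover have "lookup a k = 0" if "\<not> k \<le> d" using a that by (auto simp: in_keys_iff subset_iff)
      ultimately show "lookup a k = lookup (\<Sum>i\<le>d. exp_single i (f i)) k" by simp
    qed
    ultimately show "a \<in> (\<lambda>f. \<Sum>i\<le>d. exp_single i (f i)) ` ({..d} \<rightarrow>\<^sub>E {..N})"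
      by (intro image_eqI[of _ _ f])
  qed
qed (simp add: finite_PiE)

text \<open>If \<open>y\<close> were transcendental modulo the maximal ideal \<open>P\<close>, the uncountably many inverses of
  \<open>y - a\<close> would be linearly independent, whereas \<open>poly_ring d\<close> has countable dimension.\<close>

lemma nullstellensatz:
  assumes P: "primeideal P (poly_ring d)"
    and inv: "\<And>g. g \<in> polys d \<Longrightarrow> g \<notin> P \<Longrightarrow> \<exists>u\<in>polys d. g * u - 1 \<in> P"
    and y: "y \<in> polys d"
  shows "\<exists>a. y - Const a \<in> P"
proof (rule ccontr)
  assume "\<nexists>a. y - Const a \<in> P"
  then have ya: "y - Const a \<notin> P" for a by blast
  note iP = primeideal_polysD(1)[OF P]
  have "\<exists>u. u \<in> polys d \<and> (y - Const a) * u - 1 \<in> P" for a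
    using inv[OF polys_diff[OF y polys_Const] ya] by blast
  then obtain u where u: "\<And>a. u a \<in> polys d" "\<And>a. (y - Const a) * u a - 1 \<in> P" by metis
  define X where "X = (\<lambda>N. {a :: nat \<Rightarrow>\<^sub>0 nat. keys a \<subseteq> {..d} \<and> mdegree a \<le> N})"
  define V where "V = (\<lambda>N. {a. keys (u a) \<subseteq> X N})"
  have "a \<in> V (\<Sum>b\<in>keys (u a). mdegree b)" for a
    unfolding V_def X_def using u(1)[of a] by (auto simp: polys_def intro: member_le_sum)
  then have "(\<Union>N. V N) = UNIV" by blast
  \<comment> \<open>Countably many levels cover the uncountable field, so one level contains
    infinitely many a. Their inverses lie in a space of finite dimension and are linearly
    dependent.\<close>
  then have "\<not> (\<forall>N. countable (V N))"
    using uncountable_UNIV_complex countable_UN[of "UNIV :: nat set" V] by auto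
  then obtain N where "infinite (V N)" using countable_finite by blast
  then obtain A where A: "A \<subseteq> V N" "finite A" "card A = Suc (card (X N))"
    using infinite_arbitrarily_large by blast
  have finX: "finite (X N)" unfolding X_def by (rule finite_bounded_exponents)
  have "card (X N) < card A" using A(3) by simp
  from homogeneous_system_nontrivial_solution_UNIV[OF finX A(2) this, of "\<lambda>e a. lookup (u a) e"]
  obtain c where c: "\<exists>a\<in>A. c a \<noteq> 0" "\<forall>e\<in>X N. (\<Sum>a\<in>A. lookup (u a) e * c a) = 0"
    by (elim exE conjE)
  have sum0: "(\<Sum>a\<in>A. Const (c a) * u a) = 0"
  proof (rule poly_mapping_eqI)
    fix e
    have "lookup (Const (c a) * u a) e = lookup (u a) e * c a" for a
      using lookup_single_mult[of 0 "c a" "u a" e] by (simp add: mult.commute)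
    then have "lookup (\<Sum>a\<in>A. Const (c a) * u a) e = (\<Sum>a\<in>A. lookup (u a) e * c a)"
      by (simp add: lookup_sum)
    also have "\<dots> = 0"
    proof (cases "e \<in> X N")
      case False
      then have "lookup (u a) e = 0" if "a \<in> A" for a
        using that A(1) unfolding V_def by (auto simp: in_keys_iff subset_iff)
      then show ?thesis by simp
    qed (use c(2) in blast)
    finally show "lookup (\<Sum>a\<in>A. Const (c a) * u a) e = lookup 0 e" by simp
  qed
  \<comment> \<open>The numerator of the sum of the fractions c(a) / (Y - a) in an indeterminate Y.
    It is nonzero, since at \<open>a0\<close> only the summand with \<open>a = a0\<close> survives,
    while its value at \<open>y\<close> lies in \<open>P\<close> by the dependence of the
    inverses.\<close>
  define q where "q = (\<Sum>a\<in>A. smult (c a) (\<Prod>b\<in>A - {a}. [:- b, 1:]))"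
  obtain a0 where a0: "a0 \<in> A" "c a0 \<noteq> 0" using c(1) by blast
  have "poly q a0 = (\<Sum>a\<in>A. if a = a0 then c a0 * (\<Prod>b\<in>A - {a0}. a0 - b) else 0)"
    unfolding q_def poly_sum
  proof (rule sum.cong[OF refl])
    fix a assume a: "a \<in> A"
    show "poly (smult (c a) (\<Prod>b\<in>A - {a}. [:- b, 1:])) a0
        = (if a = a0 then c a0 * (\<Prod>b\<in>A - {a0}. a0 - b) else 0)"
    proof (cases "a = a0")
      case False
      then have "(\<Prod>b\<in>A - {a}. a0 - b) = 0" using a0(1) A(2) by (intro prod_zero) auto
      then show ?thesis using False by (simp add: poly_prod)
    qed (simp add: poly_prod)
  qed
  also have "\<dots> = c a0 * (\<Prod>b\<in>A - {a0}. a0 - b)" using a0(1) A(2) by simp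
  also have "\<dots> \<noteq> 0" using a0(2) A(2) by auto
  finally have "q \<noteq> 0" by auto
  have term_P: "(\<Prod>b\<in>A - {a}. y - Const b) - (\<Prod>b\<in>A. y - Const b) * u a \<in> P" if "a \<in> A" for a
  proof -
    have pr: "(\<Prod>b\<in>A. y - Const b) = (y - Const a) * (\<Prod>b\<in>A - {a}. y - Const b)"
      using that A(2) by (simp add: prod.remove)
    have "- (\<Prod>b\<in>A - {a}. y - Const b) * ((y - Const a) * u a - 1) \<in> P"
      by (rule ideal_polysD(4)[OF iP u(2)]) (use y in \<open>auto intro!: polys_prod\<close>)
    then show ?thesis unfolding pr by (simp add: algebra_simps)
  qed
  have "const_poly_eval q y = (\<Sum>a\<in>A. Const (c a) * (\<Prod>b\<in>A - {a}. y - Const b))"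
    unfolding q_def const_poly_eval_sum const_poly_eval_smult const_poly_eval_prod ..
  also have "\<dots> = (\<Sum>a\<in>A. Const (c a) * ((\<Prod>b\<in>A - {a}. y - Const b) - (\<Prod>b\<in>A. y - Const b) * u a))"
  proof -
    have "(\<Sum>a\<in>A. Const (c a) * ((\<Prod>b\<in>A. y - Const b) * u a)) = (\<Prod>b\<in>A. y - Const b) * (\<Sum>a\<in>A. Const (c a) * u a)"
      unfolding sum_distrib_left by (intro sum.cong refl) (simp only: ac_simps)
    then show ?thesis using sum0 by (simp add: right_diff_distrib sum_subtractf)
  qed
  also have "\<dots> \<in> P"
    by (intro ideal_polys_sum[OF iP] ideal_polysD(4)[OF iP] term_P polys_Const)
  finally show False
    using const_poly_eval_not_in_prime[OF P y ya \<open>q \<noteq> 0\<close>] by blast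
qed

section \<open>The vanishing ideal\<close>

definition param_kernel :: "nat \<Rightarrow> cpoly set" where
  "param_kernel d = {f \<in> polys d. param f = 0}"

definition minors :: "nat \<Rightarrow> cpoly set" where
  "minors d = {ig_minor a b c | a b c. a < b \<and> b < c \<and> c < d}"

lemma param_kernel_ideal: "ideal (param_kernel d) (poly_ring d)"
  by (rule ideal_polysI) (auto simp: param_kernel_def)

lemma param_kernel_prime: "primeideal (param_kernel d) (poly_ring d)"
proof (rule primeidealI[OF param_kernel_ideal cring_poly_ring])
  have "1 \<notin> param_kernel d" by (simp add: param_kernel_def)
  then show "carrier (poly_ring d) \<noteq> param_kernel d" using polys_1[of d] by auto
  fix f g assume "f \<in> carrier (poly_ring d)" "g \<in> carrier (poly_ring d)"
    "f \<otimes>\<^bsub>poly_ring d\<^esub> g \<in> param_kernel d"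
  then show "f \<in> param_kernel d \<or> g \<in> param_kernel d" by (simp add: param_kernel_def)
qed

lemma minors_in_kernel: "minors d \<subseteq> param_kernel d"
  unfolding minors_def param_kernel_def using ig_minor_polys param_ig_minor by blast

lemma minors_polys: "minors d \<subseteq> carrier (poly_ring d)"
  using minors_in_kernel by (auto simp: param_kernel_def)

lemma reduce_mod_kernel:
  assumes "d \<ge> 3" "f \<in> polys d"
  shows "\<exists>r. reduced d r \<and> f - r \<in> Idl\<^bsub>poly_ring d\<^esub> minors d \<and> f - r \<in> param_kernel d"
proof -
  let ?J = "Idl\<^bsub>poly_ring d\<^esub> minors d"
  have J: "ideal ?J (poly_ring d)" by (rule PR.genideal_ideal[OF minors_polys])
  have "ig_minor a b c \<in> ?J" if "a < b" "b < c" "c < d" for a b c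
    using PR.genideal_self[OF minors_polys, of d] that unfolding minors_def by blast
  then obtain r where "reduced d r" "f - r \<in> ?J" using reduce_poly[OF assms(1) J _ assms(2)] by auto
  moreover have "?J \<subseteq> param_kernel d"
    by (rule PR.genideal_minimal[OF param_kernel_ideal minors_in_kernel])
  ultimately show ?thesis by blast
qed

lemma reduced_in_kernel:
  assumes d: "d \<ge> 3" and r: "reduced d r" "r \<in> param_kernel d"
  shows "r = 0"
proof (rule reduced_param_eq_0[OF d r(1)])
  show "param r = 0" using r(2) by (simp add: param_kernel_def)
  fix f assume "f \<in> polys d"
  from reduce_mod_kernel[OF d this] obtain s where "reduced d s" "f - s \<in> param_kernel d"
    by (elim exE conjE)
  then show "\<exists>s. reduced d s \<and> param f = param s" by (intro exI[of _ s]) (simp add: param_kernel_def)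
qed

lemma param_kernel_eq_minor_ideal:
  assumes d: "d \<ge> 3"
  shows "param_kernel d = Idl\<^bsub>poly_ring d\<^esub> minors d"
proof
  show "Idl\<^bsub>poly_ring d\<^esub> minors d \<subseteq> param_kernel d"
    by (rule PR.genideal_minimal[OF param_kernel_ideal minors_in_kernel])
  show "param_kernel d \<subseteq> Idl\<^bsub>poly_ring d\<^esub> minors d"
  proof
    fix f assume f: "f \<in> param_kernel d"
    then have "f \<in> polys d" by (simp add: param_kernel_def)
    from reduce_mod_kernel[OF d this]
    obtain r where r: "reduced d r" "f - r \<in> Idl\<^bsub>poly_ring d\<^esub> minors d" "f - r \<in> param_kernel d"
      by (elim exE conjE)
    have "r = f - (f - r)" by simp
    then have "r \<in> param_kernel d" using ideal_polysD(7)[OF param_kernel_ideal f r(3)] by simp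
    then have "r = 0" by (rule reduced_in_kernel[OF d r(1)])
    then show "f \<in> Idl\<^bsub>poly_ring d\<^esub> minors d" using r(2) by simp
  qed
qed

text \<open>One inclusion holds because the generators of the vanishing ideal lie in the kernel. For
  the other, the kernel is generated by the minors, which are homogeneous and therefore among those
  generators.\<close>

lemma vanishing_ideal_eq_kernel:
  assumes d: "d \<ge> 3"
  shows "vanishing_ideal d (ig_moment_variety d) = param_kernel d"
proof
  let ?H = "{f \<in> homogeneous_polys d. param f = 0}"
  have H: "?H \<subseteq> param_kernel d" by (auto simp: homogeneous_polys_def param_kernel_def)
  then show "vanishing_ideal d (ig_moment_variety d) \<subseteq> param_kernel d"
    unfolding vanishing_ideal_conv_param by (rule PR.genideal_minimal[OF param_kernel_ideal])
  have "?H \<subseteq> carrier (poly_ring d)" by (auto simp: homogeneous_polys_def)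
  note gen = PR.genideal_ideal[OF this] PR.genideal_self[OF this]
  have "minors d \<subseteq> ?H"
  proof
    fix f assume "f \<in> minors d"
    then obtain a b c where f: "f = ig_minor a b c" "a < b" "b < c" "c < d" by (auto simp: minors_def)
    then show "f \<in> ?H"
      unfolding homogeneous_polys_def
      using ig_minor_polys[OF f(2-4)] param_ig_minor ig_minor_keys(3)[OF f(2,3)] by auto
  qed
  then show "param_kernel d \<subseteq> vanishing_ideal d (ig_moment_variety d)"
    unfolding vanishing_ideal_conv_param param_kernel_eq_minor_ideal[OF d]
    using gen by (intro PR.genideal_minimal) auto
qed

section \<open>Counting the minors\<close>

lemma sorted_triple:
  fixes J :: "nat set"
  assumes "card J = 3"
  obtains a b c where "a < b" "b < c" "J = {a, b, c}"
proof -
  obtain x y z where *: "J = {x, y, z}" "x \<noteq> y" "y \<noteq> z" "x \<noteq> z"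
    using assms unfolding card_3_iff by (elim exE conjE)
  consider "x < y" "y < z" | "x < z" "z < y" | "y < x" "x < z" | "y < z" "z < x" | "z < x" "x < y" | "z < y" "y < x"
    using *(2-4) by linarith
  then show thesis
  proof cases
    case 1 show ?thesis by (rule that[OF 1]) (use * in auto)
  next
    case 2 show ?thesis by (rule that[OF 2]) (use * in auto)
  next
    case 3 show ?thesis by (rule that[OF 3]) (use * in auto)
  next
    case 4 show ?thesis by (rule that[OF 4]) (use * in auto)
  next
    case 5 show ?thesis by (rule that[OF 5]) (use * in auto)
  next
    case 6 show ?thesis by (rule that[OF 6]) (use * in auto)
  qed
qed

definition minor_of :: "nat \<Rightarrow> nat set \<Rightarrow> cpoly" where
  "minor_of d J = det (submatrix (ig_matrix d) UNIV J)"

lemma minor_of_cases: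
  assumes "J \<subseteq> {..<d}" "card J = 3"
  obtains a b c where "a < b" "b < c" "c < d" "J = {a, b, c}" "minor_of d J = ig_minor a b c"
proof -
  obtain a b c where *: "a < b" "b < c" "J = {a, b, c}" using sorted_triple[OF assms(2)] .
  then have "c < d" using assms(1) by auto
  then show thesis using that * det_submatrix_ig_matrix unfolding minor_of_def by blast
qed

lemma maximal_minors_ig_matrix:
  "maximal_minors (ig_matrix d) = minor_of d ` {J. J \<subseteq> {..<d} \<and> card J = 3}"
  unfolding maximal_minors_def minor_of_def by (auto simp: ig_matrix_def)

lemma minor_of_inj: "inj_on (minor_of d) {J. J \<subseteq> {..<d} \<and> card J = 3}"
proof (rule inj_onI)
  fix J J' assume J: "J \<in> {J. J \<subseteq> {..<d} \<and> card J = 3}" "J' \<in> {J. J \<subseteq> {..<d} \<and> card J = 3}"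
    and eq: "minor_of d J = minor_of d J'"
  obtain a b c where 1: "a < b" "b < c" "c < d" "J = {a, b, c}" "minor_of d J = ig_minor a b c"
    by (rule minor_of_cases[of J d]) (use J in auto)
  obtain a' b' c' where 2: "a' < b'" "b' < c'" "c' < d" "J' = {a', b', c'}" "minor_of d J' = ig_minor a' b' c'"
    by (rule minor_of_cases[of J' d]) (use J in auto)
  have "a = a' \<and> b = b' \<and> c = c'"
    by (rule ig_minor_inj[OF 1(1,2) 2(1,2)]) (use eq 1(5) 2(5) in simp)
  then show "J = J'" by (simp add: 1(4) 2(4))
qed

lemma maximal_minors_eq_minors: "maximal_minors (ig_matrix d) = minors d"
proof
  show "maximal_minors (ig_matrix d) \<subseteq> minors d"
  proof
    fix f assume "f \<in> maximal_minors (ig_matrix d)"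
    then obtain J where J: "J \<subseteq> {..<d}" "card J = 3" "f = minor_of d J"
      unfolding maximal_minors_ig_matrix by auto
    obtain a b c where "a < b" "b < c" "c < d" "minor_of d J = ig_minor a b c"
      by (rule minor_of_cases[OF J(1,2)])
    then show "f \<in> minors d" unfolding J(3) minors_def by blast
  qed
  show "minors d \<subseteq> maximal_minors (ig_matrix d)"
  proof
    fix f assume "f \<in> minors d"
    then obtain a b c where f: "f = ig_minor a b c" "a < b" "b < c" "c < d" by (auto simp: minors_def)
    show "f \<in> maximal_minors (ig_matrix d)"
      unfolding maximal_minors_ig_matrix
      by (rule image_eqI[of _ _ "{a, b, c}"])
        (use f det_submatrix_ig_matrix[OF f(2-4)] in \<open>auto simp: minor_of_def\<close>)
  qed
qed

text \<open>Only the first column has quadratic entries. Choosing three of the other d - 1 columns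
  gives the cubics; the first column together with two others gives the quartics.\<close>

lemma minors_split:
  assumes "d \<ge> 3"
  shows "\<exists>C Q. finite C \<and> card C = (d - 1) choose 3 \<and>
          (\<forall>f \<in> C. f \<noteq> 0 \<and> homogeneous_of_degree 3 f) \<and>
          finite Q \<and> card Q = (d - 1) choose 2 \<and>
          (\<forall>f \<in> Q. f \<noteq> 0 \<and> homogeneous_of_degree 4 f) \<and>
          C \<union> Q = maximal_minors (ig_matrix d)"
proof -
  define S where "S = {J. J \<subseteq> {..<d} \<and> card J = 3}"
  define SC where "SC = {J. J \<subseteq> {1..<d} \<and> card J = 3}"
  define SQ where "SQ = insert 0 ` {J. J \<subseteq> {1..<d} \<and> card J = 2}"
  have finJ: "finite J" if "J \<subseteq> {1..<d}" for J using that by (rule finite_subset) simp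
  have sub: "SC \<subseteq> S" "SQ \<subseteq> S"
    unfolding SC_def SQ_def S_def using assms finJ by (auto simp: card_insert_if subset_iff)
  have S: "S = SC \<union> SQ"
  proof (rule equalityI)
    show "S \<subseteq> SC \<union> SQ"
    proof
      fix J assume J: "J \<in> S"
      show "J \<in> SC \<union> SQ"
      proof (cases "0 \<in> J")
        case True
        have "J - {0} \<in> {J. J \<subseteq> {1..<d} \<and> card J = 2}"
          using J True by (auto simp: S_def card_Diff_singleton Suc_le_eq intro: gr0I)
        moreover have "J = insert 0 (J - {0})" using True by blast
        ultimately show ?thesis unfolding SQ_def by blast
      next
        case False
        have "J \<subseteq> {1..<d}"
        proof
          fix j assume "j \<in> J"
          then have "j \<noteq> 0" "j < d" using False J by (metis, auto simp: S_def)
          then show "j \<in> {1..<d}" by simp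
        qed
        then show ?thesis using J by (simp add: SC_def S_def)
      qed
    qed
  qed (use sub in blast)
  have inj: "inj_on (minor_of d) SC" "inj_on (minor_of d) SQ"
    using minor_of_inj[of d] sub unfolding S_def by (auto intro: inj_on_subset)
  have card_SC: "card SC = (d - 1) choose 3"
    unfolding SC_def using n_subsets[of "{1..<d}" 3] by simp
  have "card SQ = card {J. J \<subseteq> {1..<d} \<and> card J = 2}"
    unfolding SQ_def
  proof (rule card_image, rule inj_onI)
    fix J J' assume *: "J \<in> {J. J \<subseteq> {1..<d} \<and> card J = 2}" "J' \<in> {J. J \<subseteq> {1..<d} \<and> card J = 2}"
      "insert 0 J = insert 0 J'"
    then have "0 \<notin> J" "0 \<notin> J'" by auto
    with *(3) show "J = J'" by (metis insert_ident)
  qed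
  also have "\<dots> = (d - 1) choose 2" using n_subsets[of "{1..<d}" 2] by simp
  finally have card_SQ: "card SQ = (d - 1) choose 2" .
  have "finite S" unfolding S_def by simp
  then have fin: "finite SC" "finite SQ" using sub by (auto intro: finite_subset)
  have C: "f \<noteq> 0 \<and> homogeneous_of_degree 3 f" if fC: "f \<in> minor_of d ` SC" for f
  proof -
    obtain J where J: "J \<in> SC" "f = minor_of d J" using fC by blast
    then have JS: "J \<subseteq> {..<d}" "card J = 3" using sub unfolding S_def by blast+
    have "0 \<notin> J" using J(1) unfolding SC_def by auto
    obtain a b c where *: "a < b" "b < c" "J = {a, b, c}" "minor_of d J = ig_minor a b c"
      by (rule minor_of_cases[OF JS])
    then have "a \<noteq> 0" using \<open>0 \<notin> J\<close> by auto
    then show ?thesis using ig_minor_keys(3,4)[OF *(1,2)] J(2) *(4) by simp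
  qed
  have Q: "f \<noteq> 0 \<and> homogeneous_of_degree 4 f" if fC: "f \<in> minor_of d ` SQ" for f
  proof -
    obtain J where J: "J \<in> SQ" "f = minor_of d J" using fC by blast
    then have JS: "J \<subseteq> {..<d}" "card J = 3" using sub unfolding S_def by blast+
    have "0 \<in> J" using J(1) unfolding SQ_def by auto
    obtain a b c where *: "a < b" "b < c" "J = {a, b, c}" "minor_of d J = ig_minor a b c"
      by (rule minor_of_cases[OF JS])
    then have "a = 0" using \<open>0 \<in> J\<close> by auto
    then show ?thesis using ig_minor_keys(3,4)[OF *(1,2)] J(2) *(4) by simp
  qed
  have "minor_of d ` SC \<union> minor_of d ` SQ = maximal_minors (ig_matrix d)"
    unfolding maximal_minors_ig_matrix S_def[symmetric] by (simp only: S image_Un)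
  then show ?thesis
    using C Q fin card_image[OF inj(1)] card_image[OF inj(2)] card_SC card_SQ
    by (intro exI[of _ "minor_of d ` SC"] exI[of _ "minor_of d ` SQ"]) simp
qed

section \<open>A regular sequence of length three\<close>

lemma polys_induct [consumes 1, case_names Const Var add mult]:
  assumes "f \<in> polys d" "\<And>c. P (Const c)" "\<And>i. i \<le> d \<Longrightarrow> P (Var i)"
    "\<And>f g. f \<in> polys d \<Longrightarrow> g \<in> polys d \<Longrightarrow> P f \<Longrightarrow> P g \<Longrightarrow> P (f + g)"
    "\<And>f g. f \<in> polys d \<Longrightarrow> g \<in> polys d \<Longrightarrow> P f \<Longrightarrow> P g \<Longrightarrow> P (f * g)"
  shows "P f"
proof -
  have pow: "P (Var i ^ k)" if "i \<le> d" for i k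
  proof (induction k)
    case 0
    then show ?case using assms(2)[of 1] by simp
  next
    case (Suc k)
    then show ?case using assms(3,5) that by simp
  qed
  have mono_prod: "monomial (\<Sum>i\<in>A. exp_single i (e i)) = (\<Prod>i\<in>A. Var i ^ e i)" for A and e :: "nat \<Rightarrow> nat"
  proof (induction A rule: infinite_finite_induct)
    case (insert i A)
    have pw: "Var i ^ k = monomial (exp_single i k)" for k
      by (induction k) (simp_all add: Var_def mult_single single_add[symmetric])
    have "monomial (\<Sum>i\<in>insert i A. exp_single i (e i)) = monomial (exp_single i (e i)) * monomial (\<Sum>i\<in>A. exp_single i (e i))"
      using insert.hyps by (simp add: mult_single)
    also have "\<dots> = Var i ^ e i * (\<Prod>i\<in>A. Var i ^ e i)" unfolding insert.IH pw ..
    finally show ?case using insert.hyps by simp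
  qed simp_all
  have P_prod: "P (\<Prod>i\<in>A. Var i ^ e i)" if "A \<subseteq> {..d}" for A and e :: "nat \<Rightarrow> nat"
    using finite_subset[OF that finite_atMost] that
  proof (induction A)
    case empty
    then show ?case using assms(2)[of 1] by simp
  next
    case (insert i A)
    then show ?case using pow[of i "e i"] by (auto intro!: assms(5) polys_prod polys_power)
  qed
  have P_single: "P (Poly_Mapping.single a c)" if "keys a \<subseteq> {..d}" for a c
  proof -
    have m: "monomial a = (\<Prod>i\<in>keys a. Var i ^ lookup a i)"
      using mono_prod[of "lookup a" "keys a"] by (simp only: cpoly_eq_sum_single[symmetric])
    have "P (monomial a)" unfolding m by (rule P_prod[OF that])
    then show ?thesis
      unfolding single_eq_Const_mult_mono[of a c]
      using that by (intro assms(5) assms(2)) (auto simp: polys_single)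
  qed
  have "P (\<Sum>a\<in>A. Poly_Mapping.single a (lookup f a))" if "finite A" "A \<subseteq> keys f" for A
    using that
  proof induction
    case empty
    then show ?case using assms(2)[of 0] by simp
  next
    case (insert a A)
    have k: "keys b \<subseteq> {..d}" if "b \<in> insert a A" for b
      using insert.prems that assms(1) by (auto simp: polys_def)
    have "P (Poly_Mapping.single a (lookup f a) + (\<Sum>a\<in>A. Poly_Mapping.single a (lookup f a)))"
      using insert k by (intro assms(4) P_single polys_sum polys_single) auto
    then show ?case using insert.hyps by simp
  qed
  from this[of "keys f"] show ?thesis by (simp add: cpoly_eq_sum_single[symmetric])
qed

section \<open>Translated coordinates and specialization\<close>

definition linear_form :: "(nat \<Rightarrow> complex) \<Rightarrow> nat \<Rightarrow> cpoly" where
  "linear_form v j = Var j - Const (v j)"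

definition specialize :: "(nat \<Rightarrow> complex) \<Rightarrow> nat set \<Rightarrow> cpoly \<Rightarrow> cpoly" where
  "specialize v T = subst_poly Const (\<lambda>j. if j \<in> T then Const (v j) else Var j)"

lemma specialize_simps [simp]:
  "specialize v T 0 = 0" "specialize v T (f + g) = specialize v T f + specialize v T g"
  "specialize v T (f - g) = specialize v T f - specialize v T g"
  "specialize v T (f * g) = specialize v T f * specialize v T g"
  "specialize v T (Const c) = Const c"
  "specialize v T (Var j) = (if j \<in> T then Const (v j) else Var j)"
  "specialize v T (sum F A) = (\<Sum>i\<in>A. specialize v T (F i))"
  by (simp_all add: specialize_def hom_distribs)

lemma specialize_polys: "f \<in> polys d \<Longrightarrow> specialize v T f \<in> polys d"
  by (induction f rule: polys_induct) auto

lemma specialize_linear_form: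
  "specialize v T (linear_form v j) = (if j \<in> T then 0 else linear_form v j)"
  by (simp add: linear_form_def)

lemma linear_form_polys: "j \<le> d \<Longrightarrow> linear_form v j \<in> polys d"
  by (simp add: linear_form_def)

lemma linear_form_nonzero: "linear_form v j \<noteq> 0"
proof
  have ne: "exp_single j (Suc 0) \<noteq> 0"
  proof
    assume "exp_single j (Suc 0) = 0"
    then have "keys (exp_single j (Suc 0)) = keys (0 :: nat \<Rightarrow>\<^sub>0 nat)" by (rule arg_cong)
    then show False by simp
  qed
  assume "linear_form v j = 0"
  then have "lookup (linear_form v j) (exp_single j 1) = 0" by simp
  then show False using ne by (simp add: linear_form_def Var_def lookup_minus lookup_single when_def)
qed

text \<open>Modulo the linear forms every polynomial agrees with its specialization, and
  specialization annihilates the forms; membership is thus tested by substitution. The first claim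
  supplies explicit cofactors, which are later replaced by reduced ones.\<close>

lemma genideal_linear_forms:
  assumes "T \<subseteq> {..d}"
  shows "f \<in> Idl\<^bsub>poly_ring d\<^esub> (linear_form v ` T)
      \<Longrightarrow> \<exists>h. (\<forall>j\<in>T. h j \<in> polys d) \<and> f = (\<Sum>j\<in>T. linear_form v j * h j)"
    and "f \<in> Idl\<^bsub>poly_ring d\<^esub> (linear_form v ` T) \<longleftrightarrow> f \<in> polys d \<and> specialize v T f = 0"
proof -
  let ?X = "linear_form v ` T" and ?\<theta> = "linear_form v"
  let ?I = "Idl\<^bsub>poly_ring d\<^esub> ?X"
  define L where "L = {f. \<exists>h. (\<forall>j\<in>T. h j \<in> polys d) \<and> f = (\<Sum>j\<in>T. ?\<theta> j * h j)}"
  have finT: "finite T" using assms finite_subset by blast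
  have \<theta>: "?\<theta> j \<in> polys d" if "j \<in> T" for j using that assms by (intro linear_form_polys) auto
  then have X: "?X \<subseteq> carrier (poly_ring d)" by auto
  have I: "ideal ?I (poly_ring d)" by (rule PR.genideal_ideal[OF X])
  have \<theta>I: "?\<theta> j \<in> ?I" if "j \<in> T" for j using PR.genideal_self[OF X] that by blast
  have LI: "ideal L (poly_ring d)"
  proof (rule ideal_polysI)
    show "L \<subseteq> polys d" unfolding L_def using \<theta> by (auto intro!: polys_sum)
    show "0 \<in> L" unfolding L_def by (intro CollectI exI[of _ "\<lambda>_. 0"]) simp
    fix f g assume "f \<in> L" "g \<in> L"
    then obtain h k where "\<forall>j\<in>T. h j \<in> polys d" "f = (\<Sum>j\<in>T. ?\<theta> j * h j)"
      "\<forall>j\<in>T. k j \<in> polys d" "g = (\<Sum>j\<in>T. ?\<theta> j * k j)" unfolding L_def by auto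
    then show "f + g \<in> L"
      unfolding L_def by (intro CollectI exI[of _ "\<lambda>j. h j + k j"]) (simp add: distrib_left sum.distrib)
  next
    fix f g assume "f \<in> L" "g \<in> polys d"
    then obtain h where "\<forall>j\<in>T. h j \<in> polys d" "f = (\<Sum>j\<in>T. ?\<theta> j * h j)" unfolding L_def by auto
    then show "g * f \<in> L"
      unfolding L_def using \<open>g \<in> polys d\<close>
      by (intro CollectI exI[of _ "\<lambda>j. g * h j"]) (simp add: sum_distrib_left ac_simps)
  qed
  have "?X \<subseteq> L"
  proof
    fix f assume "f \<in> ?X"
    then obtain i where i: "i \<in> T" "f = ?\<theta> i" by blast
    have "(\<Sum>j\<in>T. ?\<theta> j * (if j = i then 1 else 0)) = (\<Sum>j\<in>T. if j = i then ?\<theta> j else 0)"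
      by (intro sum.cong) auto
    also have "\<dots> = f" using finT i by simp
    finally show "f \<in> L"
      unfolding L_def by (intro CollectI exI[of _ "\<lambda>j. if j = i then 1 else 0"]) simp
  qed
  then have IL: "?I \<subseteq> L" by (rule PR.genideal_minimal[OF LI])
  then show "\<exists>h. (\<forall>j\<in>T. h j \<in> polys d) \<and> f = (\<Sum>j\<in>T. linear_form v j * h j)" if "f \<in> ?I"
    using that unfolding L_def by blast
  have diff: "f - specialize v T f \<in> ?I" if "f \<in> polys d" for f
    using that
  proof (induction f rule: polys_induct)
    case (Const c)
    then show ?case using ideal_polysD(1)[OF I] by simp
  next
    case (Var i)
    then show ?case using ideal_polysD(1)[OF I] \<theta>I[of i] by (simp add: linear_form_def)
  next
    case (add f g)
    have eq: "f + g - specialize v T (f + g) = (f - specialize v T f) + (g - specialize v T g)" by simp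
    show ?case unfolding eq by (rule ideal_polysD(3)[OF I add.IH])
  next
    case (mult f g)
    have eq: "f * g - specialize v T (f * g) = f * (g - specialize v T g) + specialize v T g * (f - specialize v T f)"
      by (simp add: algebra_simps)
    show ?case
      unfolding eq by (rule ideal_polysD(3)[OF I ideal_polysD(4)[OF I mult.IH(2) mult.hyps(1)]
          ideal_polysD(4)[OF I mult.IH(1) specialize_polys[OF mult.hyps(2)]]])
  qed
  show "f \<in> ?I \<longleftrightarrow> f \<in> polys d \<and> specialize v T f = 0"
  proof
    assume f: "f \<in> ?I"
    then obtain h where h: "f = (\<Sum>j\<in>T. ?\<theta> j * h j)" using IL unfolding L_def by blast
    show "f \<in> polys d \<and> specialize v T f = 0"
      using ideal_polysD(2)[OF I f] unfolding h by (simp add: specialize_linear_form)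
  next
    assume "f \<in> polys d \<and> specialize v T f = 0"
    then show "f \<in> ?I" using diff[of f] by simp
  qed
qed

text \<open>The condition \<open>standard\<close> ignores the exponents of m_0, m_{d-1} and m_d, so
  the reduced polynomials form a module over \<open>A\<close>.\<close>

lemma reduced_linear_form_mult:
  assumes d: "d \<ge> 3" and r: "reduced d r" and j: "j \<in> {0, d - 1, d}"
  shows "reduced d (linear_form v j * r)"
proof -
  have "reduced d (Var j * r)"
    unfolding reduced_def
  proof (intro conjI ballI)
    show "Var j * r \<in> polys d" using r j unfolding reduced_def by (intro polys_mult polys_Var) auto
    fix e assume "e \<in> keys (Var j * r)"
    then obtain a where a: "a \<in> keys r" "e = exp_single j 1 + a"
      using Poly_Mapping.keys_mult[of "Var j" r] by (auto simp: Var_def)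
    have "lookup e i = lookup a i" if "i \<in> {1..d-2}" for i
      using that j d by (auto simp: a(2) lookup_add lookup_single when_def)
    then have "lookup e 1 = lookup a 1" "(\<Sum>i\<in>{2..d-2}. lookup e i) = (\<Sum>i\<in>{2..d-2}. lookup a i)"
      using d by (auto intro!: sum.cong)
    moreover have "standard d a" using r a(1) unfolding reduced_def by blast
    ultimately show "standard d e" by (simp add: standard_def)
  qed
  then show ?thesis
    unfolding linear_form_def left_diff_distrib by (intro reduced_diff reduced_Const_mult r)
qed

text \<open>Both sides may be replaced by reduced representatives, on which congruence modulo the kernel
  is equality.\<close>

lemma linear_form_regular:
  assumes d: "d \<ge> 3" and j: "j \<in> {0, d - 1, d}" and T: "T \<subseteq> {0, d - 1, d}" "j \<notin> T"
    and f: "f \<in> polys d" and l: "l \<in> Idl\<^bsub>poly_ring d\<^esub> (linear_form v ` T)"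
    and fl: "linear_form v j * f - l \<in> param_kernel d"
  shows "\<exists>r \<in> Idl\<^bsub>poly_ring d\<^esub> (linear_form v ` T). f - r \<in> param_kernel d"
proof -
  let ?K = "param_kernel d" and ?\<theta> = "linear_form v"
  note K = param_kernel_ideal[of d]
  have Td: "T \<subseteq> {..d}" and jd: "j \<le> d" using T(1) j by auto
  have \<theta>: "?\<theta> i \<in> polys d" if "i \<in> {0, d - 1, d}" for i
    using that by (intro linear_form_polys) auto
  have nf: "\<exists>r. reduced d r \<and> g - r \<in> ?K" if "g \<in> polys d" for g
    using reduce_mod_kernel[OF d that] by blast
  obtain h where h: "\<forall>i\<in>T. h i \<in> polys d" "l = (\<Sum>i\<in>T. ?\<theta> i * h i)"
    using genideal_linear_forms(1)[OF Td l] by (elim exE conjE)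
  have "\<forall>i\<in>T. \<exists>r. reduced d r \<and> h i - r \<in> ?K" using nf h(1) by blast
  then obtain R where R: "\<forall>i\<in>T. reduced d (R i) \<and> h i - R i \<in> ?K" by (rule bchoice[THEN exE])
  obtain r where r: "reduced d r" "f - r \<in> ?K" using nf[OF f] by (elim exE conjE)
  define l' where "l' = (\<Sum>i\<in>T. ?\<theta> i * R i)"
  have red_sum: "reduced d (\<Sum>i\<in>A. ?\<theta> i * R i)" if "A \<subseteq> T" for A
    using finite_subset[OF that finite_subset[OF Td finite_atMost]] that
  proof (induction A)
    case (insert i A)
    then have "reduced d (?\<theta> i * R i)"
      using R T(1) by (intro reduced_linear_form_mult[OF d]) auto
    then show ?case using insert by (simp add: reduced_add)
  qed (simp add: reduced_0)
  have red: "reduced d (?\<theta> j * r - l')"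
    unfolding l'_def using red_sum[OF order_refl]
    by (intro reduced_diff reduced_linear_form_mult[OF d r(1) j])
  have "l - l' = (\<Sum>i\<in>T. ?\<theta> i * (h i - R i))"
    by (simp add: h(2) l'_def sum_subtractf right_diff_distrib)
  moreover have "(\<Sum>i\<in>T. ?\<theta> i * (h i - R i)) \<in> ?K"
    using R T(1) by (intro ideal_polys_sum[OF K] ideal_polysD(4)[OF K] \<theta>) auto
  ultimately have ll: "l - l' \<in> ?K" by simp
  have "?\<theta> j * (f - r) \<in> ?K" by (rule ideal_polysD(4)[OF K r(2) \<theta>[OF j]])
  from ideal_polysD(7)[OF K ideal_polysD(3)[OF K fl ll] this]
  have "?\<theta> j * r - l' \<in> ?K" by (simp add: right_diff_distrib)
  then have eq: "?\<theta> j * r - l' = 0" by (rule reduced_in_kernel[OF d red])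
  \<comment> \<open>The congruence has become an equation of polynomials. Specializing the
    coordinates in \<open>T\<close> kills \<open>l'\<close> and leaves the form of \<open>j\<close>
    intact, which then cancels in the domain.\<close>
  have "specialize v T l' = 0" by (simp add: l'_def specialize_linear_form)
  moreover have "specialize v T (?\<theta> j * r - l') = 0" by (simp only: eq specialize_simps)
  ultimately have "?\<theta> j * specialize v T r = 0" using T(2) by (simp add: specialize_linear_form)
  then have "specialize v T r = 0" using linear_form_nonzero by (simp only: mult_eq_0_iff) blast
  then have "r \<in> Idl\<^bsub>poly_ring d\<^esub> (?\<theta> ` T)"
    using genideal_linear_forms(2)[OF Td] r(1) by (simp add: reduced_def)
  then show ?thesis using r(2) by blast
qed

section \<open>The coordinate ring\<close>

text \<open>Lets generated ideals of the quotient be computed upstairs, where the polynomial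
  arguments apply.\<close>

lemma (in ring) genideal_quot:
  assumes I: "ideal I R" and A: "A \<subseteq> carrier R"
  shows "Idl\<^bsub>R Quot I\<^esub> ((+>) I ` A) = (+>) I ` (Idl A)"
proof
  interpret I: ideal I R by fact
  interpret Q: ring "R Quot I" by (rule I.quotient_is_ring)
  interpret h: ring_hom_ring R "R Quot I" "(+>) I" by (rule I.rcos_ring_hom_ring)
  have A': "(+>) I ` A \<subseteq> carrier (R Quot I)" using A h.hom_closed by blast
  show "Idl\<^bsub>R Quot I\<^esub> ((+>) I ` A) \<subseteq> (+>) I ` (Idl A)"
    by (rule Q.genideal_minimal[OF ring_ideal_imp_quot_ideal[OF I genideal_ideal[OF A]]])
      (intro image_mono genideal_self[OF A])
  have "ideal {r \<in> carrier R. I +> r \<in> Idl\<^bsub>R Quot I\<^esub> ((+>) I ` A)} R"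
    by (rule h.ideal_vimage[OF Q.genideal_ideal[OF A']])
  moreover have "A \<subseteq> {r \<in> carrier R. I +> r \<in> Idl\<^bsub>R Quot I\<^esub> ((+>) I ` A)}"
    using A Q.genideal_self[OF A'] by blast
  ultimately have "Idl A \<subseteq> {r \<in> carrier R. I +> r \<in> Idl\<^bsub>R Quot I\<^esub> ((+>) I ` A)}"
    by (rule genideal_minimal)
  then show "(+>) I ` (Idl A) \<subseteq> Idl\<^bsub>R Quot I\<^esub> ((+>) I ` A)" by blast
qed

lemma (in ring) noetherian_quot:
  assumes N: "noetherian_ring R" and I: "ideal I R"
  shows "noetherian_ring (R Quot I)"
proof -
  interpret Q: ring "R Quot I" by (rule ideal.quotient_is_ring[OF I])
  interpret h: ring_hom_ring R "R Quot I" "(+>) I" by (rule ideal.rcos_ring_hom_ring[OF I])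
  show ?thesis
  proof (rule Q.noetherian_ringI)
    fix J assume "ideal J (R Quot I)"
    then obtain J' where J': "ideal J' R" "J = (+>) I ` J'"
      using quot_ideal_correspondence[OF I] unfolding bij_betw_def by blast
    obtain A where A: "A \<subseteq> carrier R" "finite A" "J' = Idl A"
      using noetherian_ring.finetely_gen[OF N J'(1)] by blast
    have "J = Idl\<^bsub>R Quot I\<^esub> ((+>) I ` A)" using genideal_quot[OF I A(1)] J'(2) A(3) by simp
    moreover have "(+>) I ` A \<subseteq> carrier (R Quot I)" using A(1) h.hom_closed by blast
    ultimately show "\<exists>A\<subseteq>carrier (R Quot I). finite A \<and> J = Idl\<^bsub>R Quot I\<^esub> A"
      using A(2) by blast
  qed
qed

section \<open>The Cohen-Macaulay property of the coordinate ring\<close>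

context
  fixes d :: nat
  assumes d: "d \<ge> 3"
begin

abbreviation "ker \<equiv> param_kernel d"
abbreviation "coord_ring \<equiv> poly_ring d Quot ker"
abbreviation "proj \<equiv> \<lambda>f. ker +>\<^bsub>poly_ring d\<^esub> f"

lemma proj_hom: "ring_hom_ring (poly_ring d) coord_ring proj"
  by (rule ideal.rcos_ring_hom_ring[OF param_kernel_ideal])

lemma cring_R: "cring coord_ring"
  by (rule ideal.quotient_is_cring[OF param_kernel_ideal cring_poly_ring])

lemma proj_eq_iff: "f \<in> polys d \<Longrightarrow> g \<in> polys d \<Longrightarrow> proj f = proj g \<longleftrightarrow> f - g \<in> ker"
  using PR.quotient_eq_iff_same_a_r_cos[OF param_kernel_ideal, of f d g] by simp

lemma carrier_R: "carrier coord_ring = proj ` polys d"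
  by (auto simp: FactRing_def A_RCOSETS_def')

definition contraction :: "cpoly set set \<Rightarrow> cpoly set" where
  "contraction M = {f \<in> polys d. proj f \<in> M}"

lemma contraction_prime:
  assumes "primeideal M coord_ring"
  shows "primeideal (contraction M) (poly_ring d)" "ker \<subseteq> contraction M"
proof -
  show "primeideal (contraction M) (poly_ring d)"
    using ring_hom_ring.primeideal_vimage[OF proj_hom cring_poly_ring assms]
    by (simp add: contraction_def)
  have zero: "\<zero>\<^bsub>coord_ring\<^esub> \<in> M"
    by (rule additive_subgroup.zero_closed[OF ideal.axioms(1)[OF primeideal.axioms(1)[OF assms]]])
  show "ker \<subseteq> contraction M"
  proof
    fix f assume f: "f \<in> ker"
    then have fp: "f \<in> polys d" by (simp add: param_kernel_def)
    have "proj f = proj 0" using proj_eq_iff[OF fp polys_0] f by simp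
    also have "proj 0 = \<zero>\<^bsub>coord_ring\<^esub>"
      using PR.a_coset_add_zero[of ker d] by (auto simp: FactRing_def param_kernel_def)
    finally show "f \<in> contraction M" using zero fp by (simp add: contraction_def)
  qed
qed

text \<open>The set \<open>W\<close> is the ideal generated by \<open>g\<close> and the contraction.
  Its image properly contains \<open>M\<close> and is therefore the whole ring, so 1 is a multiple
  of \<open>g\<close> modulo the contraction. This is the field property in the form required by the
  Nullstellensatz.\<close>

lemma contraction_inverse:
  assumes M: "maximalideal M coord_ring" and g: "g \<in> polys d" "g \<notin> contraction M"
  shows "\<exists>u\<in>polys d. g * u - 1 \<in> contraction M"
proof -
  interpret M: maximalideal M coord_ring by fact
  have prime: "primeideal M coord_ring" by (rule cring.maximalideal_prime[OF cring_R M])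
  note cM = contraction_prime[OF prime]
  note iM = primeideal_polysD(1)[OF cM(1)]
  define W where "W = {x \<in> polys d. \<exists>u\<in>polys d. g * u - x \<in> contraction M}"
  have W: "ideal W (poly_ring d)"
  proof (rule ideal_polysI)
    show "W \<subseteq> polys d" by (auto simp: W_def)
    show "0 \<in> W" unfolding W_def using ideal_polysD(1)[OF iM] by (auto intro!: bexI[of _ 0])
    fix x y assume "x \<in> W" "y \<in> W"
    then obtain u w where *: "x \<in> polys d" "y \<in> polys d" "u \<in> polys d" "w \<in> polys d"
      "g * u - x \<in> contraction M" "g * w - y \<in> contraction M" by (auto simp: W_def)
    have eq: "g * (u + w) - (x + y) = (g * u - x) + (g * w - y)" by (simp add: algebra_simps)
    have "g * (u + w) - (x + y) \<in> contraction M" unfolding eq by (rule ideal_polysD(3)[OF iM *(5,6)])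
    then show "x + y \<in> W" using * unfolding W_def by (intro CollectI conjI bexI[of _ "u + w"]) auto
  next
    fix x y assume "x \<in> W" "y \<in> polys d"
    then obtain u where *: "x \<in> polys d" "u \<in> polys d" "g * u - x \<in> contraction M" by (auto simp: W_def)
    have eq: "g * (y * u) - y * x = y * (g * u - x)" by (simp add: algebra_simps)
    have "g * (y * u) - y * x \<in> contraction M" unfolding eq by (rule ideal_polysD(4)[OF iM *(3) \<open>y \<in> polys d\<close>])
    then show "y * x \<in> W" using * \<open>y \<in> polys d\<close> unfolding W_def by (intro CollectI conjI bexI[of _ "y * u"]) auto
  qed
  have cW: "contraction M \<subseteq> W"
  proof
    fix x assume x: "x \<in> contraction M"
    then have "- x \<in> contraction M" by (rule ideal_polysD(6)[OF iM])
    then show "x \<in> W" using x unfolding W_def contraction_def by (intro CollectI conjI bexI[of _ 0]) auto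
  qed
  have gW: "g \<in> W" using g(1) ideal_polysD(1)[OF iM] unfolding W_def by (intro CollectI conjI bexI[of _ 1]) auto
  have iW: "ideal (proj ` W) coord_ring" by (rule PR.ring_ideal_imp_quot_ideal[OF param_kernel_ideal W])
  have "M \<subseteq> proj ` W"
  proof
    fix m assume m: "m \<in> M"
    then have "m \<in> carrier coord_ring" by (rule M.a_Hcarr)
    then obtain f where f: "f \<in> polys d" "m = proj f" unfolding carrier_R by blast
    then have "f \<in> contraction M" using m by (simp add: contraction_def)
    then show "m \<in> proj ` W" using cW f(2) by blast
  qed
  moreover have "proj ` W \<noteq> M"
  proof
    assume "proj ` W = M"
    then have "proj g \<in> M" using gW by blast
    then show False using g by (simp add: contraction_def)
  qed
  moreover have "proj ` W \<subseteq> carrier coord_ring" unfolding carrier_R using ideal_polysD(2)[OF W] by blast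
  ultimately have "proj ` W = carrier coord_ring" using M.I_maximal[OF iW] by blast
  then have "proj 1 \<in> proj ` W" unfolding carrier_R by simp
  then obtain x where x: "x \<in> W" "proj 1 = proj x" by blast
  then have xp: "x \<in> polys d" by (simp add: W_def)
  have x1: "x - 1 \<in> ker" using proj_eq_iff[OF xp polys_1] x(2) by simp
  obtain u where u: "u \<in> polys d" "g * u - x \<in> contraction M" using x(1) by (auto simp: W_def)
  have "x - 1 \<in> contraction M" using x1 cM(2) by blast
  from ideal_polysD(3)[OF iM u(2) this] have "g * u - 1 \<in> contraction M" by simp
  then show ?thesis using u(1) by blast
qed

lemma regular_sequence_in_maximal:
  assumes M: "maximalideal M coord_ring"
  shows "\<exists>xs. regular_sequence coord_ring xs \<and> set xs \<subseteq> M \<and> length xs = 3"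
proof -
  interpret M: maximalideal M coord_ring by fact
  have prime: "primeideal M coord_ring" by (rule cring.maximalideal_prime[OF cring_R M])
  note cM = contraction_prime[OF prime]
  have "\<exists>a. Var j - Const a \<in> contraction M" if "j \<le> d" for j
    by (rule nullstellensatz[OF cM(1)]) (use contraction_inverse[OF M] that in auto)
  then obtain v where v: "\<And>j. j \<le> d \<Longrightarrow> linear_form v j \<in> contraction M"
    unfolding linear_form_def by metis
  let ?\<theta> = "linear_form v"
  define js where "js = [0, d - 1, d]"
  define xs where "xs = map (\<lambda>j. proj (?\<theta> j)) js"
  have js: "distinct js" "set js = {0, d - 1, d}" "length js = 3" using d by (auto simp: js_def)
  have xs_M: "set xs \<subseteq> M"
    using v unfolding xs_def js_def contraction_def by auto
  \<comment> \<open>Carries the regularity condition back to the polynomial ring, where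
    \<open>linear_form_regular\<close> applies.\<close>
  have Idl: "Idl\<^bsub>coord_ring\<^esub> (set (take i xs)) = proj ` (Idl\<^bsub>poly_ring d\<^esub> (?\<theta> ` set (take i js)))" for i
  proof -
    have "set (take i js) \<subseteq> {0, d - 1, d}" using set_take_subset[of i js] js(2) by simp
    then have "?\<theta> ` set (take i js) \<subseteq> carrier (poly_ring d)" using linear_form_polys by auto
    from PR.genideal_quot[OF param_kernel_ideal this] show ?thesis
      by (simp add: xs_def take_map image_image)
  qed
  have "regular_sequence coord_ring xs"
    unfolding regular_sequence_def
  proof (intro conjI allI impI ballI)
    show "set xs \<subseteq> carrier coord_ring" using xs_M M.a_subset by (rule subset_trans)
    have sub: "Idl\<^bsub>coord_ring\<^esub> (set xs) \<subseteq> M" by (rule ring.genideal_minimal[OF cring.axioms(1)[OF cring_R] M.is_ideal xs_M])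
    show "Idl\<^bsub>coord_ring\<^esub> (set xs) \<noteq> carrier coord_ring"
    proof
      assume "Idl\<^bsub>coord_ring\<^esub> (set xs) = carrier coord_ring"
      then have "carrier coord_ring \<subseteq> M" using sub by simp
      then have "carrier coord_ring = M" using M.a_subset by (rule equalityI)
      then show False using M.I_notcarr by simp
    qed
    fix i a assume i: "i < length xs" and a: "a \<in> carrier coord_ring"
      and mem: "xs ! i \<otimes>\<^bsub>coord_ring\<^esub> a \<in> Idl\<^bsub>coord_ring\<^esub> (set (take i xs))"
    let ?T = "set (take i js)"
    have i3: "i < length js" using i by (simp add: xs_def)
    have T: "?T \<subseteq> {0, d - 1, d}" using set_take_subset[of i js] js(2) by simp
    have j: "js ! i \<in> {0, d - 1, d}" using nth_mem[OF i3] js(2) by simp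
    have jT: "js ! i \<notin> ?T"
    proof
      assume "js ! i \<in> ?T"
      then obtain k where "k < i" "js ! k = js ! i" using i3 by (auto simp: in_set_conv_nth)
      then show False using js(1) i3 nth_eq_iff_index_eq[OF js(1), of k i] by simp
    qed
    have \<theta>: "?\<theta> (js ! i) \<in> polys d" using j by (intro linear_form_polys) auto
    from a have "a \<in> proj ` polys d" unfolding carrier_R .
    then obtain f where f: "a = proj f" "f \<in> polys d" by (rule imageE)
    have xi: "xs ! i = proj (?\<theta> (js ! i))" using i3 by (simp add: xs_def)
    have "proj (?\<theta> (js ! i) * f) = proj (?\<theta> (js ! i)) \<otimes>\<^bsub>coord_ring\<^esub> proj f"
      using ring_hom_mult[OF ideal.rcos_ring_hom[OF param_kernel_ideal[of d]], of "?\<theta> (js ! i)" f] \<theta> f(2)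
      by (simp only: poly_ring_simps)
    then have "xs ! i \<otimes>\<^bsub>coord_ring\<^esub> a = proj (?\<theta> (js ! i) * f)" by (simp only: xi f(1))
    then have "proj (?\<theta> (js ! i) * f) \<in> proj ` (Idl\<^bsub>poly_ring d\<^esub> (?\<theta> ` ?T))" using mem unfolding Idl by simp
    then obtain l where l: "proj (?\<theta> (js ! i) * f) = proj l" "l \<in> Idl\<^bsub>poly_ring d\<^esub> (?\<theta> ` ?T)"
      by (rule imageE)
    have Td: "?T \<subseteq> {..d}" using T by auto
    have lp: "l \<in> polys d" using genideal_linear_forms(2)[OF Td] l(2) by simp
    have "?\<theta> (js ! i) * f - l \<in> ker"
      using proj_eq_iff[OF polys_mult[OF \<theta> f(2)] lp] l(1) by simp
    from linear_form_regular[OF d j T jT f(2) l(2) this]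
    obtain r where r: "r \<in> Idl\<^bsub>poly_ring d\<^esub> (?\<theta> ` ?T)" "f - r \<in> ker" by (rule bexE)
    have rp: "r \<in> polys d" using genideal_linear_forms(2)[OF Td] r(1) by simp
    have "a = proj r" unfolding f(1) using proj_eq_iff[OF f(2) rp] r(2) by (rule iffD2)
    then show "a \<in> Idl\<^bsub>coord_ring\<^esub> (set (take i xs))" unfolding Idl using r(1) by (rule image_eqI)
  qed
  then show ?thesis using xs_M js(3) by (intro exI[of _ xs]) (simp add: xs_def)
qed

lemma cohen_macaulay_R: "cohen_macaulay_ring coord_ring"
proof (rule cring.cohen_macaulay_ringI[OF cring_R, where k = 3])
  show "noetherian_ring coord_ring" by (rule PR.noetherian_quot[OF hilbert_basis param_kernel_ideal])
  show "\<exists>xs. regular_sequence coord_ring xs \<and> set xs \<subseteq> M \<and> length xs = 3" if "maximalideal M coord_ring" for M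
    by (rule regular_sequence_in_maximal[OF that])
  fix Q :: "nat \<Rightarrow> cpoly set set"
  assume Q: "\<forall>i\<le>Suc 3. primeideal (Q i) coord_ring" "\<forall>i\<le>3. Q i \<subset> Q (Suc i)"
  show False
  proof (rule no_long_prime_chain[of "\<lambda>i. contraction (Q i)" d])
    show "primeideal (contraction (Q i)) (poly_ring d)" if "i \<le> 4" for i
      using Q(1) that by (intro contraction_prime) simp
    show "{f \<in> polys d. param f = 0} \<subseteq> contraction (Q 0)"
      using contraction_prime(2)[of "Q 0"] Q(1) by (simp add: param_kernel_def)
    \<comment> \<open>Strictness survives contraction because every element of the quotient is the
      image of a polynomial.\<close>
    show "contraction (Q i) \<subset> contraction (Q (Suc i))" if "i < 4" for i
    proof -
      have sub: "Q i \<subset> Q (Suc i)" using Q(2) that by simp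
      then obtain y where y: "y \<in> Q (Suc i)" "y \<notin> Q i" by blast
      have prime: "primeideal (Q (Suc i)) coord_ring" using Q(1) that by simp
      have "y \<in> carrier coord_ring"
        by (rule ideal.Icarr[OF primeideal.axioms(1)[OF prime] y(1)])
      then have "y \<in> proj ` polys d" unfolding carrier_R .
      then obtain f where f: "y = proj f" "f \<in> polys d" by (rule imageE)
      have "f \<in> contraction (Q (Suc i))" "f \<notin> contraction (Q i)"
        using y f by (simp_all add: contraction_def)
      moreover have "contraction (Q i) \<subseteq> contraction (Q (Suc i))" using sub by (auto simp: contraction_def)
      ultimately show ?thesis by blast
    qed
  qed
qed

end

theorem theorem3p1:
  fixes d :: nat
  assumes "d \<ge> 3"
  shows "homogeneous_ideal d (vanishing_ideal d (ig_moment_variety d))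
    \<and> primeideal (vanishing_ideal d (ig_moment_variety d)) (poly_ring d)
    \<and> (\<exists>C Q. finite C \<and> card C = (d - 1) choose 3 \<and>
          (\<forall>f \<in> C. f \<noteq> 0 \<and> homogeneous_of_degree 3 f) \<and>
          finite Q \<and> card Q = (d - 1) choose 2 \<and>
          (\<forall>f \<in> Q. f \<noteq> 0 \<and> homogeneous_of_degree 4 f) \<and>
          C \<union> Q = maximal_minors (ig_matrix d) \<and>
          vanishing_ideal d (ig_moment_variety d) = Idl\<^bsub>poly_ring d\<^esub> (C \<union> Q))
    \<and> cohen_macaulay_variety d (ig_moment_variety d)"
proof (intro conjI)
  note eq = vanishing_ideal_eq_kernel[OF assms]
  show "homogeneous_ideal d (vanishing_ideal d (ig_moment_variety d))"
    unfolding homogeneous_ideal_def vanishing_ideal_def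
    by (intro exI[of _ "{f \<in> homogeneous_polys d. \<forall>p \<in> ig_moment_variety d. vanishes_at f p}"]) auto
  show "primeideal (vanishing_ideal d (ig_moment_variety d)) (poly_ring d)"
    unfolding eq by (rule param_kernel_prime)
  show "cohen_macaulay_variety d (ig_moment_variety d)"
    unfolding cohen_macaulay_variety_def coordinate_ring_def eq by (rule cohen_macaulay_R[OF assms])
  obtain C Q where CQ: "finite C" "card C = (d - 1) choose 3"
    "\<forall>f \<in> C. f \<noteq> 0 \<and> homogeneous_of_degree 3 f"
    "finite Q" "card Q = (d - 1) choose 2"
    "\<forall>f \<in> Q. f \<noteq> 0 \<and> homogeneous_of_degree 4 f"
    "C \<union> Q = maximal_minors (ig_matrix d)"
    using minors_split[OF assms] by (elim exE conjE)
  have gen: "vanishing_ideal d (ig_moment_variety d) = Idl\<^bsub>poly_ring d\<^esub> (C \<union> Q)"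
    unfolding eq param_kernel_eq_minor_ideal[OF assms] CQ(7) maximal_minors_eq_minors ..
  show "\<exists>C Q. finite C \<and> card C = (d - 1) choose 3 \<and>
          (\<forall>f \<in> C. f \<noteq> 0 \<and> homogeneous_of_degree 3 f) \<and>
          finite Q \<and> card Q = (d - 1) choose 2 \<and>
          (\<forall>f \<in> Q. f \<noteq> 0 \<and> homogeneous_of_degree 4 f) \<and>
          C \<union> Q = maximal_minors (ig_matrix d) \<and>
          vanishing_ideal d (ig_moment_variety d) = Idl\<^bsub>poly_ring d\<^esub> (C \<union> Q)"
    by (rule exI[of _ C], rule exI[of _ Q]) (intro conjI CQ gen)
qed

end
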